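(* Let $H\in(0,1)$ and let $(X_t)_{t\ge 0}$ be a fractional Brownian motion with Hurst index $H$. Let $\mathrm{Rec}=\{t\ge 0 : X_t=\max_{s\in[0,t]}X_s\}$ be its record set. Then, almost surely, the Hausdorff dimension of $\mathrm{Rec}$ satisfies $$\mathrm{Dim}(\mathrm{Rec})=H.$$
   Context: A fractional Brownian motion (fBm) with Hurst index $H\in(0,1)$ is a real-valued Gaussian process $(X_t)_{t\ge 0}$ with continuous sample paths, mean $0$, and covariance $\mathbb{E}[X_tX_s]=\frac12\left(|t|^{2H}+|s|^{2H}-|t-s|^{2H}\right)$. For a metric space $E$, a covering $\mathfrak{E}=\{E_1,E_2,\dots\}$ of $E$ and $\alpha\ge 0$, the $\alpha$-value of $\mathfrak{E}$ is $\mathcal{S}_\alpha(\mathfrak{E})=\sum_{i=1}^\infty \mathrm{Diam}(E_i)^\alpha$. The $\alpha$-Hausdorff measure of $E$ is $\mathcal{H}_\alpha(E)=\lim_{\delta\downarrow 0}\inf\{\mathcal{S}_\alpha(\mathfrak{E}) : \mathfrak{E}\text{ a covering of }E\text{ with }\mathrm{Diam}(E_i)\le\delta\text{ for all } i\}$, and the Hausdorff dimension is $\mathrm{Dim}(E)=\inf\{\alpha\ge 0:\mathcal{H}_\alpha(E)<\infty\}$. Here $\mathrm{Rec}\subset[0,\infty)$ carries the usual metric of $\mathbb{R}$. *)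

theory Defs
  imports "HOL-Probability.Probability"
begin

text \<open>
  Coverings are sequences, so that finite coverings are padded with empty sets. For
  exponent \<open>0\<close> we therefore use the usual conventions that the empty set contributes \<open>0\<close> and
  every nonempty set contributes \<open>1\<close>, whereas \<open>0 powr 0 = 0\<close>.
\<close>

definition diam_power :: "real \<Rightarrow> 'a::metric_space set \<Rightarrow> ennreal" where
  "diam_power \<alpha> A =
     (if A = {} then 0 else if \<alpha> = 0 then 1 else ennreal (diameter A powr \<alpha>))"

definition alpha_value :: "real \<Rightarrow> (nat \<Rightarrow> 'a::metric_space set) \<Rightarrow> ennreal" where
  "alpha_value \<alpha> A = (\<Sum>i. diam_power \<alpha> (A i))"

text \<open>
  The library's \<^const>\<open>diameter\<close> is real-valued and meaningless for unbounded sets, so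
  boundedness has to be demanded explicitly.
\<close>

definition delta_coverings :: "'a::metric_space set \<Rightarrow> real \<Rightarrow> (nat \<Rightarrow> 'a set) set" where
  "delta_coverings E \<delta> =
     {A. (\<Union>i. A i) = E \<and> (\<forall>i. bounded (A i) \<and> diameter (A i) \<le> \<delta>)}"

definition hausdorff_measure :: "real \<Rightarrow> 'a::metric_space set \<Rightarrow> ennreal" where
  "hausdorff_measure \<alpha> E =
     Lim (at_right 0) (\<lambda>\<delta>. INF A\<in>delta_coverings E \<delta>. alpha_value \<alpha> A)"

text \<open>The limit exists, so \<^const>\<open>Lim\<close> never takes an unspecified value here.\<close>

lemma tendsto_hausdorff_measure:
  fixes E :: "'a::metric_space set"
  shows "((\<lambda>\<delta>. INF A\<in>delta_coverings E \<delta>. alpha_value \<alpha> A)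
           \<longlongrightarrow> hausdorff_measure \<alpha> E) (at_right 0)"
proof -
  define f where "f = (\<lambda>\<delta>. INF A\<in>delta_coverings E \<delta>. alpha_value \<alpha> A)"
  have anti: "f d \<le> f e" if "e \<le> d" for d e
    unfolding f_def using that
    by (intro INF_superset_mono) (auto simp: delta_coverings_def intro: order_trans)
  have "(f \<longlongrightarrow> (SUP \<delta>\<in>{0<..}. f \<delta>)) (at_right 0)"
  proof (rule order_tendstoI)
    fix a assume "a < (SUP \<delta>\<in>{0<..}. f \<delta>)"
    then obtain e where e: "e > 0" "a < f e"
      by (auto simp: less_SUP_iff)
    have "\<forall>\<^sub>F \<delta> in at_right 0. \<delta> \<in> {0<..<e}"
      using e by (intro eventually_at_right_real)
    then show "\<forall>\<^sub>F \<delta> in at_right 0. a < f \<delta>"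
      by eventually_elim (use e anti in \<open>auto intro: less_le_trans\<close>)
  next
    fix a assume a: "(SUP \<delta>\<in>{0<..}. f \<delta>) < a"
    have "\<forall>\<^sub>F \<delta>::real in at_right 0. \<delta> \<in> {0<..<1}"
      by (intro eventually_at_right_real) simp
    then show "\<forall>\<^sub>F \<delta> in at_right 0. f \<delta> < a"
      by eventually_elim (rule le_less_trans[OF SUP_upper a], simp)
  qed
  then show ?thesis
    unfolding hausdorff_measure_def f_def[symmetric]
    by (metis tendsto_Lim trivial_limit_at_right_real)
qed

text \<open>Extended-real valued: the infimum of the empty set is \<open>\<infinity>\<close>.\<close>

definition hausdorff_dim :: "'a::metric_space set \<Rightarrow> ereal" where
  "hausdorff_dim E = Inf {ereal \<alpha> | \<alpha>. 0 \<le> \<alpha> \<and> hausdorff_measure \<alpha> E < \<infinity>}"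

text \<open>Point masses count as (degenerate) Gaussian laws; note that \<open>X\<^sub>0 = 0\<close> almost surely.\<close>

definition gaussian_rv :: "'a measure \<Rightarrow> ('a \<Rightarrow> real) \<Rightarrow> bool" where
  "gaussian_rv M Y \<longleftrightarrow>
     Y \<in> borel_measurable M \<and>
     ((\<exists>\<mu>. AE \<omega> in M. Y \<omega> = \<mu>) \<or>
      (\<exists>\<mu> \<sigma>. 0 < \<sigma> \<and> distributed M lborel Y (normal_density \<mu> \<sigma>)))"

text \<open>
  Joint Gaussianity of the finite-dimensional distributions: all finite linear combinations
  are Gaussian.
\<close>

definition gaussian_process :: "'a measure \<Rightarrow> 't set \<Rightarrow> ('t \<Rightarrow> 'a \<Rightarrow> real) \<Rightarrow> bool" where
  "gaussian_process M T X \<longleftrightarrow>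
     (\<forall>J c. finite J \<and> J \<subseteq> T \<longrightarrow> gaussian_rv M (\<lambda>\<omega>. \<Sum>t\<in>J. c t * X t \<omega>))"

text \<open>Processes are indexed by \<^typ>\<open>real\<close>; only times \<open>t \<ge> 0\<close> are relevant.\<close>

locale fractional_brownian_motion = prob_space M
  for M :: "'a measure" and H :: real and X :: "real \<Rightarrow> 'a \<Rightarrow> real" +
  assumes Hurst_index: "0 < H" "H < 1"
    and gaussian: "gaussian_process M {0..} X"
    and continuous_paths: "\<omega> \<in> space M \<Longrightarrow> continuous_on {0..} (\<lambda>t. X t \<omega>)"
    and mean_zero: "0 \<le> t \<Longrightarrow> expectation (X t) = 0"
    and covariance: "0 \<le> t \<Longrightarrow> 0 \<le> s \<Longrightarrow>
      expectation (\<lambda>\<omega>. X t \<omega> * X s \<omega>) =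
        1/2 * (\<bar>t\<bar> powr (2 * H) + \<bar>s\<bar> powr (2 * H) - \<bar>t - s\<bar> powr (2 * H))"

text \<open>For a continuous path the supremum over the compact interval is attained, i.e. a maximum.\<close>

definition record_set :: "(real \<Rightarrow> real) \<Rightarrow> real set" where
  "record_set x = {t. 0 \<le> t \<and> x t = (SUP s\<in>{0..t}. x s)}"

end

theory Submission
  imports Defs "HOL-Real_Asymp.Real_Asymp"
begin

text \<open>
  Lower bound: a record path attains every level between \<open>0\<close> and its running maximum at a record
  time, so the path maps \<open>Rec\<close> onto an interval; as the path is \<open>\<gamma>\<close>-Hoelder for every \<open>\<gamma> < H\<close>, the
  record set has dimension at least \<open>H\<close>.

  Upper bound: cut \<open>[0, T]\<close> into intervals of length \<open>h\<close>. If such an interval contains a record, its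
  right end point \<open>t\<^sub>n\<close> is a near record, \<open>X (t\<^sub>n) \<ge> X (t\<^sub>k) - \<delta>\<close> for all \<open>k < n\<close>, with \<open>\<delta>\<close> about \<open>h powr H\<close>.
  The softmax weights \<open>exp (L x\<^sub>n) / (\<Sum>k\<le>n. exp (L x\<^sub>k))\<close> are bounded by the increments of
  \<open>ln (\<Sum>k\<le>n. exp (L x\<^sub>k))\<close>, so for \<open>L = 1 / \<delta>\<close> their expected sum is at most \<open>1 / \<delta>\<close> up to logarithms.
  To compare near records with softmax weights, one shifts the Gaussian family along the direction
  \<open>X (t\<^sub>n) - X (t\<^bsub>n-q\<^esub>)\<close>, where \<open>q\<close> is a small power of \<open>1 / h\<close>. This costs a bounded factor and
  pushes all values before \<open>t\<^bsub>n-q\<^esub>\<close> far below \<open>X (t\<^sub>n)\<close>, so that the weight at \<open>n\<close> is of order \<open>1 / q\<close>.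
  Hence the expected number of intervals meeting \<open>Rec\<close> is at most \<open>h powr (- H - \<epsilon>)\<close>.
\<close>

section \<open>Hausdorff measure and record sets\<close>

text \<open>For \<open>H \<noteq> 1/2\<close> the process is neither Markov nor has independent
  increments, so record probabilities on a grid cannot be computed by fluctuation theory. The
  softmax weights replace this: their telescoping bound is deterministic and indifferent to
  dependence. The shift must not destroy the near record constraints, so its direction has to be
  positively correlated with every increment ending at the same time. Increments with a common right
  end point have this property for every \<open>H\<close> in (0,1), although increments over
  disjoint intervals are negatively correlated when \<open>H < 1/2\<close>. Splitting off the
  direction requires that uncorrelated implies independent, while joint Gaussianity is given only
  through linear combinations; hence the trigonometric test functions and the uniqueness theorem for
  characteristic functions. The lower bound also needs a positive value of the path on [0,1], since
  otherwise the interval of levels could be a single point. Instead of a zero-one law, a second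
  moment estimate along geometric times tending to 0 supplies it.\<close>

lemma hausdorff_measure_UN_eq_0:
  fixes E :: "nat \<Rightarrow> 'a::metric_space set"
  assumes cover: "\<And>j \<delta> \<theta>. 0 < \<delta> \<Longrightarrow> 0 < \<theta> \<Longrightarrow> \<exists>A\<in>delta_coverings (E j) \<delta>. alpha_value \<alpha> A \<le> ennreal \<theta>"
  shows "hausdorff_measure \<alpha> (\<Union>j. E j) = 0"
proof -
  have "(INF A\<in>delta_coverings (\<Union>j. E j) \<delta>. alpha_value \<alpha> A) = 0" if \<delta>: "0 < \<delta>" for \<delta>
  proof -
    have "(INF A\<in>delta_coverings (\<Union>j. E j) \<delta>. alpha_value \<alpha> A) \<le> ennreal \<theta>" if \<theta>: "0 < \<theta>" for \<theta>
    proof -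
      \<comment> \<open>The budget \<theta> is split geometrically among the pieces
        \<open>E j\<close>; the pairing function then lists the double family of covering sets as
        one sequence.\<close>
      have "\<forall>j. \<exists>A\<in>delta_coverings (E j) \<delta>. alpha_value \<alpha> A \<le> ennreal (\<theta> * (1/2) ^ Suc j)"
        using cover[OF \<delta>] \<theta> by simp
      then obtain A where A: "\<And>j. A j \<in> delta_coverings (E j) \<delta>"
        "\<And>j. alpha_value \<alpha> (A j) \<le> ennreal (\<theta> * (1/2) ^ Suc j)" by metis
      define B where "B i = A (fst (prod_decode i)) (snd (prod_decode i))" for i
      have "(\<Union>i. B i) = (\<Union>p\<in>range prod_decode. A (fst p) (snd p))"
        by (simp add: B_def)
      also have "\<dots> = (\<Union>p. A (fst p) (snd p))"
        by (simp only: surj_prod_decode)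
      also have "\<dots> = (\<Union>j. \<Union>i. A j i)" by fastforce
      also have "\<dots> = (\<Union>j. E j)" using A(1) by (auto simp: delta_coverings_def)
      finally have "B \<in> delta_coverings (\<Union>j. E j) \<delta>"
        using A(1) by (auto simp: delta_coverings_def B_def)
      then have "(INF A\<in>delta_coverings (\<Union>j. E j) \<delta>. alpha_value \<alpha> A) \<le> alpha_value \<alpha> B"
        by (rule INF_lower)
      also have "alpha_value \<alpha> B = (\<Sum>i. case_prod (\<lambda>j i. diam_power \<alpha> (A j i)) (prod_decode i))"
        by (simp add: alpha_value_def B_def case_prod_beta)
      also have "\<dots> = (\<Sum>j. alpha_value \<alpha> (A j))"
        by (rule suminf_ennreal_2dimen) (simp add: alpha_value_def)
      also have "\<dots> \<le> (\<Sum>j. ennreal (\<theta> * (1/2) ^ Suc j))"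
        using A(2) by (intro suminf_le) auto
      also have "\<dots> = ennreal (\<Sum>j. \<theta> * (1/2) ^ Suc j)"
        by (rule suminf_ennreal2) (use \<theta> sums_mult[OF power_half_series, of \<theta>] in \<open>auto dest: sums_summable\<close>)
      also have "(\<Sum>j. \<theta> * (1/2) ^ Suc j) = \<theta>"
        using sums_unique[OF sums_mult[OF power_half_series, of \<theta>]] by simp
      finally show ?thesis .
    qed
    note le = this
    have "(INF A\<in>delta_coverings (\<Union>j. E j) \<delta>. alpha_value \<alpha> A) \<le> 0"
      by (rule ennreal_le_epsilon) (use le in simp)
    then show ?thesis by simp
  qed
  then have "\<forall>\<^sub>F \<delta> in at_right 0. (INF A\<in>delta_coverings (\<Union>j. E j) \<delta>. alpha_value \<alpha> A) = 0"
    by (auto simp: eventually_at_right_field intro!: exI[of _ 1])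
  then have "((\<lambda>\<delta>. INF A\<in>delta_coverings (\<Union>j. E j) \<delta>. alpha_value \<alpha> A) \<longlongrightarrow> 0) (at_right 0)"
    by (rule tendsto_eventually)
  then show ?thesis
    using tendsto_hausdorff_measure by (rule tendsto_unique[OF trivial_limit_at_right_real, symmetric])
qed

text \<open>The image of a covering set has length at most \<open>2 * C * d powr \<gamma>\<close>,
  where \<open>d\<close> is its diameter, hence at most
  \<open>2 * C * \<delta> powr (\<gamma> - \<alpha>)\<close> times its \<alpha>-power. The images
  cover an interval of length \<open>b\<close>, so the \<alpha>-value blows up as \<delta> tends to
  0. Only the points of \<open>S\<close> are controlled; elsewhere in \<open>E\<close> the map may
  be arbitrary.\<close>

lemma hausdorff_measure_eq_infinity:
  fixes x :: "'a::metric_space \<Rightarrow> real"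
  assumes \<alpha>: "0 \<le> \<alpha>" "\<alpha> < \<gamma>" and C: "0 < C" and b: "0 < b" and S: "S \<subseteq> E" "{0..b} \<subseteq> x ` S"
    and hoelder: "\<And>s t. s \<in> S \<Longrightarrow> t \<in> S \<Longrightarrow> \<bar>x s - x t\<bar> \<le> C * dist s t powr \<gamma>"
  shows "hausdorff_measure \<alpha> E = \<infinity>"
proof -
  have lower: "ennreal (b / (2 * C * \<delta> powr (\<gamma> - \<alpha>))) \<le> alpha_value \<alpha> A"
    if \<delta>: "0 < \<delta>" and A: "A \<in> delta_coverings E \<delta>" for \<delta> A
  proof -
    define p where "p i = (SOME s. s \<in> A i \<inter> S)" for i
    define r where "r i = C * diameter (A i) powr \<gamma>" for i
    \<comment> \<open>An interval around the value at one chosen point replaces the image itself,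
      which need not be measurable. Sets missing \<open>S\<close> get the empty interval, as
      \<open>p i\<close> is arbitrary there.\<close>
    define I where "I i = (if A i \<inter> S = {} then {} else {x (p i) - r i .. x (p i) + r i})" for i
    have p: "p i \<in> A i \<inter> S" if "A i \<inter> S \<noteq> {}" for i
      unfolding p_def by (rule someI_ex) (use that in blast)
    have bd: "bounded (A i)" "diameter (A i) \<le> \<delta>" and UA: "(\<Union>i. A i) = E" for i
      using A by (auto simp: delta_coverings_def)
    have d0: "0 \<le> diameter (A i)" for i using bd by (intro diameter_ge_0)
    have "{0..b} \<subseteq> (\<Union>i. I i)"
    proof
      fix y assume "y \<in> {0..b}"
      then obtain s where s: "s \<in> S" "y = x s" using S(2) by auto
      then obtain i where i: "s \<in> A i" using S(1) UA by auto
      then have "A i \<inter> S \<noteq> {}" using s by auto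
      note pi = p[OF this]
      have "\<bar>x s - x (p i)\<bar> \<le> C * dist s (p i) powr \<gamma>" using s pi by (intro hoelder) auto
      also have "\<dots> \<le> r i"
        unfolding r_def using i pi C \<alpha> bd
        by (intro mult_left_mono powr_mono2 diameter_bounded_bound) auto
      finally have "y \<in> I i" using s \<open>A i \<inter> S \<noteq> {}\<close> by (auto simp: I_def)
      then show "y \<in> (\<Union>i. I i)" by auto
    qed
    then have "emeasure lborel {0..b} \<le> emeasure lborel (\<Union>i. I i)"
      by (intro emeasure_mono) (auto simp: I_def)
    also have "\<dots> \<le> (\<Sum>i. emeasure lborel (I i))"
      by (intro emeasure_subadditive_countably) (auto simp: I_def)
    also have "\<dots> \<le> (\<Sum>i. ennreal (2 * C * \<delta> powr (\<gamma> - \<alpha>)) * diam_power \<alpha> (A i))"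
    proof (rule suminf_le)
      fix i
      show "emeasure lborel (I i) \<le> ennreal (2 * C * \<delta> powr (\<gamma> - \<alpha>)) * diam_power \<alpha> (A i)"
      proof (cases "A i \<inter> S = {}")
        case False
        \<comment> \<open>The case of diameter 0 is separate: \<open>0 powr \<gamma> = 0\<close>
          makes the left side vanish, whereas for \<open>\<alpha> = 0\<close> a nonempty set counts
          1 by convention and not \<open>0 powr 0\<close>.\<close>
        have "diameter (A i) powr \<gamma> \<le> \<delta> powr (\<gamma> - \<alpha>) * (if \<alpha> = 0 then 1 else diameter (A i) powr \<alpha>)"
        proof (cases "diameter (A i) = 0")
          case False
          then have "diameter (A i) powr \<gamma> = diameter (A i) powr (\<gamma> - \<alpha>) * diameter (A i) powr \<alpha>"
            by (simp add: powr_add[symmetric])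
          also have "\<dots> \<le> \<delta> powr (\<gamma> - \<alpha>) * diameter (A i) powr \<alpha>"
            using d0 bd \<alpha> by (intro mult_right_mono powr_mono2) auto
          finally show ?thesis using False by (auto simp: powr_zero_eq_one)
        qed (use \<alpha> in auto)
        then have "2 * r i \<le> 2 * C * \<delta> powr (\<gamma> - \<alpha>) * (if \<alpha> = 0 then 1 else diameter (A i) powr \<alpha>)"
          unfolding r_def using C by (simp add: mult.assoc)
        moreover have "0 \<le> r i" using C by (simp add: r_def)
        ultimately have "ennreal (2 * r i) \<le> ennreal (2 * C * \<delta> powr (\<gamma> - \<alpha>) * (if \<alpha> = 0 then 1 else diameter (A i) powr \<alpha>))"
          by (intro ennreal_leI)
        moreover have "diam_power \<alpha> (A i) = ennreal (if \<alpha> = 0 then 1 else diameter (A i) powr \<alpha>)"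
          using False by (auto simp: diam_power_def)
        ultimately show ?thesis using False \<open>0 \<le> r i\<close> C
          by (simp add: I_def ennreal_mult[symmetric])
      qed (simp add: I_def)
    qed auto
    also have "\<dots> = ennreal (2 * C * \<delta> powr (\<gamma> - \<alpha>)) * alpha_value \<alpha> A"
      by (simp add: alpha_value_def)
    finally have *: "ennreal b \<le> ennreal (2 * C * \<delta> powr (\<gamma> - \<alpha>)) * alpha_value \<alpha> A"
      using b by simp
    show ?thesis
    proof (cases "alpha_value \<alpha> A")
      case (real v)
      have "b \<le> 2 * C * \<delta> powr (\<gamma> - \<alpha>) * v"
        using * real C by (simp add: ennreal_mult[symmetric])
      then have "b / (2 * C * \<delta> powr (\<gamma> - \<alpha>)) \<le> v" using C \<delta> by (simp add: pos_divide_le_eq mult.commute)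
      then show ?thesis using real by (simp add: ennreal_leI)
    qed simp
  qed
  have "ennreal r \<le> hausdorff_measure \<alpha> E" if r: "0 < r" for r
  proof (rule tendsto_lowerbound[OF tendsto_hausdorff_measure])
    have "((\<lambda>\<delta>::real. \<delta> powr (\<gamma> - \<alpha>)) \<longlongrightarrow> 0) (at_right 0)"
    proof -
      define k where "k = \<gamma> - \<alpha>"
      have "k > 0" using \<alpha> by (simp add: k_def)
      then have "((\<lambda>\<delta>::real. \<delta> powr k) \<longlongrightarrow> 0) (at_right 0)" by real_asymp
      then show ?thesis by (simp add: k_def)
    qed
    then have "\<forall>\<^sub>F \<delta>::real in at_right 0. \<delta> powr (\<gamma> - \<alpha>) < b / (2 * C * r)"
      by (rule order_tendstoD) (use b C r in auto)
    moreover have "\<forall>\<^sub>F \<delta>::real in at_right 0. 0 < \<delta>" by (simp add: eventually_at_right_less)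
    ultimately show "\<forall>\<^sub>F \<delta> in at_right 0. ennreal r \<le> (INF A\<in>delta_coverings E \<delta>. alpha_value \<alpha> A)"
    proof eventually_elim
      case (elim \<delta>)
      then have "r \<le> b / (2 * C * \<delta> powr (\<gamma> - \<alpha>))" using b C r by (simp add: field_simps)
      then have "ennreal r \<le> ennreal (b / (2 * C * \<delta> powr (\<gamma> - \<alpha>)))" by (rule ennreal_leI)
      then show ?case using lower[OF elim(2)] by (intro INF_greatest) (rule order_trans)
    qed
  qed simp
  note ge = this
  show ?thesis
  proof (cases "hausdorff_measure \<alpha> E")
    case (real v)
    with ge[of "v + 1"] show ?thesis by simp
  qed simp
qed

text \<open>Continuity on the compact interval bounds the image, so that the conditionally complete
  \<open>SUP\<close> is a genuine supremum.\<close>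

lemma record_set_iff:
  assumes "continuous_on {0..} x"
  shows "t \<in> record_set x \<longleftrightarrow> 0 \<le> t \<and> (\<forall>s\<in>{0..t}. x s \<le> x t)"
proof safe
  assume t: "t \<in> record_set x"
  then show "0 \<le> t" by (simp add: record_set_def)
  have "compact (x ` {0..t})"
    by (intro compact_continuous_image continuous_on_subset[OF assms]) auto
  then have bdd: "bdd_above (x ` {0..t})" by (intro bounded_imp_bdd_above compact_imp_bounded)
  fix s assume "s \<in> {0..t}"
  then show "x s \<le> x t" using t cSUP_upper[OF _ bdd, of s] by (simp add: record_set_def)
next
  assume "0 \<le> t" "\<forall>s\<in>{0..t}. x s \<le> x t"
  moreover from this have "(SUP s\<in>{0..t}. x s) = x t" by (intro cSup_eq_maximum) auto
  ultimately show "t \<in> record_set x" by (simp add: record_set_def)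
qed

text \<open>First passage times are records.\<close>

lemma record_set_attains:
  assumes cont: "continuous_on {0..} x" and x0: "x 0 = 0" and t: "0 \<le> t" and y: "0 \<le> y" "y \<le> x t"
  shows "\<exists>s\<in>record_set x \<inter> {0..t}. x s = y"
proof -
  have c: "continuous_on {0..t} x" by (rule continuous_on_subset[OF cont]) auto
  define P where "P = {0..t} \<inter> x -` {y..}"
  have "closed P" unfolding P_def by (rule continuous_closed_preimage[OF c]) auto
  moreover have "P \<subseteq> {0..t}" by (auto simp: P_def)
  ultimately have "compact P" using bounded_subset[OF bounded_closed_interval] by (simp add: compact_eq_bounded_closed)
  moreover have "t \<in> P" using t y by (simp add: P_def)
  ultimately obtain s where s: "s \<in> P" "\<And>u. u \<in> P \<Longrightarrow> s \<le> u"
    using compact_attains_inf[of P] by blast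
  \<comment> \<open>So far \<open>x s\<close> is only known to be at least \<open>y\<close>. The
    intermediate value theorem finds the level exactly, no later than \<open>s\<close>, and
    minimality of \<open>s\<close> forces this time to be \<open>s\<close>.\<close>
  have "\<exists>u\<ge>0. u \<le> s \<and> x u = y"
    using s(1) x0 y by (intro IVT') (auto simp: P_def intro: continuous_on_subset[OF cont])
  then obtain u where u: "0 \<le> u" "u \<le> s" "x u = y" by blast
  then have "u \<in> P" using s(1) by (auto simp: P_def)
  then have us: "u = s" using s(2)[of u] u by simp
  have "x v \<le> x s" if "v \<in> {0..s}" for v
  proof (rule ccontr)
    assume *: "\<not> x v \<le> x s"
    then have "v \<in> P" using that s(1) u us by (auto simp: P_def)
    then show False using s(2)[of v] that * by auto
  qed
  then show ?thesis using s(1) u us cont by (intro bexI[of _ s]) (auto simp: record_set_iff P_def)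
qed

text \<open>A record in the grid interval ending at \<open>n * h\<close> dominates all grid values
  up to its left end, and the modulus of continuity carries this to the right end with loss
  \<delta>. Thus the intervals meeting the record set are among those indexed by near records, and
  each piece has diameter at most \<open>h\<close>.\<close>

lemma record_set_covering:
  fixes T m :: nat
  assumes cont: "continuous_on {0..} x" and T: "1 \<le> T" and \<alpha>: "0 < \<alpha>" and h: "h = 1 / 2 ^ m"
    and modulus: "\<And>s t. 0 \<le> s \<Longrightarrow> s \<le> t \<Longrightarrow> t \<le> real T \<Longrightarrow> t - s \<le> h \<Longrightarrow> \<bar>x t - x s\<bar> \<le> \<delta>"
  shows "\<exists>A\<in>delta_coverings (record_set x \<inter> {0..real T}) h.
    alpha_value \<alpha> A \<le> ennreal (real (card {n\<in>{1..T * 2 ^ m}. \<forall>k<n. - \<delta> \<le> x (real n * h) - x (real k * h)}) * h powr \<alpha>)"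
proof -
  let ?N = "{n\<in>{1..T * 2 ^ m}. \<forall>k<n. - \<delta> \<le> x (real n * h) - x (real k * h)}"
  define A where "A n = (if n \<in> ?N then record_set x \<inter> {real (n - 1) * h .. real n * h} else {})" for n
  have h0: "0 < h" by (simp add: h)
  have Th: "real (T * 2 ^ m) * h = real T" by (simp add: h)
  have len: "real n * h - real (n - 1) * h = h" if "1 \<le> n" for n
    using that by (simp add: of_nat_diff algebra_simps)
  have le_T: "real n * h \<le> real T" if "n \<in> {1..T * 2 ^ m}" for n
    unfolding Th[symmetric] using that h0 by (intro mult_right_mono) (simp_all only: of_nat_le_iff atLeastAtMost_iff less_imp_le)
  have sub: "A n \<subseteq> record_set x \<inter> {0..real T}" for n
    unfolding A_def using le_T[of n] h0 by (auto simp: record_set_def)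
  have bd: "bounded (A n)" for n
    unfolding A_def by (auto intro: bounded_subset[of "{real (n - 1) * h .. real n * h}"])
  have diam: "diameter (A n) \<le> h" for n
  proof (rule diameter_le)
    fix s t assume "s \<in> A n" "t \<in> A n"
    then show "norm (s - t) \<le> h" using len[of n] by (auto simp: A_def split: if_splits)
  qed (use h0 in auto)
  have cov: "t \<in> (\<Union>n. A n)" if t: "t \<in> record_set x" "0 \<le> t" "t \<le> real T" for t
  proof -
    \<comment> \<open>The maximum with 1 matters only for \<open>t = 0\<close>, whose ceiling would
      give the index 0; it is assigned to the first interval instead.\<close>
    define n where "n = max 1 (nat \<lceil>t / h\<rceil>)"
    have n1: "1 \<le> n" by (simp add: n_def)
    have t1: "t \<le> real n * h"
    proof -
      have "t / h \<le> real (nat \<lceil>t / h\<rceil>)" by (rule real_nat_ceiling_ge)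
      also have "\<dots> \<le> real n" by (simp add: n_def)
      finally show ?thesis using h0 by (simp add: pos_divide_le_eq)
    qed
    have t2: "real (n - 1) * h \<le> t"
    proof (cases "n = 1")
      case False
      then have "n = nat \<lceil>t / h\<rceil>" by (auto simp: n_def max_def split: if_splits)
      moreover have "real_of_int \<lceil>t / h\<rceil> - 1 < t / h" by linarith
      ultimately have "real (n - 1) \<le> t / h" using n1 t(2) h0 by (simp add: of_nat_diff)
      then show ?thesis using h0 by (simp add: pos_le_divide_eq)
    qed (use t in simp)
    have n2: "n \<le> T * 2 ^ m"
    proof -
      have "t / h \<le> real (T * 2 ^ m)" using t(3) unfolding Th[symmetric] using h0 by (simp only: pos_divide_le_eq)
      then have "\<lceil>t / h\<rceil> \<le> int (T * 2 ^ m)" by (simp add: ceiling_le_iff)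
      then show ?thesis using T by (simp add: n_def nat_le_iff)
    qed
    have "- \<delta> \<le> x (real n * h) - x (real k * h)" if k: "k < n" for k
    proof -
      have "real k * h \<le> real (n - 1) * h" using k h0 by (intro mult_right_mono) auto
      with t2 have "real k * h \<le> t" by (rule order_trans[rotated])
      then have "real k * h \<in> {0..t}" using h0 by simp
      then have "x (real k * h) \<le> x t"
        using t(1) cont by (simp add: record_set_iff)
      moreover have "\<bar>x (real n * h) - x t\<bar> \<le> \<delta>"
        using t t1 t2 len[OF n1] le_T[of n] n1 n2 by (intro modulus) auto
      ultimately show ?thesis by linarith
    qed
    then have "n \<in> ?N" using n1 n2 by auto
    then have "t \<in> A n" using t t1 t2 by (auto simp: A_def)
    then show ?thesis by blast
  qed
  have "(\<Union>n. A n) = record_set x \<inter> {0..real T}" using sub cov by auto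
  then have "A \<in> delta_coverings (record_set x \<inter> {0..real T}) h"
    using bd diam by (simp add: delta_coverings_def)
  moreover have "alpha_value \<alpha> A \<le> ennreal (real (card ?N) * h powr \<alpha>)"
  proof -
    have "alpha_value \<alpha> A = (\<Sum>n\<in>?N. diam_power \<alpha> (A n))"
      unfolding alpha_value_def by (rule suminf_finite) (auto simp: A_def diam_power_def)
    also have "\<dots> \<le> (\<Sum>n\<in>?N. ennreal (h powr \<alpha>))"
      using \<alpha> diam diameter_ge_0[OF bd] by (intro sum_mono) (auto simp: diam_power_def intro!: ennreal_leI powr_mono2)
    also have "\<dots> = ennreal (real (card ?N) * h powr \<alpha>)"
      by (simp add: ennreal_mult ennreal_of_nat_eq_real_of_nat)
    finally show ?thesis .
  qed
  ultimately show ?thesis by blast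
qed

section \<open>Hoelder continuity from dyadic increments\<close>

text \<open>The deterministic half of the Kolmogorov-Chentsov argument. Rounding down to level
  \<open>m\<close> costs a geometric tail of dyadic increments, and two points about
  \<open>1 / 2 ^ m\<close> apart are compared through their level \<open>m\<close> approximations.
  Distances above \<open>1 / 2 ^ m0\<close> are handled by boundedness of \<open>f\<close>.\<close>

lemma hoelder_of_dyadic_increments:
  fixes f :: "real \<Rightarrow> real" and T m0 :: nat
  assumes cont: "continuous_on {0..real T} f" and \<gamma>: "0 < \<gamma>"
    and dyadic: "\<And>m k. m0 \<le> m \<Longrightarrow> k < T * 2 ^ m \<Longrightarrow>
      \<bar>f (real (Suc k) / 2 ^ m) - f (real k / 2 ^ m)\<bar> \<le> (1 / 2 ^ m) powr \<gamma>"
  shows "\<exists>C>0. \<forall>s\<in>{0..real T}. \<forall>t\<in>{0..real T}. \<bar>f s - f t\<bar> \<le> C * \<bar>s - t\<bar> powr \<gamma>"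
proof -
  define \<rho> where "\<rho> = (1/2 :: real) powr \<gamma>"
  have \<rho>: "0 < \<rho>" "\<rho> < 1"
    using \<gamma> powr_less_mono2[of \<gamma> "1/2" 1] by (auto simp: \<rho>_def)
  have \<rho>_pow: "(1 / 2 ^ m) powr \<gamma> = \<rho> ^ m" for m :: nat
  proof -
    have "(1 / 2 ^ m :: real) = (1/2) powr real m" by (simp add: powr_realpow power_one_over)
    then show ?thesis by (simp add: \<rho>_def powr_powr powr_power mult.commute)
  qed
  define N where "N m s = nat \<lfloor>s * 2 ^ m\<rfloor>" for m :: nat and s :: real
  define D where "D m s = real (N m s) / 2 ^ m" for m s
  \<comment> \<open>The sum of the powers \<open>\<rho> ^ i\<close> over \<open>i \<ge> 1\<close>,
    so that \<open>\<rho> ^ m * B\<close> is the total of all increments finer than level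
    \<open>m\<close>.\<close>
  define B where "B = \<rho> / (1 - \<rho>)"
  have N_bounds: "real (N m s) \<le> s * 2 ^ m" "s * 2 ^ m < real (N m s) + 1" if "0 \<le> s" for m s
    using that by (auto simp: N_def of_nat_nat)
  have D_bounds: "0 \<le> D m s" "D m s \<le> s" "s - D m s \<le> 1 / 2 ^ m" if "0 \<le> s" for m s
  proof -
    show "0 \<le> D m s" by (simp add: D_def)
    show "D m s \<le> s" using N_bounds[OF that, of m] by (simp add: D_def pos_divide_le_eq)
    have "s \<le> (real (N m s) + 1) / 2 ^ m" using N_bounds[OF that, of m] by (simp add: pos_le_divide_eq)
    then show "s - D m s \<le> 1 / 2 ^ m" by (simp add: D_def add_divide_distrib)
  qed
  have step: "\<bar>f (D (Suc j) s) - f (D j s)\<bar> \<le> \<rho> ^ Suc j" if s: "0 \<le> s" "s \<le> real T" and j: "m0 \<le> j" for s j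
  proof -
    have "2 * real (N j s) < real (N (Suc j) s) + 1" and "real (N (Suc j) s) < 2 * real (N j s) + 2"
      using N_bounds[OF s(1), of j] N_bounds[OF s(1), of "Suc j"] by (auto simp: algebra_simps)
    then have "N (Suc j) s = 2 * N j s \<or> N (Suc j) s = Suc (2 * N j s)" by linarith
    then show ?thesis
    proof
      assume "N (Suc j) s = 2 * N j s"
      then have "D (Suc j) s = D j s" by (simp add: D_def)
      then show ?thesis using \<rho> by simp
    next
      assume *: "N (Suc j) s = Suc (2 * N j s)"
      have "real (N (Suc j) s) \<le> real (T * 2 ^ Suc j)"
        using order_trans[OF N_bounds(1)[OF s(1), of "Suc j"] mult_right_mono[OF s(2), of "2 ^ Suc j"]] by simp
      then have "2 * N j s < T * 2 ^ Suc j" unfolding of_nat_le_iff using * by simp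
      from dyadic[OF _ this] j have "\<bar>f (real (Suc (2 * N j s)) / 2 ^ Suc j) - f (real (2 * N j s) / 2 ^ Suc j)\<bar> \<le> \<rho> ^ Suc j"
        by (simp only: \<rho>_pow le_SucI)
      then show ?thesis by (simp add: D_def * )
    qed
  qed
  \<comment> \<open>The bound is the exact value of the finite geometric sum from level
    \<open>m + 1\<close> to \<open>m + i\<close>, which lets the induction close without
    loss.\<close>
  have chain: "\<bar>f (D (m + i) s) - f (D m s)\<bar> \<le> (\<rho> ^ m - \<rho> ^ (m + i)) * B"
    if s: "0 \<le> s" "s \<le> real T" and m: "m0 \<le> m" for s m i
  proof (induction i)
    case (Suc i)
    have "\<rho> ^ Suc (m + i) = (\<rho> ^ (m + i) - \<rho> ^ Suc (m + i)) * B"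
      using \<rho> by (simp add: B_def field_simps)
    moreover have "\<bar>f (D (Suc (m + i)) s) - f (D (m + i) s)\<bar> \<le> \<rho> ^ Suc (m + i)"
      using m by (intro step s) auto
    ultimately show ?case using Suc.IH by (simp add: algebra_simps)
  qed simp
  have near: "\<bar>f s - f (D m s)\<bar> \<le> \<rho> ^ m * B" if s: "0 \<le> s" "s \<le> real T" and m: "m0 \<le> m" for s m
  proof -
    have "(\<lambda>i. D (m + i) s) \<longlonglongrightarrow> s"
    proof (rule tendsto_sandwich[of "\<lambda>i. s - (1/2) ^ (m + i)" _ _ "\<lambda>_. s"])
      have "(\<lambda>i. s - (1/2) ^ m * (1/2) ^ i) \<longlonglongrightarrow> s - (1/2) ^ m * 0"
        by (intro tendsto_intros LIMSEQ_power_zero) auto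
      then show "(\<lambda>i. s - (1/2) ^ (m + i)) \<longlonglongrightarrow> s" by (simp add: power_add)
    qed (use D_bounds[OF s(1)] in \<open>auto simp: power_one_over algebra_simps\<close>)
    then have "(\<lambda>i. f (D (m + i) s)) \<longlonglongrightarrow> f s"
      using s D_bounds(1)[OF s(1)] order_trans[OF D_bounds(2)[OF s(1)] s(2)]
      by (intro continuous_on_tendsto_compose[OF cont]) auto
    then have lim: "(\<lambda>i. \<bar>f (D (m + i) s) - f (D m s)\<bar>) \<longlonglongrightarrow> \<bar>f s - f (D m s)\<bar>"
      by (intro tendsto_intros)
    have "\<bar>f (D (m + i) s) - f (D m s)\<bar> \<le> \<rho> ^ m * B" for i
    proof -
      have "0 \<le> \<rho> ^ (m + i) * B" using \<rho> by (simp add: B_def)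
      then show ?thesis using chain[OF s m, of i] by (simp add: algebra_simps)
    qed
    then show ?thesis by (intro LIMSEQ_le_const2[OF lim]) auto
  qed
  \<comment> \<open>The level \<open>m\<close> roundings of the two points coincide or are
    neighbours, so one dyadic increment and two rounding errors suffice:
    \<open>2 * B + 1\<close>.\<close>
  have small: "\<bar>f t - f s\<bar> \<le> (2 * B + 1) * \<rho> ^ m"
    if st: "0 \<le> s" "s \<le> t" "t \<le> real T" and m: "m0 \<le> m" and d: "t - s \<le> 1 / 2 ^ m" for s t m
  proof -
    have "s * 2 ^ m \<le> t * 2 ^ m" using st by (intro mult_right_mono) auto
    moreover have "t * 2 ^ m \<le> s * 2 ^ m + 1" using d by (simp add: field_simps)
    ultimately have "real (N m s) < real (N m t) + 1" "real (N m t) < real (N m s) + 2"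
      using N_bounds[of s m] N_bounds[of t m] st by linarith+
    then have "N m t = N m s \<or> N m t = Suc (N m s)" by linarith
    then have "\<bar>f (D m t) - f (D m s)\<bar> \<le> \<rho> ^ m"
    proof
      assume "N m t = N m s"
      then show ?thesis using \<rho> by (simp add: D_def)
    next
      assume *: "N m t = Suc (N m s)"
      have "real (N m t) \<le> real (T * 2 ^ m)"
        using order_trans[OF N_bounds(1)[of t m] mult_right_mono[OF st(3), of "2 ^ m"]] st by simp
      then have "N m s < T * 2 ^ m" unfolding of_nat_le_iff using * by simp
      from dyadic[OF m this] show ?thesis by (simp add: D_def * \<rho>_pow)
    qed
    moreover have "\<bar>f t - f (D m t)\<bar> \<le> \<rho> ^ m * B" "\<bar>f s - f (D m s)\<bar> \<le> \<rho> ^ m * B"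
      using st m by (intro near; simp)+
    ultimately show ?thesis by (simp add: algebra_simps)
  qed
  have "bounded (f ` {0..real T})"
    by (intro compact_imp_bounded compact_continuous_image cont compact_Icc)
  then obtain K where K: "0 < K" "\<And>s. s \<in> {0..real T} \<Longrightarrow> \<bar>f s\<bar> \<le> K"
    unfolding bounded_pos by auto
  \<comment> \<open>The first summand serves close points, the division by \<rho> paying for one
    dyadic level; the second serves points farther apart than \<open>1 / 2 ^ m0\<close>.\<close>
  define C where "C = (2 * B + 1) / \<rho> + 2 * K / \<rho> ^ m0"
  have B0: "0 < B" using \<rho> by (simp add: B_def)
  have C1: "(2 * B + 1) / \<rho> \<le> C" "2 * K / \<rho> ^ m0 \<le> C" "0 < C"
    using B0 \<rho> K by (auto simp: C_def intro!: add_pos_pos)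
  have ordered: "\<bar>f t - f s\<bar> \<le> C * (t - s) powr \<gamma>" if st: "0 \<le> s" "s < t" "t \<le> real T" for s t
  proof (cases "t - s \<le> 1 / 2 ^ m0")
    case True
    \<comment> \<open>With \<open>n = Suc m\<close> this places the distance between
      \<open>1 / 2 ^ Suc m\<close> and \<open>1 / 2 ^ m\<close>: the upper bound permits comparison
      at level \<open>m\<close>, and the lower one turns \<open>\<rho> ^ Suc m\<close> into a power
      of the distance.\<close>
    define n where "n = (LEAST n. (1/2) ^ n < t - s)"
    have "\<exists>n. (1/2) ^ n < t - s" using st real_arch_pow_inv[of "t - s" "1/2"] by auto
    then have n: "(1/2) ^ n < t - s" unfolding n_def by (rule LeastI_ex)
    have "m0 < n"
    proof (rule ccontr)
      assume "\<not> m0 < n"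
      then have "(1/2 :: real) ^ m0 \<le> (1/2) ^ n" by (intro power_decreasing) auto
      then show False using n True by (simp add: power_one_over)
    qed
    then obtain m where m: "n = Suc m" "m0 \<le> m" by (cases n) auto
    then have "\<not> (1/2) ^ m < t - s" unfolding n_def by (intro not_less_Least) auto
    then have "\<bar>f t - f s\<bar> \<le> (2 * B + 1) * \<rho> ^ m"
      using st m by (intro small) (auto simp: power_one_over)
    also have "\<dots> = (2 * B + 1) / \<rho> * \<rho> ^ Suc m" using \<rho> by simp
    also have "\<dots> \<le> C * (t - s) powr \<gamma>"
    proof (rule mult_mono)
      show "\<rho> ^ Suc m \<le> (t - s) powr \<gamma>"
        unfolding \<rho>_pow[symmetric] using n m \<gamma> by (intro powr_mono2) (auto simp: power_one_over)
    qed (use C1 \<rho> in auto)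
    finally show ?thesis .
  next
    case False
    have "\<bar>f t - f s\<bar> \<le> 2 * K" using K(2)[of s] K(2)[of t] st by auto
    also have "\<dots> = 2 * K / \<rho> ^ m0 * \<rho> ^ m0" using \<rho> by simp
    also have "\<dots> \<le> C * (t - s) powr \<gamma>"
    proof (rule mult_mono)
      show "\<rho> ^ m0 \<le> (t - s) powr \<gamma>"
        unfolding \<rho>_pow[symmetric] using False \<gamma> by (intro powr_mono2) auto
    qed (use C1 \<rho> in auto)
    finally show ?thesis .
  qed
  have "\<bar>f s - f t\<bar> \<le> C * \<bar>s - t\<bar> powr \<gamma>" if "s \<in> {0..real T}" "t \<in> {0..real T}" for s t
  proof -
    consider "s < t" | "t < s" | "s = t" by linarith
    then show ?thesis
    proof cases
      case 1 then show ?thesis using ordered[of s t] that by (simp add: abs_minus_commute)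
    next
      case 2 then show ?thesis using ordered[of t s] that by simp
    qed (use C1 in auto)
  qed
  then show ?thesis using C1 by blast
qed

section \<open>Gaussian spaces\<close>

text \<open>The weights may be signed: this allows iteration over coordinates, the remaining
  trigonometric factors being absorbed into the weight.\<close>

lemma (in prob_space) weighted_law_eqI:
  fixes u1 u2 Y :: "'a \<Rightarrow> real"
  assumes [measurable]: "u1 \<in> borel_measurable M" "u2 \<in> borel_measurable M" "Y \<in> borel_measurable M"
    and bounds: "\<And>\<omega>. \<bar>u1 \<omega>\<bar> \<le> C" "\<And>\<omega>. \<bar>u2 \<omega>\<bar> \<le> C"
    and cos_eq: "\<And>s. expectation (\<lambda>\<omega>. u1 \<omega> * cos (s * Y \<omega>)) = expectation (\<lambda>\<omega>. u2 \<omega> * cos (s * Y \<omega>))"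
    and sin_eq: "\<And>s. expectation (\<lambda>\<omega>. u1 \<omega> * sin (s * Y \<omega>)) = expectation (\<lambda>\<omega>. u2 \<omega> * sin (s * Y \<omega>))"
    and B [measurable]: "B \<in> sets borel"
  shows "expectation (\<lambda>\<omega>. u1 \<omega> * indicator B (Y \<omega>)) = expectation (\<lambda>\<omega>. u2 \<omega> * indicator B (Y \<omega>))"
proof -
  \<comment> \<open>Adding \<open>D\<close> makes the signed weights positive, and division by the
    total mass \<open>c\<close> makes them probability densities, so that the uniqueness theorem for
    characteristic functions applies. Both weights have the same total mass by the cosine hypothesis
    at frequency 0.\<close>
  define D where "D = C + 1"
  define c where "c = expectation u1 + D"
  have int_u: "integrable M (\<lambda>\<omega>. u \<omega> * g \<omega>)"
    if "u \<in> borel_measurable M" "g \<in> borel_measurable M" "\<And>\<omega>. \<bar>u \<omega>\<bar> \<le> C" "\<And>\<omega>. \<bar>g \<omega>\<bar> \<le> 1"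
    for u g :: "'a \<Rightarrow> real"
  proof (rule integrable_const_bound[where B = C])
    show "AE \<omega> in M. norm (u \<omega> * g \<omega>) \<le> C"
    proof (rule AE_I2)
      fix \<omega> show "norm (u \<omega> * g \<omega>) \<le> C"
        using mult_mono[OF that(3)[of \<omega>] that(4)[of \<omega>]] that(3)[of \<omega>] by (simp add: abs_mult)
    qed
  qed (use that in measurable)
  have int_g: "integrable M g" if "g \<in> borel_measurable M" "\<And>\<omega>. \<bar>g \<omega>\<bar> \<le> 1" for g :: "'a \<Rightarrow> real"
    using that by (intro integrable_const_bound[where B = 1]) auto
  have int1: "integrable M u1" "integrable M u2"
    using int_u[of u1 "\<lambda>_. 1"] int_u[of u2 "\<lambda>_. 1"] bounds by simp_all
  have E_eq: "expectation u1 = expectation u2" using cos_eq[of 0] by simp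
  have c1: "c \<ge> 1"
  proof -
    have "expectation (\<lambda>_. - C) \<le> expectation u1"
      using bounds(1) by (intro integral_mono) (auto simp: int1 abs_le_iff intro: minus_le_iff[THEN iffD1])
    then show ?thesis by (simp add: c_def D_def prob_space)
  qed
  define N where "N u = distr (density M (\<lambda>\<omega>. ennreal ((u \<omega> + D) / c))) borel Y" for u
  define good where "good u \<longleftrightarrow> u \<in> borel_measurable M \<and> (\<forall>\<omega>. \<bar>u \<omega>\<bar> \<le> C) \<and> expectation u = expectation u1 \<and> integrable M u" for u
  have good12: "good u1" "good u2"
    using bounds int1 E_eq by (auto simp: good_def)
  have nonneg: "0 \<le> (u \<omega> + D) / c" if "good u" for u \<omega>
    using that c1 by (auto simp: good_def D_def abs_le_iff intro!: divide_nonneg_nonneg) (smt (verit))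
  have rd: "real_distribution (N u)" if u: "good u" for u
  proof -
    have [measurable]: "u \<in> borel_measurable M" using u by (simp add: good_def)
    have "emeasure (density M (\<lambda>\<omega>. ennreal ((u \<omega> + D) / c))) (space M) = (\<integral>\<^sup>+\<omega>. ennreal ((u \<omega> + D) / c) \<partial>M)"
      by (simp add: emeasure_density cong: nn_integral_cong)
    also have "\<dots> = ennreal (expectation (\<lambda>\<omega>. (u \<omega> + D) / c))"
      using u nonneg[OF u] by (intro nn_integral_eq_integral) (auto simp: good_def)
    also have "expectation (\<lambda>\<omega>. (u \<omega> + D) / c) = 1"
      using u c1 by (simp add: good_def c_def prob_space)
    finally have "prob_space (density M (\<lambda>\<omega>. ennreal ((u \<omega> + D) / c)))"
      by (intro prob_spaceI) simp
    then have "prob_space (N u)"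
      unfolding N_def by (rule prob_space.prob_space_distr) simp
    then show ?thesis
      by (simp add: real_distribution_def real_distribution_axioms_def N_def)
  qed
  have int_N: "integral\<^sup>L (N u) g = expectation (\<lambda>\<omega>. ((u \<omega> + D) / c) * g (Y \<omega>))"
    if u: "good u" and [measurable]: "g \<in> borel_measurable borel" for u and g :: "real \<Rightarrow> real"
  proof -
    have [measurable]: "u \<in> borel_measurable M" using u by (simp add: good_def)
    show ?thesis unfolding N_def using nonneg[OF u]
      by (simp add: integral_distr integral_density)
  qed
  have expand: "expectation (\<lambda>\<omega>. ((u \<omega> + D) / c) * g (Y \<omega>)) =
      (expectation (\<lambda>\<omega>. u \<omega> * g (Y \<omega>)) + D * expectation (\<lambda>\<omega>. g (Y \<omega>))) / c"
    if u: "good u" and [measurable]: "g \<in> borel_measurable borel" and "\<And>y. \<bar>g y\<bar> \<le> 1" for u and g :: "real \<Rightarrow> real"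
  proof -
    have [measurable]: "u \<in> borel_measurable M" using u by (simp add: good_def)
    have "integrable M (\<lambda>\<omega>. u \<omega> * g (Y \<omega>))"
      by (rule int_u) (use u that(3) in \<open>auto simp: good_def\<close>)
    moreover have "integrable M (\<lambda>\<omega>. g (Y \<omega>))"
      by (rule int_g) (use that(3) in auto)
    ultimately show ?thesis by (simp add: add_divide_distrib ring_distribs)
  qed
  note N_val = trans[OF int_N expand]
  have "char (N u1) = char (N u2)"
  proof
    fix s
    have ch: "char (N u) s = Complex (integral\<^sup>L (N u) (\<lambda>x. cos (s * x))) (integral\<^sup>L (N u) (\<lambda>x. sin (s * x)))"
      if "good u" for u
    proof -
      have "prob_space (N u)" using rd[OF that] by (simp add: real_distribution_def)
      then have i: "integrable (N u) (\<lambda>x. iexp (s * x))"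
        by (rule prob_space.integrable_iexp) (auto simp: N_def)
      show ?thesis
        unfolding char_def
        using integral_Re[OF i] integral_Im[OF i] by (intro complex_eqI) (simp_all add: Re_exp Im_exp)
    qed
    show "char (N u1) s = char (N u2) s"
      using cos_eq sin_eq by (simp add: ch good12 N_val)
  qed
  then have "N u1 = N u2" by (intro Levy_uniqueness rd good12)
  then have "integral\<^sup>L (N u1) (indicator B) = (integral\<^sup>L (N u2) (indicator B) :: real)" by simp
  moreover have "integral\<^sup>L (N u) (indicator B) =
      (expectation (\<lambda>\<omega>. u \<omega> * indicator B (Y \<omega>)) + D * expectation (\<lambda>\<omega>. indicator B (Y \<omega>))) / c"
    if "good u" for u
    using that by (intro N_val) (auto simp: indicator_def)
  ultimately show ?thesis using c1 good12 by simp
qed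

text \<open>Coordinates are converted from trigonometric functions to indicators one at a time, the
  last one first. Once converted, an indicator joins the weight, whose bound \<open>C\<close> is
  preserved, and the induction hypothesis takes care of the remaining coordinates.\<close>

lemma (in prob_space) weighted_box_eqI:
  fixes Y :: "nat \<Rightarrow> 'a \<Rightarrow> real"
  assumes "\<And>k. k < n \<Longrightarrow> Y k \<in> borel_measurable M"
    and "u1 \<in> borel_measurable M" "u2 \<in> borel_measurable M"
    and "\<And>\<omega>. \<bar>u1 \<omega>\<bar> \<le> C" "\<And>\<omega>. \<bar>u2 \<omega>\<bar> \<le> C"
    and "\<And>t. expectation (\<lambda>\<omega>. u1 \<omega> * cos (\<Sum>k<n. t k * Y k \<omega>)) = expectation (\<lambda>\<omega>. u2 \<omega> * cos (\<Sum>k<n. t k * Y k \<omega>))"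
    and "\<And>t. expectation (\<lambda>\<omega>. u1 \<omega> * sin (\<Sum>k<n. t k * Y k \<omega>)) = expectation (\<lambda>\<omega>. u2 \<omega> * sin (\<Sum>k<n. t k * Y k \<omega>))"
    and "\<And>k. k < n \<Longrightarrow> B k \<in> sets borel"
  shows "expectation (\<lambda>\<omega>. u1 \<omega> * (\<Prod>k<n. indicator (B k) (Y k \<omega>))) =
         expectation (\<lambda>\<omega>. u2 \<omega> * (\<Prod>k<n. indicator (B k) (Y k \<omega>)))"
  using assms
proof (induction n arbitrary: u1 u2)
  case 0
  then show ?case using "0.prems"(6)[of "\<lambda>_. 0"] by simp
next
  case (Suc n)
  note [measurable] = Suc.prems(2,3)
  have Y [measurable]: "k < n \<Longrightarrow> Y k \<in> borel_measurable M" "Y n \<in> borel_measurable M" for k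
    using Suc.prems(1) by auto
  have B [measurable]: "B n \<in> sets borel" using Suc.prems(8) by auto
  let ?S = "\<lambda>t \<omega>. \<Sum>k<n. t k * Y k \<omega>"
  let ?E = expectation
  have int: "integrable M (\<lambda>\<omega>. u \<omega> * g \<omega>)"
    if "u \<in> borel_measurable M" "\<And>\<omega>. \<bar>u \<omega>\<bar> \<le> C" "g \<in> borel_measurable M" "\<And>\<omega>. \<bar>g \<omega>\<bar> \<le> 1" for u g :: "'a \<Rightarrow> real"
  proof (rule integrable_const_bound[where B = C])
    show "AE \<omega> in M. norm (u \<omega> * g \<omega>) \<le> C"
    proof (rule AE_I2)
      fix \<omega> show "norm (u \<omega> * g \<omega>) \<le> C"
        using mult_mono[OF that(2)[of \<omega>] that(4)[of \<omega>]] that(2)[of \<omega>] by (simp add: abs_mult)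
    qed
  qed (use that in measurable)
  have *: "?E (\<lambda>\<omega>. u1 \<omega> * cos (?S t \<omega> + s * Y n \<omega>)) = ?E (\<lambda>\<omega>. u2 \<omega> * cos (?S t \<omega> + s * Y n \<omega>))"
    "?E (\<lambda>\<omega>. u1 \<omega> * sin (?S t \<omega> + s * Y n \<omega>)) = ?E (\<lambda>\<omega>. u2 \<omega> * sin (?S t \<omega> + s * Y n \<omega>))" for t s
    using Suc.prems(6)[of "t(n := s)"] Suc.prems(7)[of "t(n := s)"] by simp_all
  \<comment> \<open>The hypotheses concern sines and cosines of the complete sum; product-to-sum
    formulas, applied with both signs of \<open>s\<close>, isolate the factor that depends on
    coordinate \<open>n\<close>.\<close>
  have prod: "?E (\<lambda>\<omega>. (u \<omega> * cos (?S t \<omega>)) * cos (s * Y n \<omega>)) =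
      (?E (\<lambda>\<omega>. u \<omega> * cos (?S t \<omega> + s * Y n \<omega>)) + ?E (\<lambda>\<omega>. u \<omega> * cos (?S t \<omega> + (-s) * Y n \<omega>))) / 2"
    "?E (\<lambda>\<omega>. (u \<omega> * cos (?S t \<omega>)) * sin (s * Y n \<omega>)) =
      (?E (\<lambda>\<omega>. u \<omega> * sin (?S t \<omega> + s * Y n \<omega>)) - ?E (\<lambda>\<omega>. u \<omega> * sin (?S t \<omega> + (-s) * Y n \<omega>))) / 2"
    "?E (\<lambda>\<omega>. (u \<omega> * sin (?S t \<omega>)) * cos (s * Y n \<omega>)) =
      (?E (\<lambda>\<omega>. u \<omega> * sin (?S t \<omega> + s * Y n \<omega>)) + ?E (\<lambda>\<omega>. u \<omega> * sin (?S t \<omega> + (-s) * Y n \<omega>))) / 2"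
    "?E (\<lambda>\<omega>. (u \<omega> * sin (?S t \<omega>)) * sin (s * Y n \<omega>)) =
      (?E (\<lambda>\<omega>. u \<omega> * cos (?S t \<omega> + (-s) * Y n \<omega>)) - ?E (\<lambda>\<omega>. u \<omega> * cos (?S t \<omega> + s * Y n \<omega>))) / 2"
    if u [measurable]: "u \<in> borel_measurable M" and bd: "\<And>\<omega>. \<bar>u \<omega>\<bar> \<le> C" for u t s
  proof -
    have i: "integrable M (\<lambda>\<omega>. u \<omega> * cos (?S t \<omega> + s * Y n \<omega>))" "integrable M (\<lambda>\<omega>. u \<omega> * sin (?S t \<omega> + s * Y n \<omega>))" for s
      by (intro int bd; measurable; simp)+
    have p: "cos x * cos y = (cos (x + y) + cos (x + (-y))) / 2" "cos x * sin y = (sin (x + y) - sin (x + (-y))) / 2"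
      "sin x * cos y = (sin (x + y) + sin (x + (-y))) / 2" "sin x * sin y = (cos (x + (-y)) - cos (x + y)) / 2" for x y :: real
      by (simp_all add: cos_add sin_add cos_diff sin_diff)
    show "?E (\<lambda>\<omega>. (u \<omega> * cos (?S t \<omega>)) * cos (s * Y n \<omega>)) =
      (?E (\<lambda>\<omega>. u \<omega> * cos (?S t \<omega> + s * Y n \<omega>)) + ?E (\<lambda>\<omega>. u \<omega> * cos (?S t \<omega> + (-s) * Y n \<omega>))) / 2"
     "?E (\<lambda>\<omega>. (u \<omega> * cos (?S t \<omega>)) * sin (s * Y n \<omega>)) =
      (?E (\<lambda>\<omega>. u \<omega> * sin (?S t \<omega> + s * Y n \<omega>)) - ?E (\<lambda>\<omega>. u \<omega> * sin (?S t \<omega> + (-s) * Y n \<omega>))) / 2"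
    "?E (\<lambda>\<omega>. (u \<omega> * sin (?S t \<omega>)) * cos (s * Y n \<omega>)) =
      (?E (\<lambda>\<omega>. u \<omega> * sin (?S t \<omega> + s * Y n \<omega>)) + ?E (\<lambda>\<omega>. u \<omega> * sin (?S t \<omega> + (-s) * Y n \<omega>))) / 2"
    "?E (\<lambda>\<omega>. (u \<omega> * sin (?S t \<omega>)) * sin (s * Y n \<omega>)) =
      (?E (\<lambda>\<omega>. u \<omega> * cos (?S t \<omega> + (-s) * Y n \<omega>)) - ?E (\<lambda>\<omega>. u \<omega> * cos (?S t \<omega> + s * Y n \<omega>))) / 2"
      using i[of s] i[of "-s"] by (simp_all add: mult.assoc p ring_distribs diff_divide_distrib del: cos_minus sin_minus add_uminus_conv_diff)
  qed
  have bd_trig: "\<bar>u \<omega> * cos x\<bar> \<le> C" "\<bar>u \<omega> * sin x\<bar> \<le> C" "\<bar>u \<omega> * indicator A x\<bar> \<le> C"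
    if "\<And>\<omega>. \<bar>u \<omega>\<bar> \<le> C" for u \<omega> A and x :: real
    using that[of \<omega>] mult_mono[OF that[of \<omega>] abs_cos_le_one[of x]] mult_mono[OF that[of \<omega>] abs_sin_le_one[of x]]
    by (auto simp: abs_mult indicator_def)
  have bd_ind: "\<bar>u1 \<omega> * indicator (B n) (Y n \<omega>)\<bar> \<le> C" "\<bar>u2 \<omega> * indicator (B n) (Y n \<omega>)\<bar> \<le> C" for \<omega>
    by (intro bd_trig Suc.prems)+
  have "?E (\<lambda>\<omega>. (u1 \<omega> * indicator (B n) (Y n \<omega>)) * (\<Prod>k<n. indicator (B k) (Y k \<omega>))) =
    ?E (\<lambda>\<omega>. (u2 \<omega> * indicator (B n) (Y n \<omega>)) * (\<Prod>k<n. indicator (B k) (Y k \<omega>)))"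
  proof (rule Suc.IH)
    fix t
    have "?E (\<lambda>\<omega>. (u1 \<omega> * cos (?S t \<omega>)) * indicator (B n) (Y n \<omega>)) = ?E (\<lambda>\<omega>. (u2 \<omega> * cos (?S t \<omega>)) * indicator (B n) (Y n \<omega>))"
      by (rule weighted_law_eqI[where C = C])
        (use Suc.prems(4,5) in \<open>simp_all only: prod Suc.prems(2,3) * bd_trig B Y(2)\<close>, measurable)
    then show "?E (\<lambda>\<omega>. (u1 \<omega> * indicator (B n) (Y n \<omega>)) * cos (?S t \<omega>)) = ?E (\<lambda>\<omega>. (u2 \<omega> * indicator (B n) (Y n \<omega>)) * cos (?S t \<omega>))"
      by (simp add: mult_ac)
    have "?E (\<lambda>\<omega>. (u1 \<omega> * sin (?S t \<omega>)) * indicator (B n) (Y n \<omega>)) = ?E (\<lambda>\<omega>. (u2 \<omega> * sin (?S t \<omega>)) * indicator (B n) (Y n \<omega>))"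
      by (rule weighted_law_eqI[where C = C])
        (use Suc.prems(4,5) in \<open>simp_all only: prod Suc.prems(2,3) * bd_trig B Y(2)\<close>, measurable)
    then show "?E (\<lambda>\<omega>. (u1 \<omega> * indicator (B n) (Y n \<omega>)) * sin (?S t \<omega>)) = ?E (\<lambda>\<omega>. (u2 \<omega> * indicator (B n) (Y n \<omega>)) * sin (?S t \<omega>))"
      by (simp add: mult_ac)
  qed (use Suc.prems(8) in \<open>auto intro: bd_ind\<close>)
  then show ?case by (simp add: mult_ac)
qed

section \<open>Moments, tails and shifts of centred Gaussian variables\<close>

context prob_space
begin

lemma centered_gaussian_cases:
  assumes g: "gaussian_rv M Y" and m: "expectation Y = 0"
  obtains "AE \<omega> in M. Y \<omega> = 0" | \<sigma> where "0 < \<sigma>" "distributed M lborel Y (normal_density 0 \<sigma>)"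
proof -
  have [measurable]: "Y \<in> borel_measurable M" using g by (simp add: gaussian_rv_def)
  from g consider \<mu> where "AE \<omega> in M. Y \<omega> = \<mu>" 
    | \<mu> \<sigma> where "0 < \<sigma>" "distributed M lborel Y (normal_density \<mu> \<sigma>)"
    unfolding gaussian_rv_def by blast
  then show ?thesis
  proof cases
    case (1 \<mu>)
    have "expectation Y = expectation (\<lambda>_. \<mu>)" using 1 by (intro integral_cong_AE) auto
    then show ?thesis using 1 m that(1) by (simp add: prob_space)
  next
    case (2 \<mu> \<sigma>)
    then have "expectation Y = \<mu>" using normal_distributed_expectation by blast
    then show ?thesis using 2 m that(2) by auto
  qed
qed

text \<open>Everything is expressed through the second moment, so that point masses and genuine
  normal laws obey the same formulas and later arguments need no case distinction.\<close>

lemma centered_gaussian_moments: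
  assumes g: "gaussian_rv M Y" and m: "expectation Y = 0"
  shows centered_gaussian_integrable: "integrable M Y"
    and centered_gaussian_integrable_square: "integrable M (\<lambda>\<omega>. (Y \<omega>)\<^sup>2)"
    and centered_gaussian_integrable_exp: "integrable M (\<lambda>\<omega>. exp (s * Y \<omega>))"
    and centered_gaussian_exp: "expectation (\<lambda>\<omega>. exp (s * Y \<omega>)) = exp (s\<^sup>2 * expectation (\<lambda>\<omega>. (Y \<omega>)\<^sup>2) / 2)"
    and centered_gaussian_cos: "expectation (\<lambda>\<omega>. cos (Y \<omega>)) = exp (- expectation (\<lambda>\<omega>. (Y \<omega>)\<^sup>2) / 2)"
    and centered_gaussian_sin: "expectation (\<lambda>\<omega>. sin (Y \<omega>)) = 0"
proof -
  have [measurable]: "Y \<in> borel_measurable M" using g by (simp add: gaussian_rv_def)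
  have "integrable M Y \<and> integrable M (\<lambda>\<omega>. (Y \<omega>)\<^sup>2) \<and> integrable M (\<lambda>\<omega>. exp (s * Y \<omega>)) \<and>
     expectation (\<lambda>\<omega>. exp (s * Y \<omega>)) = exp (s\<^sup>2 * expectation (\<lambda>\<omega>. (Y \<omega>)\<^sup>2) / 2) \<and>
     expectation (\<lambda>\<omega>. cos (Y \<omega>)) = exp (- expectation (\<lambda>\<omega>. (Y \<omega>)\<^sup>2) / 2) \<and>
     expectation (\<lambda>\<omega>. sin (Y \<omega>)) = 0"
    using g m
  proof (cases rule: centered_gaussian_cases)
    case 1
    have int: "integrable M (\<lambda>\<omega>. f (Y \<omega>))" and E: "expectation (\<lambda>\<omega>. f (Y \<omega>)) = f 0"
      if [measurable]: "f \<in> borel_measurable borel" for f :: "real \<Rightarrow> real"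
    proof -
      have *: "AE \<omega> in M. f (Y \<omega>) = f 0" using 1 by eventually_elim simp
      show "integrable M (\<lambda>\<omega>. f (Y \<omega>))"
        by (rule integrable_cong_AE_imp[of _ "\<lambda>_. f 0"]) (use * in \<open>auto elim: eventually_mono\<close>)
      have "expectation (\<lambda>\<omega>. f (Y \<omega>)) = expectation (\<lambda>_. f 0)"
        using * by (intro integral_cong_AE) auto
      then show "expectation (\<lambda>\<omega>. f (Y \<omega>)) = f 0" by (simp add: prob_space)
    qed
    show ?thesis using int[of "\<lambda>y. y"] int[of "\<lambda>y. y\<^sup>2"] int[of "\<lambda>y. exp (s * y)"]
        E[of "\<lambda>y. y\<^sup>2"] E[of "\<lambda>y. exp (s * y)"] E[of cos] E[of sin] by simp
  next
    case (2 \<sigma>)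
    note D = 2(2)
    have int_iff: "integrable M (\<lambda>\<omega>. f (Y \<omega>)) \<longleftrightarrow> integrable lborel (\<lambda>x. normal_density 0 \<sigma> x * f x)" 
      and E: "expectation (\<lambda>\<omega>. f (Y \<omega>)) = (\<integral>x. normal_density 0 \<sigma> x * f x \<partial>lborel)"
      if [measurable]: "f \<in> borel_measurable borel" for f :: "real \<Rightarrow> real"
      using distributed_integrable[OF D, of f] distributed_integral[OF D, of f] by auto
    have v: "expectation (\<lambda>\<omega>. (Y \<omega>)\<^sup>2) = \<sigma>\<^sup>2"
    proof -
      have "(\<integral>x. normal_density 0 \<sigma> x * x\<^sup>2 \<partial>lborel) = \<sigma>\<^sup>2"
        using integral_normal_moment_even[OF 2(1), of 0 1] by simp
      then show ?thesis using E[of "\<lambda>x. x\<^sup>2"] by simp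
    qed
    have i1: "integrable M Y" using int_iff[of "\<lambda>x. x"] integrable_normal_moment[OF 2(1), of 0 1] by simp
    have i2: "integrable M (\<lambda>\<omega>. (Y \<omega>)\<^sup>2)" 
      using int_iff[of "\<lambda>x. x\<^sup>2"] integrable_normal_moment[OF 2(1), of 0 2] by simp
    \<comment> \<open>Completing the square: exponential tilting only moves the mean to
      \<open>s * \<sigma>\<^sup>2\<close>.\<close>
    have tilt: "normal_density 0 \<sigma> x * exp (s * x) = exp (s\<^sup>2 * \<sigma>\<^sup>2 / 2) * normal_density (s * \<sigma>\<^sup>2) \<sigma> x" for x
    proof -
      have "- x\<^sup>2 / (2 * \<sigma>\<^sup>2) + s * x = s\<^sup>2 * \<sigma>\<^sup>2 / 2 + - (x - s * \<sigma>\<^sup>2)\<^sup>2 / (2 * \<sigma>\<^sup>2)"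
        using 2(1) by (simp add: field_simps power2_eq_square)
      then show ?thesis by (simp add: normal_density_def exp_add[symmetric])
    qed
    have i3: "integrable M (\<lambda>\<omega>. exp (s * Y \<omega>))"
      using int_iff[of "\<lambda>x. exp (s * x)"] 2(1) by (simp add: tilt)
    have e3: "expectation (\<lambda>\<omega>. exp (s * Y \<omega>)) = exp (s\<^sup>2 * \<sigma>\<^sup>2 / 2)"
      using E[of "\<lambda>x. exp (s * x)"] 2(1) by (simp add: tilt)
    have S: "distributed M lborel (\<lambda>\<omega>. Y \<omega> / \<sigma>) std_normal_density"
      using normal_standard_normal_convert[OF 2(1), of Y 0] D by simp
    have "char (distr M lborel (\<lambda>\<omega>. Y \<omega> / \<sigma>)) \<sigma> = exp (- \<sigma>\<^sup>2 / 2)"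
      using distributed_distr_eq_density[OF S] char_std_normal_distribution by simp
    moreover have "char (distr M lborel (\<lambda>\<omega>. Y \<omega> / \<sigma>)) \<sigma> = (CLINT \<omega>|M. iexp (Y \<omega>))"
      unfolding char_def using 2(1) by (subst integral_distr) auto
    ultimately have c: "(CLINT \<omega>|M. iexp (Y \<omega>)) = exp (- \<sigma>\<^sup>2 / 2)" by simp
    have i: "integrable M (\<lambda>\<omega>. iexp (Y \<omega>))" by (intro integrable_iexp) auto
    have "expectation (\<lambda>\<omega>. cos (Y \<omega>)) = exp (- \<sigma>\<^sup>2 / 2)" "expectation (\<lambda>\<omega>. sin (Y \<omega>)) = 0"
      using integral_Re[OF i] integral_Im[OF i] by (simp_all add: c Re_exp Im_exp)
    then show ?thesis using i1 i2 i3 e3 by (simp add: v)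
  qed
  then show "integrable M Y" "integrable M (\<lambda>\<omega>. (Y \<omega>)\<^sup>2)" "integrable M (\<lambda>\<omega>. exp (s * Y \<omega>))"
    "expectation (\<lambda>\<omega>. exp (s * Y \<omega>)) = exp (s\<^sup>2 * expectation (\<lambda>\<omega>. (Y \<omega>)\<^sup>2) / 2)"
    "expectation (\<lambda>\<omega>. cos (Y \<omega>)) = exp (- expectation (\<lambda>\<omega>. (Y \<omega>)\<^sup>2) / 2)"
    "expectation (\<lambda>\<omega>. sin (Y \<omega>)) = 0" by blast+
qed

text \<open>Chernoff bound with the fixed parameter \<open>1 / \<sigma>\<close> rather than the
  optimal one. The resulting exponential tail is enough, since in the applications
  \<open>a / \<sigma>\<close> grows like a power of the inverse mesh, up to logarithms.\<close>

lemma centered_gaussian_tail: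
  assumes g: "gaussian_rv M Y" and m: "expectation Y = 0"
    and v: "expectation (\<lambda>\<omega>. (Y \<omega>)\<^sup>2) \<le> \<sigma>\<^sup>2" and "0 < \<sigma>"
  shows "prob {\<omega> \<in> space M. a \<le> Y \<omega>} \<le> exp (1/2 - a / \<sigma>)"
proof -
  have [measurable]: "Y \<in> borel_measurable M" using g by (simp add: gaussian_rv_def)
  have "prob {\<omega> \<in> space M. a \<le> Y \<omega>} = prob {\<omega> \<in> space M. exp (a / \<sigma>) \<le> exp (1 / \<sigma> * Y \<omega>)}"
    using \<open>0 < \<sigma>\<close> by (simp add: divide_le_cancel)
  also have "\<dots> \<le> expectation (\<lambda>\<omega>. exp (1 / \<sigma> * Y \<omega>)) / exp (a / \<sigma>)"
    by (rule integral_Markov_inequality_measure[where A = "{}"]) (use centered_gaussian_integrable_exp[OF g m, of "1 / \<sigma>"] in auto)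
  also have "\<dots> = exp ((1 / \<sigma>)\<^sup>2 * expectation (\<lambda>\<omega>. (Y \<omega>)\<^sup>2) / 2) / exp (a / \<sigma>)"
    by (subst centered_gaussian_exp[OF g m]) simp
  also have "\<dots> \<le> exp (1/2) / exp (a / \<sigma>)"
    using v \<open>0 < \<sigma>\<close> by (intro divide_right_mono) (auto simp: power_divide divide_le_eq)
  finally show ?thesis by (simp add: exp_diff)
qed

text \<open>The Gaussian density at \<open>z\<close> is at most \<open>exp (c z + c\<^sup>2 \<sigma>\<^sup>2 / 2)\<close> times the density at
  \<open>z + c \<sigma>\<^sup>2\<close>; a shift of the level thus costs only a bounded factor on \<open>{Z \<le> 1 / c}\<close>.\<close>

lemma prob_shift_normal_le:
  assumes D: "distributed M lborel Z (normal_density 0 \<sigma>)" and "0 < \<sigma>" "0 < c"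
    and indep: "indep_var borel W borel Z"
  shows "prob {\<omega> \<in> space M. W \<omega> \<le> Z \<omega>} \<le>
    exp (1 + c\<^sup>2 * \<sigma>\<^sup>2 / 2) * prob {\<omega> \<in> space M. W \<omega> + c * \<sigma>\<^sup>2 \<le> Z \<omega>} + prob {\<omega> \<in> space M. 1 / c \<le> Z \<omega>}"
proof -
  have [measurable]: "W \<in> borel_measurable M" "Z \<in> borel_measurable M"
    using indep_var_rv1[OF indep] indep_var_rv2[OF indep] by auto
  define K where "K = exp (1 + c\<^sup>2 * \<sigma>\<^sup>2 / 2)"
  let ?W = "distr M borel W" and ?Z = "distr M borel Z"
  interpret W: prob_space ?W by (rule prob_space_distr) simp
  interpret Z: prob_space ?Z by (rule prob_space_distr) simp
  have J: "distr M (borel \<Otimes>\<^sub>M borel) (\<lambda>\<omega>. (W \<omega>, Z \<omega>)) = ?W \<Otimes>\<^sub>M ?Z"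
    using indep by (simp add: indep_var_distribution_eq)
  have Zd: "?Z = density lborel (normal_density 0 \<sigma>)"
    using distributed_distr_eq_density[OF D] by (metis distr_cong sets_lborel)
  \<comment> \<open>By independence the joint law is a product, so events in \<open>(W, Z)\<close>
    can be sliced at a fixed value of \<open>W\<close> and only the law of \<open>Z\<close> has to
    be compared.\<close>
  have joint: "emeasure M {\<omega> \<in> space M. (W \<omega>, Z \<omega>) \<in> S} = (\<integral>\<^sup>+w. emeasure ?Z (Pair w -` S) \<partial>?W)"
    if S: "S \<in> sets (borel \<Otimes>\<^sub>M borel)" for S
  proof -
    have "emeasure M {\<omega> \<in> space M. (W \<omega>, Z \<omega>) \<in> S} = emeasure (distr M (borel \<Otimes>\<^sub>M borel) (\<lambda>\<omega>. (W \<omega>, Z \<omega>))) S"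
      using S by (subst emeasure_distr) (auto simp: space_pair_measure intro!: arg_cong[where f = "emeasure M"])
    also have "\<dots> = (\<integral>\<^sup>+w. emeasure ?Z (Pair w -` S) \<partial>?W)"
      unfolding J using S by (intro Z.emeasure_pair_measure_alt) (simp add: sets_pair_measure_cong[of ?W borel ?Z borel])
    finally show ?thesis .
  qed
  have pt: "emeasure ?Z {w..1/c} \<le> ennreal K * emeasure ?Z {w + c * \<sigma>\<^sup>2..}" for w
  proof -
    have dens: "normal_density 0 \<sigma> z \<le> K * normal_density 0 \<sigma> (z + c * \<sigma>\<^sup>2)" if "z \<le> 1 / c" for z
    proof -
      have "- z\<^sup>2 / (2 * \<sigma>\<^sup>2) = c * z + c\<^sup>2 * \<sigma>\<^sup>2 / 2 + - (z + c * \<sigma>\<^sup>2)\<^sup>2 / (2 * \<sigma>\<^sup>2)"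
        using \<open>0 < \<sigma>\<close> by (simp add: field_simps power2_eq_square)
      also have "\<dots> \<le> (1 + c\<^sup>2 * \<sigma>\<^sup>2 / 2) + - (z + c * \<sigma>\<^sup>2)\<^sup>2 / (2 * \<sigma>\<^sup>2)"
        using that \<open>0 < c\<close> by (simp add: field_simps)
      finally have "exp (- z\<^sup>2 / (2 * \<sigma>\<^sup>2)) \<le> K * exp (- (z + c * \<sigma>\<^sup>2)\<^sup>2 / (2 * \<sigma>\<^sup>2))"
        by (simp add: K_def exp_add[symmetric])
      then show ?thesis using \<open>0 < \<sigma>\<close>
        by (simp add: normal_density_def divide_right_mono mult.commute)
    qed
    have "emeasure ?Z {w..1/c} = (\<integral>\<^sup>+z. ennreal (normal_density 0 \<sigma> z) * indicator {w..1/c} z \<partial>lborel)"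
      unfolding Zd by (simp add: emeasure_density)
    also have "\<dots> \<le> (\<integral>\<^sup>+z. ennreal K * (ennreal (normal_density 0 \<sigma> (z + c * \<sigma>\<^sup>2)) * indicator {w + c * \<sigma>\<^sup>2..} (z + c * \<sigma>\<^sup>2)) \<partial>lborel)"
      using dens by (intro nn_integral_mono)
        (auto simp: indicator_def K_def ennreal_mult[symmetric] intro!: ennreal_leI)
    also have "\<dots> = ennreal K * (\<integral>\<^sup>+z. ennreal (normal_density 0 \<sigma> (z + c * \<sigma>\<^sup>2)) * indicator {w + c * \<sigma>\<^sup>2..} (z + c * \<sigma>\<^sup>2) \<partial>lborel)"
      by (subst nn_integral_cmult) auto
    also have "(\<integral>\<^sup>+z. ennreal (normal_density 0 \<sigma> (z + c * \<sigma>\<^sup>2)) * indicator {w + c * \<sigma>\<^sup>2..} (z + c * \<sigma>\<^sup>2) \<partial>lborel) =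
        (\<integral>\<^sup>+z. ennreal (normal_density 0 \<sigma> z) * indicator {w + c * \<sigma>\<^sup>2..} z \<partial>lborel)"
      using nn_integral_real_affine[where c = 1 and t = "c * \<sigma>\<^sup>2" and f = "\<lambda>z. ennreal (normal_density 0 \<sigma> z) * indicator {w + c * \<sigma>\<^sup>2..} z"]
      by (simp add: add.commute)
    also have "\<dots> = emeasure ?Z {w + c * \<sigma>\<^sup>2..}"
      unfolding Zd by (simp add: emeasure_density)
    finally show ?thesis .
  qed
  have "closed {p :: real \<times> real. fst p \<le> snd p \<and> snd p \<le> 1 / c}" "closed {p :: real \<times> real. fst p + c * \<sigma>\<^sup>2 \<le> snd p}"
    by (intro closed_Collect_conj closed_Collect_le continuous_intros)+
  then have S1: "{p :: real \<times> real. fst p \<le> snd p \<and> snd p \<le> 1 / c} \<in> sets (borel \<Otimes>\<^sub>M borel)"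
    and S2: "{p :: real \<times> real. fst p + c * \<sigma>\<^sup>2 \<le> snd p} \<in> sets (borel \<Otimes>\<^sub>M borel)"
    unfolding borel_prod by (blast intro: borel_closed)+
  have "emeasure M {\<omega> \<in> space M. W \<omega> \<le> Z \<omega> \<and> Z \<omega> \<le> 1 / c} = (\<integral>\<^sup>+w. emeasure ?Z {w..1/c} \<partial>?W)"
    using joint[OF S1] by (simp add: vimage_def atLeastAtMost_def atLeast_def atMost_def Int_def)
  also have "\<dots> \<le> (\<integral>\<^sup>+w. ennreal K * emeasure ?Z {w + c * \<sigma>\<^sup>2..} \<partial>?W)"
    by (intro nn_integral_mono pt)
  also have "\<dots> = ennreal K * (\<integral>\<^sup>+w. emeasure ?Z {w + c * \<sigma>\<^sup>2..} \<partial>?W)"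
  proof (rule nn_integral_cmult)
    have "(\<lambda>w. emeasure ?Z (Pair w -` {p. fst p + c * \<sigma>\<^sup>2 \<le> snd p})) \<in> borel_measurable borel"
      by (rule Z.measurable_emeasure_Pair) (use S2 in simp)
    then show "(\<lambda>w. emeasure ?Z {w + c * \<sigma>\<^sup>2..}) \<in> borel_measurable ?W"
      by (simp add: vimage_def atLeast_def)
  qed
  also have "(\<integral>\<^sup>+w. emeasure ?Z {w + c * \<sigma>\<^sup>2..} \<partial>?W) = emeasure M {\<omega> \<in> space M. W \<omega> + c * \<sigma>\<^sup>2 \<le> Z \<omega>}"
    using joint[OF S2] by (simp add: vimage_def atLeast_def)
  finally have "prob {\<omega> \<in> space M. W \<omega> \<le> Z \<omega> \<and> Z \<omega> \<le> 1 / c} \<le> K * prob {\<omega> \<in> space M. W \<omega> + c * \<sigma>\<^sup>2 \<le> Z \<omega>}"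
    by (simp add: emeasure_eq_measure ennreal_mult[symmetric] K_def)
  moreover have "prob {\<omega> \<in> space M. W \<omega> \<le> Z \<omega>} \<le>
      prob ({\<omega> \<in> space M. W \<omega> \<le> Z \<omega> \<and> Z \<omega> \<le> 1 / c} \<union> {\<omega> \<in> space M. 1 / c \<le> Z \<omega>})"
    by (intro finite_measure_mono) auto
  moreover have "\<dots> \<le> prob {\<omega> \<in> space M. W \<omega> \<le> Z \<omega> \<and> Z \<omega> \<le> 1 / c} + prob {\<omega> \<in> space M. 1 / c \<le> Z \<omega>}"
    by (intro measure_Un_le) auto
  ultimately show ?thesis by (simp add: K_def)
qed

end

lemma (in prob_space) centered_gaussian_distributed:
  assumes g: "gaussian_rv M Y" and m: "expectation Y = 0" and v: "0 < expectation (\<lambda>\<omega>. (Y \<omega>)\<^sup>2)"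
  shows "distributed M lborel Y (normal_density 0 (sqrt (expectation (\<lambda>\<omega>. (Y \<omega>)\<^sup>2))))"
  using g m
proof (cases rule: centered_gaussian_cases)
  case 1
  have [measurable]: "Y \<in> borel_measurable M" using g by (simp add: gaussian_rv_def)
  have "expectation (\<lambda>\<omega>. (Y \<omega>)\<^sup>2) = expectation (\<lambda>_. 0)" using 1 by (intro integral_cong_AE) auto
  then show ?thesis using v by simp
next
  case (2 \<sigma>)
  have "expectation (\<lambda>\<omega>. (Y \<omega>)\<^sup>2) = (\<integral>x. normal_density 0 \<sigma> x * x\<^sup>2 \<partial>lborel)"
    using distributed_integral[OF 2(2), of "\<lambda>x. x\<^sup>2"] by simp
  also have "\<dots> = \<sigma>\<^sup>2" using integral_normal_moment_even[OF 2(1), of 0 1] by simp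
  finally show ?thesis using 2 by simp
qed

section \<open>Linear spaces of centred Gaussian variables; uncorrelated implies independent\<close>

locale centered_gaussian_space = prob_space M for M :: "'a measure" +
  fixes V :: "('a \<Rightarrow> real) set"
  assumes add_mem: "Y \<in> V \<Longrightarrow> Z \<in> V \<Longrightarrow> (\<lambda>\<omega>. Y \<omega> + Z \<omega>) \<in> V"
    and scale_mem: "Y \<in> V \<Longrightarrow> (\<lambda>\<omega>. c * Y \<omega>) \<in> V"
    and gaussian_mem: "Y \<in> V \<Longrightarrow> gaussian_rv M Y"
    and centered_mem: "Y \<in> V \<Longrightarrow> expectation Y = 0"
    and nonempty: "V \<noteq> {}"
begin

lemma zero_mem: "(\<lambda>_. 0) \<in> V"
  using nonempty scale_mem[of _ 0] by auto

lemma diff_mem: "Y \<in> V \<Longrightarrow> Z \<in> V \<Longrightarrow> (\<lambda>\<omega>. Y \<omega> - Z \<omega>) \<in> V"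
  using add_mem[of Y "\<lambda>\<omega>. (-1) * Z \<omega>"] scale_mem[of Z "-1"] by simp

lemma sum_mem: "(\<And>k. k \<in> I \<Longrightarrow> Y k \<in> V) \<Longrightarrow> (\<lambda>\<omega>. \<Sum>k\<in>I. Y k \<omega>) \<in> V"
  by (induction I rule: infinite_finite_induct) (auto simp: zero_mem intro!: add_mem)

lemma measurable_mem: "Y \<in> V \<Longrightarrow> Y \<in> borel_measurable M"
  using gaussian_mem by (simp add: gaussian_rv_def)

lemma
  assumes "Y \<in> V"
  shows integrable_mem: "integrable M Y"
    and integrable_square_mem: "integrable M (\<lambda>\<omega>. (Y \<omega>)\<^sup>2)"
    and integrable_exp_mem: "integrable M (\<lambda>\<omega>. exp (s * Y \<omega>))"
    and expectation_exp_mem: "expectation (\<lambda>\<omega>. exp (s * Y \<omega>)) = exp (s\<^sup>2 * expectation (\<lambda>\<omega>. (Y \<omega>)\<^sup>2) / 2)"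
    and expectation_cos_mem: "expectation (\<lambda>\<omega>. cos (Y \<omega>)) = exp (- expectation (\<lambda>\<omega>. (Y \<omega>)\<^sup>2) / 2)"
    and expectation_sin_mem: "expectation (\<lambda>\<omega>. sin (Y \<omega>)) = 0"
  by (rule centered_gaussian_moments[OF gaussian_mem[OF assms] centered_mem[OF assms]])+

lemma tail_mem:
  "Y \<in> V \<Longrightarrow> expectation (\<lambda>\<omega>. (Y \<omega>)\<^sup>2) \<le> \<sigma>\<^sup>2 \<Longrightarrow> 0 < \<sigma> \<Longrightarrow>
    prob {\<omega> \<in> space M. a \<le> Y \<omega>} \<le> exp (1/2 - a / \<sigma>)"
  by (rule centered_gaussian_tail[OF gaussian_mem centered_mem])

lemma integrable_mult_mem:
  assumes "Y \<in> V" "Z \<in> V" shows "integrable M (\<lambda>\<omega>. Y \<omega> * Z \<omega>)"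
proof (rule Bochner_Integration.integrable_bound[of _ "\<lambda>\<omega>. (Y \<omega>)\<^sup>2 + (Z \<omega>)\<^sup>2"])
  show "AE \<omega> in M. norm (Y \<omega> * Z \<omega>) \<le> norm ((Y \<omega>)\<^sup>2 + (Z \<omega>)\<^sup>2)"
  proof (rule AE_I2)
    fix \<omega>
    have "2 * \<bar>Y \<omega>\<bar> * \<bar>Z \<omega>\<bar> \<le> \<bar>Y \<omega>\<bar>\<^sup>2 + \<bar>Z \<omega>\<bar>\<^sup>2" by (rule sum_squares_bound)
    then show "norm (Y \<omega> * Z \<omega>) \<le> norm ((Y \<omega>)\<^sup>2 + (Z \<omega>)\<^sup>2)"
      using mult_nonneg_nonneg[OF abs_ge_zero[of "Y \<omega>"] abs_ge_zero[of "Z \<omega>"]]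
      unfolding real_norm_def abs_mult power2_abs by linarith
  qed
qed (use assms in \<open>auto intro!: integrable_square_mem borel_measurable_times intro: measurable_mem\<close>)

lemma expectation_square_add:
  assumes "Y \<in> V" "Z \<in> V"
  shows "expectation (\<lambda>\<omega>. (Y \<omega> + c * Z \<omega>)\<^sup>2) =
    expectation (\<lambda>\<omega>. (Y \<omega>)\<^sup>2) + 2 * c * expectation (\<lambda>\<omega>. Y \<omega> * Z \<omega>) + c\<^sup>2 * expectation (\<lambda>\<omega>. (Z \<omega>)\<^sup>2)"
proof -
  have "expectation (\<lambda>\<omega>. (Y \<omega> + c * Z \<omega>)\<^sup>2) =
      expectation (\<lambda>\<omega>. (Y \<omega>)\<^sup>2 + 2 * c * (Y \<omega> * Z \<omega>) + c\<^sup>2 * (Z \<omega>)\<^sup>2)"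
    by (simp add: power2_eq_square algebra_simps)
  then show ?thesis
    using assms by (simp add: integrable_square_mem integrable_mult_mem)
qed

lemma expectation_cos_cos:
  assumes "Y \<in> V" "Z \<in> V"
  shows "expectation (\<lambda>\<omega>. cos (Y \<omega>) * cos (Z \<omega>)) =
    (exp (- expectation (\<lambda>\<omega>. (Y \<omega> + Z \<omega>)\<^sup>2) / 2) + exp (- expectation (\<lambda>\<omega>. (Y \<omega> - Z \<omega>)\<^sup>2) / 2)) / 2"
proof -
  note [measurable] = assms[THEN measurable_mem]
  have i: "integrable M (\<lambda>\<omega>. cos (Y \<omega> + Z \<omega>))" "integrable M (\<lambda>\<omega>. cos (Y \<omega> - Z \<omega>))"
    by (auto intro!: integrable_const_bound[where B = 1])
  have "expectation (\<lambda>\<omega>. cos (Y \<omega>) * cos (Z \<omega>)) = expectation (\<lambda>\<omega>. (cos (Y \<omega> + Z \<omega>) + cos (Y \<omega> - Z \<omega>)) / 2)"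
    by (simp add: cos_add cos_diff)
  then show ?thesis
    using i assms by (simp add: expectation_cos_mem add_mem diff_mem)
qed

lemma expectation_cos_sin:
  assumes "Y \<in> V" "Z \<in> V"
  shows "expectation (\<lambda>\<omega>. cos (Y \<omega>) * sin (Z \<omega>)) = 0"
proof -
  note [measurable] = assms[THEN measurable_mem]
  have i: "integrable M (\<lambda>\<omega>. sin (Y \<omega> + Z \<omega>))" "integrable M (\<lambda>\<omega>. sin (Y \<omega> - Z \<omega>))"
    by (auto intro!: integrable_const_bound[where B = 1])
  have "expectation (\<lambda>\<omega>. cos (Y \<omega>) * sin (Z \<omega>)) = expectation (\<lambda>\<omega>. (sin (Y \<omega> + Z \<omega>) - sin (Y \<omega> - Z \<omega>)) / 2)"
    by (simp add: sin_add sin_diff)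
  then show ?thesis
    using i assms by (simp add: expectation_sin_mem add_mem diff_mem)
qed

text \<open>The product is half the difference of the cosines of \<open>Y - Z\<close> and
  \<open>Y + Z\<close>, which have equal second moments when the covariance vanishes.\<close>

lemma expectation_sin_sin:
  assumes "Y \<in> V" "Z \<in> V" and "expectation (\<lambda>\<omega>. Y \<omega> * Z \<omega>) = 0"
  shows "expectation (\<lambda>\<omega>. sin (Y \<omega>) * sin (Z \<omega>)) = 0"
proof -
  note [measurable] = assms(1,2)[THEN measurable_mem]
  have i: "integrable M (\<lambda>\<omega>. cos (Y \<omega> - Z \<omega>))" "integrable M (\<lambda>\<omega>. cos (Y \<omega> + Z \<omega>))"
    by (auto intro!: integrable_const_bound[where B = 1])
  have "expectation (\<lambda>\<omega>. sin (Y \<omega>) * sin (Z \<omega>)) = expectation (\<lambda>\<omega>. (cos (Y \<omega> - Z \<omega>) - cos (Y \<omega> + Z \<omega>)) / 2)"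
    by (simp add: cos_add cos_diff)
  also have "\<dots> = 0"
    using i assms expectation_square_add[of Y Z 1] expectation_square_add[of Y Z "-1"]
    by (simp add: expectation_cos_mem add_mem diff_mem)
  finally show ?thesis .
qed

text \<open>Trigonometric functions are exchanged for indicators twice: first in \<open>Z\<close>,
  with a trigonometric function of a linear combination of the \<open>Y k\<close> as weight, then in
  the \<open>Y k\<close>, with the indicator of \<open>A\<close> as weight. Each time the competing
  weight is a constant, which is how the product appears.\<close>

lemma uncorrelated_indep_box:
  fixes n :: nat
  assumes Z: "Z \<in> V" and Y: "\<And>k. k < n \<Longrightarrow> Y k \<in> V"
    and unc: "\<And>k. k < n \<Longrightarrow> expectation (\<lambda>\<omega>. Y k \<omega> * Z \<omega>) = 0"
    and A: "A \<in> sets borel" and B: "\<And>k. k < n \<Longrightarrow> B k \<in> sets borel"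
  shows "prob {\<omega> \<in> space M. Z \<omega> \<in> A \<and> (\<forall>k<n. Y k \<omega> \<in> B k)} =
    prob {\<omega> \<in> space M. Z \<omega> \<in> A} * prob {\<omega> \<in> space M. \<forall>k<n. Y k \<omega> \<in> B k}"
proof -
  note [measurable] = measurable_mem[OF Z] A
  let ?E = expectation
  let ?S = "\<lambda>t \<omega>. \<Sum>k<n. t k * Y k \<omega>"
  have S: "?S t \<in> V" for t by (intro sum_mem scale_mem Y) simp
  have S0: "?E (\<lambda>\<omega>. ?S t \<omega> * (s * Z \<omega>)) = 0" for t s
  proof -
    have "?E (\<lambda>\<omega>. ?S t \<omega> * (s * Z \<omega>)) = ?E (\<lambda>\<omega>. \<Sum>k<n. (s * t k) * (Y k \<omega> * Z \<omega>))"
      by (simp add: sum_distrib_left sum_distrib_right mult_ac)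
    also have "\<dots> = (\<Sum>k<n. (s * t k) * ?E (\<lambda>\<omega>. Y k \<omega> * Z \<omega>))"
      using Y Z by (subst Bochner_Integration.integral_sum) (auto intro!: integrable_mult_mem)
    finally show ?thesis by (simp add: unc)
  qed
  have sq: "?E (\<lambda>\<omega>. (?S t \<omega> + s * Z \<omega>)\<^sup>2) = ?E (\<lambda>\<omega>. (?S t \<omega>)\<^sup>2) + ?E (\<lambda>\<omega>. (s * Z \<omega>)\<^sup>2)"
    "?E (\<lambda>\<omega>. (?S t \<omega> - s * Z \<omega>)\<^sup>2) = ?E (\<lambda>\<omega>. (?S t \<omega>)\<^sup>2) + ?E (\<lambda>\<omega>. (s * Z \<omega>)\<^sup>2)" for t s
    using expectation_square_add[OF S scale_mem[OF Z, of s], of t 1] expectation_square_add[OF S scale_mem[OF Z, of s], of t "-1"]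
    by (simp_all add: S0)
  have bd: "\<bar>?E (\<lambda>\<omega>. f (g \<omega>))\<bar> \<le> 1" 
    if "g \<in> borel_measurable M" "f \<in> borel_measurable borel" "\<And>x. \<bar>f x\<bar> \<le> 1" for f :: "real \<Rightarrow> real" and g
  proof -
    have "integrable M (\<lambda>\<omega>. f (g \<omega>))" using that by (auto intro!: integrable_const_bound[where B = 1])
    then have "?E (\<lambda>\<omega>. \<bar>f (g \<omega>)\<bar>) \<le> ?E (\<lambda>\<omega>. 1)"
      by (intro integral_mono) (use that in auto)
    then have "?E (\<lambda>\<omega>. \<bar>f (g \<omega>)\<bar>) \<le> 1" by (simp add: prob_space)
    then show ?thesis by (rule order_trans[OF integral_abs_bound])
  qed
  note [measurable] = measurable_mem[OF S]
  \<comment> \<open>The second moments of \<open>?S t \<plusminus> s * Z\<close> are sums, so the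
    mean of the product of cosines factorises. In distribution tests against \<open>Z\<close>, the
    random weight may therefore be replaced by its mean.\<close>
  have c: "?E (\<lambda>\<omega>. cos (?S t \<omega>) * indicat_real A (Z \<omega>)) = ?E (\<lambda>\<omega>. ?E (\<lambda>\<omega>. cos (?S t \<omega>)) * indicat_real A (Z \<omega>))" for t
  proof (rule weighted_law_eqI[where C = 1 and ?u1.0 = "\<lambda>\<omega>. cos (?S t \<omega>)" and ?u2.0 = "\<lambda>_. ?E (\<lambda>\<omega>. cos (?S t \<omega>))"])
    fix s
    show "?E (\<lambda>\<omega>. cos (?S t \<omega>) * cos (s * Z \<omega>)) = ?E (\<lambda>\<omega>. ?E (\<lambda>\<omega>. cos (?S t \<omega>)) * cos (s * Z \<omega>))"
      using expectation_cos_cos[OF S[of t] scale_mem[OF Z, of s]]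
      by (simp add: sq expectation_cos_mem[OF S] expectation_cos_mem[OF scale_mem[OF Z]] exp_add[symmetric] add_divide_distrib diff_divide_distrib)
    show "?E (\<lambda>\<omega>. cos (?S t \<omega>) * sin (s * Z \<omega>)) = ?E (\<lambda>\<omega>. ?E (\<lambda>\<omega>. cos (?S t \<omega>)) * sin (s * Z \<omega>))"
      using expectation_cos_sin[OF S[of t] scale_mem[OF Z, of s]] by (simp add: expectation_sin_mem[OF scale_mem[OF Z]])
  qed (use bd[of "?S t" cos] in auto)
  have s: "?E (\<lambda>\<omega>. sin (?S t \<omega>) * indicat_real A (Z \<omega>)) = ?E (\<lambda>\<omega>. ?E (\<lambda>\<omega>. sin (?S t \<omega>)) * indicat_real A (Z \<omega>))" for t
  proof (rule weighted_law_eqI[where C = 1 and ?u1.0 = "\<lambda>\<omega>. sin (?S t \<omega>)" and ?u2.0 = "\<lambda>_. ?E (\<lambda>\<omega>. sin (?S t \<omega>))"])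
    fix s
    show "?E (\<lambda>\<omega>. sin (?S t \<omega>) * cos (s * Z \<omega>)) = ?E (\<lambda>\<omega>. ?E (\<lambda>\<omega>. sin (?S t \<omega>)) * cos (s * Z \<omega>))"
      using expectation_cos_sin[OF scale_mem[OF Z, of s] S[of t]] by (simp add: expectation_sin_mem[OF S] mult.commute)
    show "?E (\<lambda>\<omega>. sin (?S t \<omega>) * sin (s * Z \<omega>)) = ?E (\<lambda>\<omega>. ?E (\<lambda>\<omega>. sin (?S t \<omega>)) * sin (s * Z \<omega>))"
      using expectation_sin_sin[OF S scale_mem[OF Z] S0, of t s] by (simp add: expectation_sin_mem[OF S])
  qed (use bd[of "?S t" sin] in auto)
  have E_A: "?E (\<lambda>\<omega>. indicat_real A (Z \<omega>)) = prob {\<omega> \<in> space M. Z \<omega> \<in> A}"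
  proof -
    have "?E (\<lambda>\<omega>. indicat_real A (Z \<omega>)) = ?E (indicat_real {\<omega> \<in> space M. Z \<omega> \<in> A})"
      by (intro Bochner_Integration.integral_cong) (auto simp: indicator_def)
    then show ?thesis by simp
  qed
  have "?E (\<lambda>\<omega>. indicat_real A (Z \<omega>) * (\<Prod>k<n. indicat_real (B k) (Y k \<omega>))) =
    ?E (\<lambda>\<omega>. prob {\<omega> \<in> space M. Z \<omega> \<in> A} * (\<Prod>k<n. indicat_real (B k) (Y k \<omega>)))"
  proof (rule weighted_box_eqI[where C = 1 and n = n and Y = Y and B = B and ?u1.0 = "\<lambda>\<omega>. indicat_real A (Z \<omega>)" and ?u2.0 = "\<lambda>\<omega>. prob {\<omega> \<in> space M. Z \<omega> \<in> A}"])
    fix t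
    show "?E (\<lambda>\<omega>. indicat_real A (Z \<omega>) * cos (?S t \<omega>)) = ?E (\<lambda>\<omega>. prob {\<omega> \<in> space M. Z \<omega> \<in> A} * cos (?S t \<omega>))"
      using c[of t] by (simp add: E_A mult.commute)
    show "?E (\<lambda>\<omega>. indicat_real A (Z \<omega>) * sin (?S t \<omega>)) = ?E (\<lambda>\<omega>. prob {\<omega> \<in> space M. Z \<omega> \<in> A} * sin (?S t \<omega>))"
      using s[of t] by (simp add: E_A mult.commute)
  qed (use Y B in \<open>auto simp: indicator_def measurable_mem\<close>)
  also have "(\<lambda>\<omega>. indicat_real A (Z \<omega>) * (\<Prod>k<n. indicat_real (B k) (Y k \<omega>))) =
      (\<lambda>\<omega>. indicat_real {\<omega>. Z \<omega> \<in> A \<and> (\<forall>k<n. Y k \<omega> \<in> B k)} \<omega> :: real)"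
    by (auto simp: fun_eq_iff indicator_def)
  also have "(\<lambda>\<omega>. prob {\<omega> \<in> space M. Z \<omega> \<in> A} * (\<Prod>k<n. indicat_real (B k) (Y k \<omega>))) =
      (\<lambda>\<omega>. prob {\<omega> \<in> space M. Z \<omega> \<in> A} * indicat_real {\<omega>. \<forall>k<n. Y k \<omega> \<in> B k} \<omega>)"
    by (auto simp: fun_eq_iff indicator_def)
  finally show ?thesis
    by (simp add: Int_def conj_commute)
qed

text \<open>Half-lines are an intersection-stable generator of the Borel sets, so only the sublevel
  sets of \<open>W\<close> have to be independent of \<open>Z\<close>. These are boxes in the
  \<open>Y k\<close>, as happens for a maximum of decreasing affine functions of single
  coordinates.\<close>

lemma uncorrelated_indep_var:
  fixes W :: "'a \<Rightarrow> real" and n :: nat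
  assumes Z: "Z \<in> V" and Y: "\<And>k. k < n \<Longrightarrow> Y k \<in> V"
    and unc: "\<And>k. k < n \<Longrightarrow> expectation (\<lambda>\<omega>. Y k \<omega> * Z \<omega>) = 0"
    and W: "W \<in> borel_measurable M" and B: "\<And>w k. k < n \<Longrightarrow> B w k \<in> sets borel"
    and box: "\<And>w \<omega>. W \<omega> \<le> w \<longleftrightarrow> (\<forall>k<n. Y k \<omega> \<in> B w k)"
  shows "indep_var borel W borel Z"
  unfolding indep_var_eq
proof (intro conjI)
  note [measurable] = W measurable_mem[OF Z]
  let ?G = "{W -` A \<inter> space M |A. A \<in> range atMost}"
  have bW: "{W -` A \<inter> space M |A. A \<in> sets borel} = sigma_sets (space M) ?G"
    unfolding borel_eq_atMost by (subst sigma_sets_vimage_commute[symmetric]) (auto simp: image_def)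
  have "indep_set (sigma_sets (space M) ?G) (sigma_sets (space M) {Z -` A \<inter> space M |A. A \<in> sets borel})"
  proof (rule indep_set_sigma_sets)
    show "Int_stable ?G"
    proof (rule Int_stableI)
      fix a b assume "a \<in> ?G" "b \<in> ?G"
      then obtain x y where "a = W -` {..x} \<inter> space M" "b = W -` {..y} \<inter> space M" by auto
      then have "a \<inter> b = W -` {..min x y} \<inter> space M" by auto
      then show "a \<inter> b \<in> ?G" by blast
    qed
    show "Int_stable {Z -` A \<inter> space M |A. A \<in> sets borel}"
    proof (rule Int_stableI)
      fix a b assume "a \<in> {Z -` A \<inter> space M |A. A \<in> sets borel}" "b \<in> {Z -` A \<inter> space M |A. A \<in> sets borel}"
      then obtain x y where "x \<in> sets borel" "y \<in> sets borel" "a = Z -` x \<inter> space M" "b = Z -` y \<inter> space M" by auto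
      moreover from this have "a \<inter> b = Z -` (x \<inter> y) \<inter> space M" by auto
      ultimately show "a \<inter> b \<in> {Z -` A \<inter> space M |A. A \<in> sets borel}" by blast
    qed
    show "indep_set ?G {Z -` A \<inter> space M |A. A \<in> sets borel}"
      unfolding indep_sets2_eq
    proof (intro conjI ballI)
      fix a b assume "a \<in> ?G" "b \<in> {Z -` A \<inter> space M |A. A \<in> sets borel}"
      then obtain w A where a: "a = W -` {..w} \<inter> space M" and b: "b = Z -` A \<inter> space M" and A: "A \<in> sets borel" by auto
      have "a \<inter> b = {\<omega> \<in> space M. Z \<omega> \<in> A \<and> (\<forall>k<n. Y k \<omega> \<in> B w k)}"
        "a = {\<omega> \<in> space M. \<forall>k<n. Y k \<omega> \<in> B w k}" "b = {\<omega> \<in> space M. Z \<omega> \<in> A}"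
        unfolding a b using box by auto
      then show "prob (a \<inter> b) = prob a * prob b"
        using uncorrelated_indep_box[OF Z Y unc A B] by (simp add: mult.commute)
    qed auto
  qed
  then show "indep_set (sigma_sets (space M) {W -` A \<inter> space M |A. A \<in> sets borel})
     (sigma_sets (space M) {Z -` A \<inter> space M |A. A \<in> sets borel})"
    unfolding bW by (subst sigma_sets_sigma_sets_eq) (auto simp: sets.sets_into_space)
qed (use W measurable_mem[OF Z] in auto)

end

section \<open>Near records of fractional Brownian motion\<close>

context fractional_brownian_motion
begin

definition lin_span :: "('a \<Rightarrow> real) set" where
  "lin_span = {\<lambda>\<omega>. \<Sum>t\<in>J. c t * X t \<omega> |J c. finite J \<and> J \<subseteq> {0..}}"

lemma gaussian_X: "0 \<le> t \<Longrightarrow> gaussian_rv M (X t)"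
  using gaussian unfolding gaussian_process_def by (elim allE[of _ "{t}"] allE[of _ "\<lambda>_. 1"]) simp

sublocale gs: centered_gaussian_space M lin_span
proof
  fix Y Z assume "Y \<in> lin_span" "Z \<in> lin_span"
  then obtain I c J d where Y: "finite I" "I \<subseteq> {0..}" "Y = (\<lambda>\<omega>. \<Sum>t\<in>I. c t * X t \<omega>)"
    and Z: "finite J" "J \<subseteq> {0..}" "Z = (\<lambda>\<omega>. \<Sum>t\<in>J. d t * X t \<omega>)"
    unfolding lin_span_def by blast
  define e where "e t = (if t \<in> I then c t else 0) + (if t \<in> J then d t else 0)" for t
  have "(\<Sum>t\<in>I \<union> J. e t * X t \<omega>) = Y \<omega> + Z \<omega>" for \<omega>
  proof -
    have "(\<Sum>t\<in>I \<union> J. e t * X t \<omega>) =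
        (\<Sum>t\<in>I \<union> J. (if t \<in> I then c t * X t \<omega> else 0)) + (\<Sum>t\<in>I \<union> J. (if t \<in> J then d t * X t \<omega> else 0))"
      unfolding sum.distrib[symmetric] by (intro sum.cong) (auto simp: e_def algebra_simps)
    also have "\<dots> = (\<Sum>t\<in>(I \<union> J) \<inter> I. c t * X t \<omega>) + (\<Sum>t\<in>(I \<union> J) \<inter> J. d t * X t \<omega>)"
      using Y(1) Z(1) by (simp only: sum.inter_restrict finite_Un)
    finally show ?thesis by (simp add: Y Z Int_absorb1)
  qed
  then show "(\<lambda>\<omega>. Y \<omega> + Z \<omega>) \<in> lin_span"
    using Y(1,2) Z(1,2) unfolding lin_span_def by (intro CollectI exI[of _ "I \<union> J"] exI[of _ e]) auto
next
  fix Y and c :: real assume "Y \<in> lin_span"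
  then obtain I d where Y: "finite I" "I \<subseteq> {0..}" "Y = (\<lambda>\<omega>. \<Sum>t\<in>I. d t * X t \<omega>)"
    unfolding lin_span_def by blast
  then show "(\<lambda>\<omega>. c * Y \<omega>) \<in> lin_span"
    unfolding lin_span_def by (intro CollectI exI[of _ I] exI[of _ "\<lambda>t. c * d t"]) (auto simp: sum_distrib_left mult_ac)
next
  fix Y assume "Y \<in> lin_span"
  then obtain I d where Y: "finite I" "I \<subseteq> {0..}" "Y = (\<lambda>\<omega>. \<Sum>t\<in>I. d t * X t \<omega>)"
    unfolding lin_span_def by blast
  then show "gaussian_rv M Y" using gaussian unfolding gaussian_process_def by blast
  have "integrable M (X t)" if "t \<in> I" for t
    using that Y(2) centered_gaussian_integrable[OF gaussian_X mean_zero] by auto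
  then show "expectation Y = 0"
    using Y(2) by (simp add: Y(3) mean_zero subset_iff)
qed (auto simp: lin_span_def)

lemma X_mem: "0 \<le> t \<Longrightarrow> X t \<in> lin_span"
  unfolding lin_span_def by (intro CollectI exI[of _ "{t}"] exI[of _ "\<lambda>_. 1"]) auto

lemma increment_mem: "0 \<le> s \<Longrightarrow> 0 \<le> t \<Longrightarrow> (\<lambda>\<omega>. X t \<omega> - X s \<omega>) \<in> lin_span"
  by (intro gs.diff_mem X_mem)

lemma second_moment: "0 \<le> t \<Longrightarrow> expectation (\<lambda>\<omega>. (X t \<omega>)\<^sup>2) = t powr (2 * H)"
  using covariance[of t t] by (simp add: power2_eq_square)

lemma increment_second_moment:
  assumes "0 \<le> s" "0 \<le> t"
  shows "expectation (\<lambda>\<omega>. (X t \<omega> - X s \<omega>)\<^sup>2) = \<bar>t - s\<bar> powr (2 * H)"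
  using gs.expectation_square_add[OF X_mem X_mem, of t s "-1"] assms
  by (simp add: second_moment covariance field_simps abs_minus_commute)

lemma increment_covariance:
  assumes "0 \<le> r" "0 \<le> s" "0 \<le> t"
  shows "expectation (\<lambda>\<omega>. (X t \<omega> - X r \<omega>) * (X t \<omega> - X s \<omega>)) =
    1/2 * (\<bar>t - r\<bar> powr (2 * H) + \<bar>t - s\<bar> powr (2 * H) - \<bar>r - s\<bar> powr (2 * H))"
  using gs.expectation_square_add[OF increment_mem increment_mem, of r t s t "-1"] assms
  by (simp add: increment_second_moment abs_minus_commute)

text \<open>The distance of \<open>r\<close> and \<open>s\<close> is less than the larger of their
  distances to \<open>t\<close>, so one positive term already beats the negative one, whatever the
  value of \<open>H\<close>. Raising one increment therefore raises the regression part of every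
  other increment ending at \<open>t\<close>.\<close>

lemma increment_covariance_pos:
  assumes "0 \<le> r" "r < t" "0 \<le> s" "s < t"
  shows "0 < expectation (\<lambda>\<omega>. (X t \<omega> - X r \<omega>) * (X t \<omega> - X s \<omega>))"
proof -
  have "\<bar>r - s\<bar> powr (2 * H) < max (t - r) (t - s) powr (2 * H)"
    using assms Hurst_index by (intro powr_less_mono2) auto
  also have "\<dots> \<le> (t - r) powr (2 * H) + (t - s) powr (2 * H)"
    by (auto simp: max_def)
  finally show ?thesis using assms by (simp add: increment_covariance)
qed

text \<open>The left side is half the variance of the increment from \<open>s\<close> to
  \<open>t\<close>; this is the source of the regression coefficient bound 1/2 for earlier starting
  times.\<close>

lemma increment_covariance_ge:
  assumes "0 \<le> r" "r \<le> s" "s \<le> t"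
  shows "(t - s) powr (2 * H) / 2 \<le> expectation (\<lambda>\<omega>. (X t \<omega> - X r \<omega>) * (X t \<omega> - X s \<omega>))"
proof -
  have "(s - r) powr (2 * H) \<le> (t - r) powr (2 * H)"
    using assms Hurst_index by (intro powr_mono2) auto
  then show ?thesis using assms by (simp add: increment_covariance abs_minus_commute[of r s])
qed

text \<open>Write the increments as \<open>D k = b k * Z + Y k\<close> with \<open>Z = D (n - q)\<close> and \<open>Y k\<close> uncorrelated with
  \<open>Z\<close>, hence jointly independent of it. As \<open>b k > 0\<close>, the near record event is \<open>W \<le> Z\<close> with
  \<open>W\<close> a function of the \<open>Y k\<close>; raising \<open>Z\<close> by \<open>2 a\<close> raises \<open>D k\<close> by at least \<open>a\<close> for \<open>k \<le> n - q\<close>,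
  because \<open>b k \<ge> 1/2\<close> there.\<close>

lemma near_record_shift:
  assumes h: "0 < h" and q: "1 \<le> q" "q \<le> n" and a: "0 < a" "a \<le> (real q * h) powr H"
  shows "prob {\<omega> \<in> space M. \<forall>k<n. - \<delta> \<le> X (real n * h) \<omega> - X (real k * h) \<omega>} \<le>
    exp 3 * prob {\<omega> \<in> space M. \<forall>k<n. - \<delta> \<le> X (real n * h) \<omega> - X (real k * h) \<omega> \<and>
        (k \<le> n - q \<longrightarrow> a - \<delta> \<le> X (real n * h) \<omega> - X (real k * h) \<omega>)}
    + exp (1/2 - (real q * h) powr H / (2 * a))"
proof -
  define D where "D k \<omega> = X (real n * h) \<omega> - X (real k * h) \<omega>" for k \<omega>
  define Z where "Z = D (n - q)"
  define s where "s = (real q * h) powr H"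
  have s: "0 < s" "a \<le> s" using a h q by (auto simp: s_def)
  have D_mem: "D k \<in> lin_span" for k
    unfolding D_def[abs_def] using h by (intro increment_mem) auto
  have Z_mem: "Z \<in> lin_span" by (simp add: Z_def D_mem)
  note [measurable] = gs.measurable_mem[OF D_mem] gs.measurable_mem[OF Z_mem]
  have tq: "real n * h - real (n - q) * h = real q * h" using q by (simp add: of_nat_diff algebra_simps)
  have s2: "(real q * h) powr (2 * H) = s\<^sup>2"
    using h q by (simp add: s_def powr_power mult.commute)
  have vZ: "expectation (\<lambda>\<omega>. (Z \<omega>)\<^sup>2) = s\<^sup>2"
  proof -
    have "expectation (\<lambda>\<omega>. (Z \<omega>)\<^sup>2) = \<bar>real n * h - real (n - q) * h\<bar> powr (2 * H)"
      unfolding Z_def D_def by (rule increment_second_moment) (use h in auto)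
    then show ?thesis unfolding tq using h s2 by simp
  qed
  define b where "b k = expectation (\<lambda>\<omega>. D k \<omega> * Z \<omega>) / s\<^sup>2" for k
  have b_pos: "0 < b k" if "k < n" for k
    unfolding b_def Z_def D_def using that h q s by (intro divide_pos_pos increment_covariance_pos) auto
  have b_ge: "1/2 \<le> b k" if "k \<le> n - q" for k
  proof -
    have "(real q * h) powr (2 * H) / 2 \<le> expectation (\<lambda>\<omega>. D k \<omega> * Z \<omega>)"
      unfolding tq[symmetric] D_def Z_def by (rule increment_covariance_ge) (use that h q in auto)
    then show ?thesis unfolding b_def s2 using s by (simp add: pos_le_divide_eq)
  qed
  define Y where "Y k \<omega> = D k \<omega> - b k * Z \<omega>" for k \<omega>
  have Y_mem: "Y k \<in> lin_span" for k
    unfolding Y_def[abs_def] by (intro gs.diff_mem gs.scale_mem D_mem Z_mem)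
  note [measurable] = gs.measurable_mem[OF Y_mem]
  have unc: "expectation (\<lambda>\<omega>. Y k \<omega> * Z \<omega>) = 0" for k
  proof -
    have "expectation (\<lambda>\<omega>. Y k \<omega> * Z \<omega>) = expectation (\<lambda>\<omega>. D k \<omega> * Z \<omega> - b k * (Z \<omega>)\<^sup>2)"
      by (simp add: Y_def power2_eq_square algebra_simps)
    also have "\<dots> = 0"
      using s by (simp add: gs.integrable_mult_mem[OF D_mem Z_mem] gs.integrable_square_mem[OF Z_mem] vZ b_def)
    finally show ?thesis .
  qed
  \<comment> \<open>Each constraint \<open>- \<delta> \<le> b k * Z + Y k\<close> is solved for
    \<open>Z\<close>, which is possible because \<open>b k > 0\<close>; \<open>W\<close> is the
    largest of the resulting thresholds.\<close>
  define W where "W \<omega> = Max ((\<lambda>k. (- \<delta> - Y k \<omega>) / b k) ` {..<n})" for \<omega>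
  have W_meas: "W \<in> borel_measurable M"
    unfolding W_def[abs_def] by (intro borel_measurable_Max) auto
  have ne: "{..<n} \<noteq> {}" using q by (auto simp: lessThan_empty_iff)
  have W_le: "W \<omega> \<le> w \<longleftrightarrow> (\<forall>k<n. - \<delta> - w * b k \<le> Y k \<omega>)" for \<omega> w
    unfolding W_def using ne b_pos by (auto simp: Max_le_iff pos_divide_le_eq algebra_simps)
  have indep: "indep_var borel W borel Z"
    by (rule gs.uncorrelated_indep_var[where Y = Y and n = n and B = "\<lambda>w k. {- \<delta> - w * b k..}"])
      (auto simp: Z_mem Y_mem unc W_meas W_le)
  have dZ: "distributed M lborel Z (normal_density 0 s)"
    using centered_gaussian_distributed[OF gs.gaussian_mem[OF Z_mem] gs.centered_mem[OF Z_mem]] s by (simp add: vZ)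
  \<comment> \<open>This makes the shift \<open>c * s\<^sup>2\<close> equal to \<open>2 * a\<close>.
    Its cost stays below \<open>exp 3\<close> because \<open>a\<close> does not exceed the standard
    deviation \<open>s\<close> of \<open>Z\<close>, and the truncation level \<open>1 / c\<close>
    lies \<open>s / (2 * a)\<close> standard deviations above the mean.\<close>
  define c where "c = 2 * a / s\<^sup>2"
  have c: "0 < c" using a s by (simp add: c_def)
  have "prob {\<omega> \<in> space M. W \<omega> \<le> Z \<omega>} \<le>
    exp (1 + c\<^sup>2 * s\<^sup>2 / 2) * prob {\<omega> \<in> space M. W \<omega> + c * s\<^sup>2 \<le> Z \<omega>} + prob {\<omega> \<in> space M. 1 / c \<le> Z \<omega>}"
    by (rule prob_shift_normal_le[OF dZ s(1) c indep])
  moreover have "exp (1 + c\<^sup>2 * s\<^sup>2 / 2) \<le> exp 3"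
  proof -
    have "c\<^sup>2 * s\<^sup>2 / 2 = 2 * (a / s)\<^sup>2"
      using s by (simp add: c_def power2_eq_square field_simps)
    also have "\<dots> \<le> 2" using s a by (simp add: power_le_one)
    finally show ?thesis by simp
  qed
  moreover have "prob {\<omega> \<in> space M. W \<omega> + c * s\<^sup>2 \<le> Z \<omega>} \<le>
      prob {\<omega> \<in> space M. \<forall>k<n. - \<delta> \<le> D k \<omega> \<and> (k \<le> n - q \<longrightarrow> a - \<delta> \<le> D k \<omega>)}"
  proof (rule finite_measure_mono)
    show "{\<omega> \<in> space M. W \<omega> + c * s\<^sup>2 \<le> Z \<omega>} \<subseteq>
      {\<omega> \<in> space M. \<forall>k<n. - \<delta> \<le> D k \<omega> \<and> (k \<le> n - q \<longrightarrow> a - \<delta> \<le> D k \<omega>)}"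
    proof safe
      fix \<omega> k assume k: "k < n" and *: "W \<omega> + c * s\<^sup>2 \<le> Z \<omega>"
      have "- \<delta> - W \<omega> * b k \<le> Y k \<omega>" using W_le[of \<omega> "W \<omega>"] k by auto
      then have "- \<delta> + (Z \<omega> - W \<omega>) * b k \<le> D k \<omega>" by (simp add: Y_def algebra_simps)
      moreover have "c * s\<^sup>2 * b k \<le> (Z \<omega> - W \<omega>) * b k"
        using * b_pos[OF k] by (intro mult_right_mono) auto
      moreover have "c * s\<^sup>2 = 2 * a" using s by (simp add: c_def)
      ultimately have D: "- \<delta> + 2 * a * b k \<le> D k \<omega>" by simp
      have "0 \<le> 2 * a * b k" using a b_pos[OF k] by simp
      with D show "- \<delta> \<le> D k \<omega>" by linarith
      assume "k \<le> n - q"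
      then have "a \<le> 2 * a * b k" using a b_ge[of k] by (simp add: field_simps)
      with D show "a - \<delta> \<le> D k \<omega>" by linarith
    qed
  qed measurable
  moreover have "prob {\<omega> \<in> space M. 1 / c \<le> Z \<omega>} \<le> exp (1/2 - s / (2 * a))"
    using gs.tail_mem[OF Z_mem, of s "1 / c"] s vZ by (simp add: c_def power2_eq_square)
  moreover have "prob {\<omega> \<in> space M. W \<omega> \<le> Z \<omega>} = prob {\<omega> \<in> space M. \<forall>k<n. - \<delta> \<le> D k \<omega>}"
    by (simp add: W_le Y_def algebra_simps)
  ultimately have "prob {\<omega> \<in> space M. \<forall>k<n. - \<delta> \<le> D k \<omega>} \<le>
      exp 3 * prob {\<omega> \<in> space M. \<forall>k<n. - \<delta> \<le> D k \<omega> \<and> (k \<le> n - q \<longrightarrow> a - \<delta> \<le> D k \<omega>)} + exp (1/2 - s / (2 * a))"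
    by (smt (verit) mult_mono measure_nonneg exp_ge_zero)
  then show ?thesis by (simp add: D_def s_def)
qed

end

section \<open>Softmax weights along a real sequence and along the process\<close>

lemma sum_softmax_le:
  fixes x :: "nat \<Rightarrow> real"
  assumes "1 \<le> L"
  shows "(\<Sum>n=1..K. exp (L * x n) / (\<Sum>k\<le>n. exp (L * x k))) \<le>
    L * (ln (real K + 1) + (\<Sum>k\<le>K. exp (x k)) / (real K + 1) - 1) - L * x 0"
proof -
  define S where "S n = (\<Sum>k\<le>n. exp (L * x k))" for n
  have S_pos: "0 < S n" for n unfolding S_def by (intro sum_pos) auto
  have S_Suc: "S (Suc n) = S n + exp (L * x (Suc n))" for n by (simp add: S_def)
  \<comment> \<open>The inequality \<open>ln u \<le> u - 1\<close> at
    \<open>u = S n / S (Suc n)\<close> turns each weight into a telescoping increment.\<close>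
  have step: "exp (L * x (Suc n)) / S (Suc n) \<le> ln (S (Suc n)) - ln (S n)" for n
  proof -
    have "ln (S n / S (Suc n)) \<le> S n / S (Suc n) - 1"
      by (rule ln_le_minus_one) (use S_pos in simp)
    also have "S n / S (Suc n) - 1 = - (exp (L * x (Suc n)) / S (Suc n))"
      using S_pos[of "Suc n"] by (simp add: S_Suc field_simps)
    finally show ?thesis using S_pos[of n] S_pos[of "Suc n"] by (simp add: ln_div)
  qed
  have "(\<Sum>n=1..K. exp (L * x n) / S n) \<le> ln (S K) - ln (S 0)"
  proof (induction K)
    case (Suc K)
    then show ?case using step[of K] by simp
  qed simp
  also have "ln (S 0) = L * x 0" by (simp add: S_def)
  \<comment> \<open>For \<open>L \<ge> 1\<close> a sum of \<open>L\<close>-th powers is at most the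
    \<open>L\<close>-th power of the sum. Thus only exponential moments with parameter 1 enter and
    the bound is linear in \<open>L\<close>; the moments of \<open>exp (L * x k)\<close> themselves
    would contribute \<open>L\<^sup>2\<close> in the exponent.\<close>
  also have "ln (S K) \<le> L * ln (\<Sum>k\<le>K. exp (x k))"
  proof -
    define s where "s = (\<Sum>k\<le>K. exp (x k))"
    have s: "0 < s" unfolding s_def by (intro sum_pos) auto
    have "S K \<le> (\<Sum>k\<le>K. exp (x k) * exp ((L - 1) * ln s))"
      unfolding S_def
    proof (rule sum_mono)
      fix k assume "k \<in> {..K}"
      then have "exp (x k) \<le> s" unfolding s_def by (intro member_le_sum) auto
      then have "x k \<le> ln s" using s by (simp add: ln_ge_iff)
      then have "(L - 1) * x k \<le> (L - 1) * ln s" using assms by (intro mult_left_mono) auto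
      then show "exp (L * x k) \<le> exp (x k) * exp ((L - 1) * ln s)"
        by (simp add: exp_add[symmetric] algebra_simps)
    qed
    also have "\<dots> = s * exp ((L - 1) * ln s)" by (simp add: s_def sum_distrib_right)
    also have "\<dots> = exp (L * ln s)" using s by (simp add: exp_diff algebra_simps)
    finally have "ln (S K) \<le> ln (exp (L * ln s))" using S_pos[of K] by (simp only: ln_le_cancel_iff exp_gt_zero)
    then show ?thesis by (simp add: s_def)
  qed
  \<comment> \<open>The tangent to the logarithm at \<open>K + 1\<close>, the number of summands.
    The bound is affine in the sum, so its expectation can be taken directly.\<close>
  also have "ln (\<Sum>k\<le>K. exp (x k)) \<le> ln (real K + 1) + (\<Sum>k\<le>K. exp (x k)) / (real K + 1) - 1"
  proof -
    have "0 < (\<Sum>k\<le>K. exp (x k))" by (intro sum_pos) auto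
    then have "ln ((\<Sum>k\<le>K. exp (x k)) / (real K + 1)) \<le> (\<Sum>k\<le>K. exp (x k)) / (real K + 1) - 1"
      by (intro ln_le_minus_one divide_pos_pos) auto
    then show ?thesis using \<open>0 < (\<Sum>k\<le>K. exp (x k))\<close> by (simp add: ln_div)
  qed
  finally show ?thesis using assms by (simp add: S_def mult_left_mono)
qed

text \<open>In units of the term at \<open>n\<close>, the at most \<open>K\<close> distant terms
  weigh \<open>1 / K\<close> each and 1 together, which is why the gap is
  \<open>\<delta> * ln K\<close>. The \<open>q - 1\<close> close terms weigh at most
  \<open>exp 1 \<le> 3\<close> each. With the term at \<open>n\<close> itself the total is at most
  \<open>3 * q - 1\<close>.\<close>

lemma softmax_ge_of_gap:
  fixes x :: "nat \<Rightarrow> real"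
  assumes q: "1 \<le> q" "q \<le> n" "n \<le> K" and \<delta>: "0 < \<delta>"
    and gap: "\<And>k. k < n \<Longrightarrow> - \<delta> \<le> x n - x k" "\<And>k. k \<le> n - q \<Longrightarrow> \<delta> * ln (real K) \<le> x n - x k"
  shows "1 / (3 * real q) \<le> exp (1 / \<delta> * x n) / (\<Sum>k\<le>n. exp (1 / \<delta> * x k))"
proof -
  let ?e = "\<lambda>k. exp (1 / \<delta> * x k)"
  have near: "?e k \<le> 3 * ?e n" if "k < n" for k
  proof -
    have "1 / \<delta> * x k \<le> 1 + 1 / \<delta> * x n" using gap(1)[OF that] \<delta> by (simp add: field_simps)
    then have "?e k \<le> exp 1 * ?e n" by (simp add: exp_add[symmetric])
    also have "\<dots> \<le> 3 * ?e n" using exp_le by (intro mult_right_mono) auto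
    finally show ?thesis .
  qed
  have far: "?e k \<le> ?e n / real K" if "k \<le> n - q" for k
  proof -
    have "ln (real K) \<le> (x n - x k) / \<delta>" using gap(2)[OF that] \<delta> by (simp add: field_simps)
    then have "1 / \<delta> * x k \<le> 1 / \<delta> * x n - ln (real K)" by (simp add: diff_divide_distrib)
    then have "?e k \<le> exp (1 / \<delta> * x n - ln (real K))" by simp
    also have "\<dots> = ?e n / real K" using q by (simp add: exp_diff)
    finally show ?thesis .
  qed
  have "(\<Sum>k\<le>n. ?e k) = ?e n + (\<Sum>k<n. ?e k)" by (simp add: lessThan_Suc_atMost[symmetric])
  also have "(\<Sum>k<n. ?e k) = (\<Sum>k\<in>{..n - q} \<union> {n - q<..<n}. ?e k)"
    using q by (intro sum.cong) auto
  also have "\<dots> = (\<Sum>k\<le>n - q. ?e k) + (\<Sum>k\<in>{n - q<..<n}. ?e k)"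
    by (rule sum.union_disjoint) auto
  also have "(\<Sum>k\<le>n - q. ?e k) \<le> real (card {..n - q}) * (?e n / real K)"
    by (intro sum_bounded_above far) auto
  also have "\<dots> \<le> real K * (?e n / real K)"
    using q by (intro mult_right_mono) auto
  also have "\<dots> = ?e n" using q by simp
  also have "(\<Sum>k\<in>{n - q<..<n}. ?e k) \<le> real (card {n - q<..<n}) * (3 * ?e n)"
    by (intro sum_bounded_above near) auto
  also have "real (card {n - q<..<n}) = real q - 1" using q by simp
  finally have "(\<Sum>k\<le>n. ?e k) \<le> (3 * real q - 1) * ?e n" by (simp add: algebra_simps)
  also have "\<dots> \<le> 3 * real q * ?e n" by (intro mult_right_mono) auto
  finally have *: "(\<Sum>k\<le>n. ?e k) \<le> 3 * real q * ?e n" .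
  have "0 < (\<Sum>k\<le>n. ?e k)" by (intro sum_pos) auto
  with * q show ?thesis by (simp add: field_simps)
qed

context fractional_brownian_motion
begin

text \<open>The term \<open>- L * X 0\<close> is centred and disappears, and the exponential moments
  are bounded on the time interval in question, uniformly in the mesh. Only the factor
  \<open>L\<close> and a logarithm of \<open>K\<close> depend on the discretisation.\<close>

lemma expected_softmax_le:
  assumes h: "0 < h" and L: "1 \<le> L"
  shows "(\<Sum>n=1..K. expectation (\<lambda>\<omega>. exp (L * X (real n * h) \<omega>) / (\<Sum>k\<le>n. exp (L * X (real k * h) \<omega>)))) \<le>
    L * (ln (real K + 1) + exp ((real K * h) powr (2 * H) / 2) - 1)"
proof -
  let ?X = "\<lambda>k. X (real k * h)"
  have mem: "?X k \<in> lin_span" for k using h by (intro X_mem) auto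
  note [measurable] = gs.measurable_mem[OF mem]
  have sum_pos': "0 < (\<Sum>k\<le>n. exp (L * ?X k \<omega>))" for n \<omega> by (intro sum_pos) auto
  have int: "integrable M (\<lambda>\<omega>. exp (L * ?X n \<omega>) / (\<Sum>k\<le>n. exp (L * ?X k \<omega>)))" for n
  proof (rule integrable_const_bound[where B = 1])
    show "AE \<omega> in M. norm (exp (L * ?X n \<omega>) / (\<Sum>k\<le>n. exp (L * ?X k \<omega>))) \<le> 1"
    proof (rule AE_I2)
      fix \<omega>
      have "exp (L * ?X n \<omega>) \<le> (\<Sum>k\<le>n. exp (L * ?X k \<omega>))" by (intro member_le_sum) auto
      then show "norm (exp (L * ?X n \<omega>) / (\<Sum>k\<le>n. exp (L * ?X k \<omega>))) \<le> 1"
        using sum_pos'[of \<omega> n] by (simp add: abs_of_pos)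
    qed
  qed measurable
  have int_exp: "integrable M (\<lambda>\<omega>. exp (?X k \<omega>))" for k
    using gs.integrable_exp_mem[OF mem, of 1] by simp
  have E_exp: "expectation (\<lambda>\<omega>. exp (?X k \<omega>)) \<le> exp ((real K * h) powr (2 * H) / 2)" if "k \<le> K" for k
  proof -
    have "(real k * h) powr (2 * H) \<le> (real K * h) powr (2 * H)"
      using that h Hurst_index by (intro powr_mono2) auto
    then show ?thesis
      using gs.expectation_exp_mem[OF mem, of 1 k] h by (simp add: second_moment)
  qed
  have "(\<Sum>n=1..K. expectation (\<lambda>\<omega>. exp (L * ?X n \<omega>) / (\<Sum>k\<le>n. exp (L * ?X k \<omega>)))) =
      expectation (\<lambda>\<omega>. \<Sum>n=1..K. exp (L * ?X n \<omega>) / (\<Sum>k\<le>n. exp (L * ?X k \<omega>)))"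
    by (rule Bochner_Integration.integral_sum[symmetric]) (rule int)
  also have "\<dots> \<le> expectation (\<lambda>\<omega>. L * (ln (real K + 1) + (\<Sum>k\<le>K. exp (?X k \<omega>)) / (real K + 1) - 1) - L * ?X 0 \<omega>)"
  proof (rule integral_mono)
    have "integrable M (\<lambda>\<omega>. \<Sum>k\<le>K. exp (?X k \<omega>))" by (rule Bochner_Integration.integrable_sum) (rule int_exp)
    then show "integrable M (\<lambda>\<omega>. L * (ln (real K + 1) + (\<Sum>k\<le>K. exp (?X k \<omega>)) / (real K + 1) - 1) - L * ?X 0 \<omega>)"
      using gs.integrable_mem[OF mem, of 0]
      by (intro Bochner_Integration.integrable_diff Bochner_Integration.integrable_add integrable_mult_right integrable_divide_zero) auto
  qed (use sum_softmax_le[OF L, of "\<lambda>k. ?X k _"] in \<open>auto intro!: Bochner_Integration.integrable_sum int\<close>)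
  also have "\<dots> = L * (ln (real K + 1) + (\<Sum>k\<le>K. expectation (\<lambda>\<omega>. exp (?X k \<omega>))) / (real K + 1) - 1)"
    using gs.integrable_mem[OF mem, of 0] mean_zero[of 0] int_exp
    by (simp add: prob_space)
  also have "\<dots> \<le> L * (ln (real K + 1) + exp ((real K * h) powr (2 * H) / 2) - 1)"
  proof -
    have "(\<Sum>k\<le>K. expectation (\<lambda>\<omega>. exp (?X k \<omega>))) \<le> real (card {..K}) * exp ((real K * h) powr (2 * H) / 2)"
      by (intro sum_bounded_above E_exp) auto
    then have "(\<Sum>k\<le>K. expectation (\<lambda>\<omega>. exp (?X k \<omega>))) / (real K + 1) \<le> exp ((real K * h) powr (2 * H) / 2)"
      by (simp add: field_simps)
    then show ?thesis using L by (intro mult_left_mono) auto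
  qed
  finally show ?thesis .
qed

lemma expected_near_records_le:
  assumes h: "0 < h" and K: "1 \<le> K" and q: "1 \<le> q" and \<delta>: "0 < \<delta>" "\<delta> \<le> 1"
    and a: "\<delta> * (1 + ln (real K)) \<le> (real q * h) powr H"
  shows "(\<Sum>n=1..K. prob {\<omega> \<in> space M. \<forall>k<n. - \<delta> \<le> X (real n * h) \<omega> - X (real k * h) \<omega>}) \<le>
    real q + exp 3 * (3 * real q) * (1 / \<delta> * (ln (real K + 1) + exp ((real K * h) powr (2 * H) / 2) - 1))
    + real K * exp (1/2 - (real q * h) powr H / (2 * (\<delta> * (1 + ln (real K)))))"
proof -
  let ?X = "\<lambda>k. X (real k * h)"
  let ?P = "\<lambda>n. prob {\<omega> \<in> space M. \<forall>k<n. - \<delta> \<le> ?X n \<omega> - ?X k \<omega>}"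
  let ?s = "\<lambda>n \<omega>. exp (1 / \<delta> * ?X n \<omega>) / (\<Sum>k\<le>n. exp (1 / \<delta> * ?X k \<omega>))"
  \<comment> \<open>After the loss of \<delta> in the shift lemma exactly the gap
    \<open>\<delta> * ln K\<close> remains.\<close>
  define a where "a = \<delta> * (1 + ln (real K))"
  define r where "r = exp (1/2 - (real q * h) powr H / (2 * a))"
  have mem: "?X k \<in> lin_span" for k using h by (intro X_mem) auto
  note [measurable] = gs.measurable_mem[OF mem]
  have lnK: "0 \<le> ln (real K)" using K by simp
  have a0: "0 < a" using \<delta> lnK by (simp add: a_def)
  have sp: "0 < (\<Sum>k\<le>n. exp (1 / \<delta> * ?X k \<omega>))" for n \<omega> by (intro sum_pos) auto
  have s_nonneg: "0 \<le> ?s n \<omega>" for n \<omega> using sp[of \<omega> n] by simp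
  have int: "integrable M (?s n)" for n
  proof (rule integrable_const_bound[where B = 1])
    show "AE \<omega> in M. norm (?s n \<omega>) \<le> 1"
    proof (rule AE_I2)
      fix \<omega>
      have "exp (1 / \<delta> * ?X n \<omega>) \<le> (\<Sum>k\<le>n. exp (1 / \<delta> * ?X k \<omega>))" by (intro member_le_sum) auto
      then show "norm (?s n \<omega>) \<le> 1"
        using sp[of \<omega> n] by (simp add: abs_of_pos)
    qed
  qed measurable
  have P: "?P n \<le> exp 3 * (3 * real q) * expectation (?s n) + r" if n: "q \<le> n" "n \<le> K" for n
  proof -
    let ?G = "{\<omega> \<in> space M. \<forall>k<n. - \<delta> \<le> ?X n \<omega> - ?X k \<omega> \<and> (k \<le> n - q \<longrightarrow> a - \<delta> \<le> ?X n \<omega> - ?X k \<omega>)}"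
    have "prob ?G \<le> prob {\<omega> \<in> space M. 1 / (3 * real q) \<le> ?s n \<omega>}"
    proof (rule finite_measure_mono)
      show "?G \<subseteq> {\<omega> \<in> space M. 1 / (3 * real q) \<le> ?s n \<omega>}"
      proof (intro subsetI CollectI conjI)
        fix \<omega> assume \<omega>: "\<omega> \<in> ?G"
        then show "\<omega> \<in> space M" by simp
        show "1 / (3 * real q) \<le> ?s n \<omega>"
        proof (rule softmax_ge_of_gap[OF q n \<delta>(1), of "\<lambda>k. ?X k \<omega>"])
          fix k assume "k \<le> n - q"
          moreover from this have "k < n" using q n by auto
          ultimately have "a - \<delta> \<le> ?X n \<omega> - ?X k \<omega>" using \<omega> by auto
          then show "\<delta> * ln (real K) \<le> ?X n \<omega> - ?X k \<omega>" by (simp add: a_def algebra_simps)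
        qed (use \<omega> in auto)
      qed
    qed measurable
    also have "\<dots> \<le> expectation (?s n) / (1 / (3 * real q))"
      by (rule integral_Markov_inequality_measure[where A = "{}"]) (use int s_nonneg q in auto)
    finally have "exp 3 * prob ?G \<le> exp 3 * (3 * real q) * expectation (?s n)" by (simp add: mult_ac)
    moreover have "?P n \<le> exp 3 * prob ?G + r"
      unfolding r_def by (rule near_record_shift) (use h q n a a0 in \<open>auto simp: a_def\<close>)
    ultimately show ?thesis by linarith
  qed
  have r0: "0 \<le> r" by (simp add: r_def)
  have E0: "0 \<le> expectation (?s n)" for n by (intro Bochner_Integration.integral_nonneg s_nonneg)
  \<comment> \<open>Indices below \<open>q\<close> have no predecessor at distance \<open>q\<close>;
    they are bounded by 1 and cost at most \<open>q\<close> in total.\<close>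
  have "?P n \<le> (if n < q then 1 else 0) + exp 3 * (3 * real q) * expectation (?s n) + r" if "n \<in> {1..K}" for n
  proof (cases "n < q")
    case True
    have "0 \<le> exp 3 * (3 * real q) * expectation (?s n)" using E0 by simp
    then show ?thesis using True r0 prob_le_1 by (simp add: add_increasing2)
  next
    case False
    then show ?thesis using P[of n] that by simp
  qed
  then have "(\<Sum>n=1..K. ?P n) \<le> (\<Sum>n=1..K. (if n < q then 1 else 0) + exp 3 * (3 * real q) * expectation (?s n) + r)"
    by (rule sum_mono)
  also have "\<dots> = (\<Sum>n=1..K. if n < q then 1 else 0) + exp 3 * (3 * real q) * (\<Sum>n=1..K. expectation (?s n)) + real K * r"
    by (simp add: sum.distrib sum_distrib_left)
  also have "(\<Sum>n=1..K. if n < q then 1 else (0::real)) = real (card {n \<in> {1..K}. n < q})"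
    by (simp add: sum.If_cases Int_def)
  also have "\<dots> \<le> real (card {..<q})"
    by (intro of_nat_mono card_mono) auto
  also have "\<dots> = real q" by simp
  also have "(\<Sum>n=1..K. expectation (?s n)) \<le> 1 / \<delta> * (ln (real K + 1) + exp ((real K * h) powr (2 * H) / 2) - 1)"
    by (rule expected_softmax_le) (use h \<delta> in auto)
  finally show ?thesis by (simp add: r_def a_def mult_left_mono)
qed

text \<open>With mesh \<open>1 / y\<close> the tolerance is \<open>y powr (\<epsilon> - H)\<close>,
  slightly more than the typical oscillation over one interval. The main term is of order
  \<open>q / \<delta>\<close>, that is \<open>y powr (2 * \<epsilon> / H + H - \<epsilon>)\<close>,
  up to logarithms.\<close>

lemma expected_near_records_dyadic_le:
  fixes T m :: nat
  assumes T: "1 \<le> T" and \<epsilon>: "0 < \<epsilon>" "\<epsilon> \<le> H"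
    and m: "1 + ln (real T * 2 ^ m) \<le> (2 ^ m) powr \<epsilon>"
  shows "(\<Sum>n=1..T * 2 ^ m. prob {\<omega> \<in> space M. \<forall>k<n.
        - ((1 / 2 ^ m) powr (H - \<epsilon>)) \<le> X (real n * (1 / 2 ^ m)) \<omega> - X (real k * (1 / 2 ^ m)) \<omega>}) \<le>
    2 * (2 ^ m) powr (2 * \<epsilon> / H)
    + exp 3 * 6 * (2 ^ m) powr (2 * \<epsilon> / H + H - \<epsilon>) * (ln (real T * 2 ^ m + 1) + exp (real T powr (2 * H) / 2) - 1)
    + real T * 2 ^ m * exp (1/2 - (2 ^ m) powr \<epsilon> / (2 * (1 + ln (real T * 2 ^ m))))"
proof -
  define y :: real where "y = 2 ^ m"
  define h where "h = 1 / y"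
  define p where "p = 2 * \<epsilon> / H"
  define q where "q = nat \<lceil>y powr p\<rceil>"
  define \<delta> where "\<delta> = (1 / y) powr (H - \<epsilon>)"
  define K where "K = T * 2 ^ m"
  have y: "1 \<le> y" by (simp add: y_def)
  have h: "0 < h" using y by (simp add: h_def)
  have p: "0 < p" "H * p = 2 * \<epsilon>" using \<epsilon> Hurst_index by (auto simp: p_def)
  have yp: "1 \<le> y powr p" using y p by (intro ge_one_powr_ge_zero) auto
  have q: "y powr p \<le> real q" "real q \<le> 2 * y powr p" "1 \<le> q"
  proof -
    show "y powr p \<le> real q" unfolding q_def by (rule real_nat_ceiling_ge)
    then show "1 \<le> q" using yp by linarith
    have "real q \<le> y powr p + 1" unfolding q_def using yp by (simp add: of_nat_nat)
    then show "real q \<le> 2 * y powr p" using yp by linarith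
  qed
  have \<delta>_eq: "\<delta> = y powr (\<epsilon> - H)" using y by (simp add: \<delta>_def powr_minus_divide[symmetric] powr_divide)
  have \<delta>: "0 < \<delta>" "\<delta> \<le> 1"
    using y \<epsilon> powr_mono[of "\<epsilon> - H" 0 y] by (auto simp: \<delta>_eq)
  have K: "1 \<le> K" "real K = real T * y" "real K * h = real T" using T y by (auto simp: K_def y_def h_def)
  have lnK: "0 \<le> ln (real K)" using K by simp
  \<comment> \<open>The reason for the exponent \<open>p = 2 * \<epsilon> / H\<close> in
    \<open>q\<close>: the process moves over \<open>q\<close> intervals by more than \<delta>, by
    the factor \<open>y powr \<epsilon>\<close>, which eventually beats the logarithm in the
    required gap.\<close>
  have gap: "\<delta> * y powr \<epsilon> \<le> (real q * h) powr H"
  proof -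
    have "\<delta> * y powr \<epsilon> = (y powr (p - 1)) powr H"
      using p(2) by (simp add: \<delta>_eq powr_powr powr_add[symmetric] algebra_simps)
    also have "\<dots> \<le> (real q * h) powr H"
      using q y Hurst_index by (intro powr_mono2) (auto simp: h_def powr_diff divide_right_mono)
    finally show ?thesis .
  qed
  have a: "\<delta> * (1 + ln (real K)) \<le> (real q * h) powr H"
    using m \<delta> by (intro order_trans[OF _ gap] mult_left_mono) (auto simp: K y_def)
  have "1 \<le> exp (real T powr (2 * H) / 2)" "0 \<le> ln (real K + 1)" by simp_all
  then have nn: "0 \<le> ln (real K + 1) + exp (real T powr (2 * H) / 2) - 1" by linarith
  have "(\<Sum>n=1..K. prob {\<omega> \<in> space M. \<forall>k<n. - \<delta> \<le> X (real n * h) \<omega> - X (real k * h) \<omega>}) \<le>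
    real q + exp 3 * (3 * real q) * (1 / \<delta> * (ln (real K + 1) + exp (real T powr (2 * H) / 2) - 1))
    + real K * exp (1/2 - (real q * h) powr H / (2 * (\<delta> * (1 + ln (real K)))))"
    using expected_near_records_le[OF h K(1) q(3) \<delta> a] unfolding K(3) .
  also have "\<dots> \<le> 2 * y powr p + exp 3 * (3 * (2 * y powr p)) * (1 / \<delta> * (ln (real K + 1) + exp (real T powr (2 * H) / 2) - 1))
    + real K * exp (1/2 - y powr \<epsilon> / (2 * (1 + ln (real K))))"
  proof (intro add_mono mult_mono order_refl)
    show "exp (1/2 - (real q * h) powr H / (2 * (\<delta> * (1 + ln (real K))))) \<le> exp (1/2 - y powr \<epsilon> / (2 * (1 + ln (real K))))"
    proof -
      have "y powr \<epsilon> / (2 * (1 + ln (real K))) = \<delta> * y powr \<epsilon> / (2 * (\<delta> * (1 + ln (real K))))"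
        using \<delta> by simp
      also have "\<dots> \<le> (real q * h) powr H / (2 * (\<delta> * (1 + ln (real K))))"
        using gap \<delta> lnK by (intro divide_right_mono) auto
      finally show ?thesis by simp
    qed
  qed (use q \<delta> nn in auto)
  also have "1 / \<delta> = y powr (H - \<epsilon>)" using y by (simp add: \<delta>_eq powr_diff)
  also have "exp 3 * (3 * (2 * y powr p)) * (y powr (H - \<epsilon>) * (ln (real K + 1) + exp (real T powr (2 * H) / 2) - 1)) =
      exp 3 * 6 * y powr (p + H - \<epsilon>) * (ln (real K + 1) + exp (real T powr (2 * H) / 2) - 1)"
    by (simp add: add_diff_eq[symmetric] powr_add)
  finally show ?thesis
    unfolding K(2) by (simp add: \<delta>_def h_def K_def y_def p_def)
qed

text \<open>The margin in \<alpha> pays for the factor \<open>q\<close>: multiplied by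
  \<open>y powr (- \<alpha>)\<close>, the first two terms have negative exponents
  \<open>- d1\<close> and \<open>- d2\<close>, and the last decays faster than any power of
  \<open>y = 2 ^ m\<close>.\<close>

lemma summable_expected_near_records:
  fixes T :: nat
  assumes T: "1 \<le> T" and \<epsilon>: "0 < \<epsilon>" "\<epsilon> \<le> H" and \<alpha>: "H + 2 * \<epsilon> / H < \<alpha>"
  shows "summable (\<lambda>m::nat. (\<Sum>n=1..T * 2 ^ m. prob {\<omega> \<in> space M. \<forall>k<n.
        - ((1 / 2 ^ m) powr (H - \<epsilon>)) \<le> X (real n * (1 / 2 ^ m)) \<omega> - X (real k * (1 / 2 ^ m)) \<omega>}) * (1 / 2 ^ m) powr \<alpha>)"
    (is "summable (\<lambda>m. ?S m * _)")
proof -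
  define t c where "t = real T" and "c = exp (real T powr (2 * H) / 2) - 1"
  have t: "1 \<le> t" "0 < t" using T by (auto simp: t_def)
  define d1 d2 where "d1 = \<alpha> - 2 * \<epsilon> / H" and "d2 = \<alpha> - (2 * \<epsilon> / H + H - \<epsilon>)"
  have d: "0 < d1" "0 < d2" using \<alpha> \<epsilon> Hurst_index by (auto simp: d1_def d2_def)
  define B where "B m = 2 * (2 ^ m) powr (- d1)
    + exp 3 * 6 * ((2 ^ m) powr (- d2) * (ln (t * 2 ^ m + 1) + c))
    + t * exp (1/2) * ((2 ^ m) powr (1 - \<alpha>) * exp (- ((2 ^ m) powr \<epsilon> / (2 * (1 + ln (t * 2 ^ m))))))" for m :: nat
  have sq: "summable (\<lambda>m::nat. norm (1 / (real m)\<^sup>2))"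
    using inverse_power_summable[of 2] by (simp add: inverse_eq_divide)
  have "(\<lambda>m::nat. (2 ^ m) powr (- d1)) \<in> O(\<lambda>m. 1 / (real m)\<^sup>2)" using d by real_asymp
  then have s1: "summable (\<lambda>m::nat. (2 ^ m) powr (- d1))" by (rule summable_comparison_test_bigo[OF sq])
  have "(\<lambda>m::nat. (2 ^ m) powr (- d2) * (ln (t * 2 ^ m + 1) + c)) \<in> O(\<lambda>m. 1 / (real m)\<^sup>2)" using d t by real_asymp
  then have s2: "summable (\<lambda>m::nat. (2 ^ m) powr (- d2) * (ln (t * 2 ^ m + 1) + c))" by (rule summable_comparison_test_bigo[OF sq])
  have "(\<lambda>m::nat. (2 ^ m) powr (1 - \<alpha>) * exp (- ((2 ^ m) powr \<epsilon> / (2 * (1 + ln (t * 2 ^ m)))))) \<in> O(\<lambda>m. 1 / (real m)\<^sup>2)"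
    using \<epsilon> t by real_asymp
  then have s3: "summable (\<lambda>m::nat. (2 ^ m) powr (1 - \<alpha>) * exp (- ((2 ^ m) powr \<epsilon> / (2 * (1 + ln (t * 2 ^ m))))))"
    by (rule summable_comparison_test_bigo[OF sq])
  have "summable B" unfolding B_def by (intro summable_add summable_mult s1 s2 s3)
  moreover have "\<forall>\<^sub>F m::nat in sequentially. 1 + ln (t * 2 ^ m) \<le> (2 ^ m) powr \<epsilon>"
    using \<epsilon> t by real_asymp
  then have "\<forall>\<^sub>F m in sequentially. norm (?S m * (1 / 2 ^ m) powr \<alpha>) \<le> B m"
  proof eventually_elim
    case (elim m)
    define y :: real where "y = 2 ^ m"
    have y: "0 < y" by (simp add: y_def)
    have "?S m \<le> 2 * y powr (2 * \<epsilon> / H) + exp 3 * 6 * y powr (2 * \<epsilon> / H + H - \<epsilon>) * (ln (t * y + 1) + c)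
      + t * y * exp (1/2 - y powr \<epsilon> / (2 * (1 + ln (t * y))))"
      using expected_near_records_dyadic_le[OF T \<epsilon>, of m] elim by (simp add: t_def c_def y_def add_diff_eq)
    then have "?S m * (1 / y) powr \<alpha> \<le> (2 * y powr (2 * \<epsilon> / H) + exp 3 * 6 * y powr (2 * \<epsilon> / H + H - \<epsilon>) * (ln (t * y + 1) + c)
      + t * y * exp (1/2 - y powr \<epsilon> / (2 * (1 + ln (t * y))))) * (1 / y) powr \<alpha>"
      by (intro mult_right_mono) auto
    also have "(1 / y) powr \<alpha> = y powr (- \<alpha>)" using y by (simp add: powr_minus_divide powr_divide)
    also have "(2 * y powr (2 * \<epsilon> / H) + exp 3 * 6 * y powr (2 * \<epsilon> / H + H - \<epsilon>) * (ln (t * y + 1) + c)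
      + t * y * exp (1/2 - y powr \<epsilon> / (2 * (1 + ln (t * y))))) * y powr (- \<alpha>) =
      2 * (y powr (2 * \<epsilon> / H) * y powr (- \<alpha>)) + exp 3 * 6 * ((y powr (2 * \<epsilon> / H + H - \<epsilon>) * y powr (- \<alpha>)) * (ln (t * y + 1) + c))
      + t * ((y powr 1 * y powr (- \<alpha>)) * exp (1/2 + - (y powr \<epsilon> / (2 * (1 + ln (t * y))))))"
      using y by (simp add: algebra_simps)
    also have "\<dots> = B m"
      unfolding powr_add[symmetric] exp_add B_def y_def[symmetric] by (simp add: d1_def d2_def algebra_simps)
    finally show ?case unfolding y_def by (simp add: sum_nonneg powr_divide powr_minus_divide)
  qed
  ultimately show ?thesis by (rule summable_comparison_test_ev[rotated])
qed

end

section \<open>Almost sure path properties\<close>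

lemma (in prob_space) second_moment_sum_le:
  fixes g :: "nat \<Rightarrow> 'a \<Rightarrow> real"
  assumes int: "\<And>j k. integrable M (\<lambda>\<omega>. g j \<omega> * g k \<omega>)"
    and diag: "\<And>k. expectation (\<lambda>\<omega>. g k \<omega> * g k \<omega>) \<le> 1"
    and off: "\<And>j k. j < k \<Longrightarrow> expectation (\<lambda>\<omega>. g j \<omega> * g k \<omega>) \<le> \<eta>" and \<eta>: "0 \<le> \<eta>"
  shows "expectation (\<lambda>\<omega>. (\<Sum>k<n. g k \<omega>)\<^sup>2) \<le> real n + (real n)\<^sup>2 * \<eta>"
proof -
  have pair: "expectation (\<lambda>\<omega>. g j \<omega> * g k \<omega>) \<le> (if j = k then 1 else 0) + \<eta>" for j k
  proof -
    consider "j = k" | "j < k" | "k < j" by linarith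
    then show ?thesis
    proof cases
      case 1 then show ?thesis using diag[of k] \<eta> by simp
    next
      case 2 then show ?thesis using off[of j k] by simp
    next
      case 3 then show ?thesis using off[of k j] by (simp add: mult.commute)
    qed
  qed
  have "expectation (\<lambda>\<omega>. (\<Sum>k<n. g k \<omega>)\<^sup>2) = expectation (\<lambda>\<omega>. \<Sum>j<n. \<Sum>k<n. g j \<omega> * g k \<omega>)"
    by (simp add: power2_eq_square sum_product)
  also have "\<dots> = (\<Sum>j<n. \<Sum>k<n. expectation (\<lambda>\<omega>. g j \<omega> * g k \<omega>))"
    by (simp add: int)
  also have "\<dots> \<le> (\<Sum>j<n. \<Sum>k<n. (if j = k then 1 else 0) + \<eta>)"
    by (intro sum_mono pair)
  also have "\<dots> = (\<Sum>j<n. 1 + real n * \<eta>)"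
    by (intro sum.cong) (auto simp: sum.distrib)
  also have "\<dots> = real n + (real n)\<^sup>2 * \<eta>"
    by (simp add: power2_eq_square algebra_simps)
  finally show ?thesis .
qed

lemma one_minus_cos_le_abs: "1 - cos y \<le> \<bar>y\<bar>" for y :: real
proof -
  have "1 - cos y = 2 * (sin (y / 2))\<^sup>2" using cos_double_sin[of "y / 2"] by simp
  also have "\<dots> = 2 * (\<bar>sin (y / 2)\<bar> * \<bar>sin (y / 2)\<bar>)" by (simp add: power2_eq_square)
  also have "\<dots> \<le> 2 * (1 * \<bar>y / 2\<bar>)"
    by (intro mult_left_mono mult_mono abs_sin_x_le_abs_x) auto
  finally show ?thesis by simp
qed

context fractional_brownian_motion
begin

text \<open>Self-similarity reduces the covariance to a function of \<open>u\<close>. The resulting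
  correlation bound \<open>u powr H + u powr (1 - H)\<close> vanishes as \<open>u\<close> tends to 0
  for every \<open>H\<close> in (0,1), so values at widely separated time scales are nearly
  uncorrelated.\<close>

lemma covariance_scaled_le:
  assumes t: "0 < t" and u: "0 < u" "u \<le> 1"
  shows "0 \<le> expectation (\<lambda>\<omega>. X t \<omega> * X (u * t) \<omega>)"
    and "expectation (\<lambda>\<omega>. X t \<omega> * X (u * t) \<omega>) \<le> (u powr H + u powr (1 - H)) * (t powr H * (u * t) powr H)"
proof -
  have E: "expectation (\<lambda>\<omega>. X t \<omega> * X (u * t) \<omega>) = t powr (2 * H) * (1 + u powr (2 * H) - (1 - u) powr (2 * H)) / 2"
  proof -
    have "0 \<le> (1 - u) * t" using t u by simp
    then have *: "\<bar>t - u * t\<bar> = (1 - u) * t" by (simp add: left_diff_distrib)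
    have "expectation (\<lambda>\<omega>. X t \<omega> * X (u * t) \<omega>) =
        1/2 * (\<bar>t\<bar> powr (2 * H) + \<bar>u * t\<bar> powr (2 * H) - \<bar>t - u * t\<bar> powr (2 * H))"
      by (rule covariance) (use t u in auto)
    then show ?thesis unfolding * using t u by (simp add: powr_mult abs_mult) (simp add: algebra_simps)
  qed
  have "(1 - u) powr (2 * H) \<le> 1 powr (2 * H)" using u Hurst_index by (intro powr_mono2) auto
  then have "(1 - u) powr (2 * H) \<le> 1" by simp
  then show "0 \<le> expectation (\<lambda>\<omega>. X t \<omega> * X (u * t) \<omega>)"
    unfolding E using powr_ge_zero[of u "2 * H"] by (intro divide_nonneg_nonneg mult_nonneg_nonneg powr_ge_zero) linarith+
  \<comment> \<open>A Bernoulli-type bound covering all \<open>H\<close> at once: the exponent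
    \<open>2 * H\<close> is below 2 and the base at most 1, so the power is at least
    \<open>1 - 2 * u\<close>.\<close>
  have "(1 - u)\<^sup>2 \<le> (1 - u) powr (2 * H)"
  proof (cases "u = 1")
    case False
    then have "(1 - u)\<^sup>2 = (1 - u) powr 2" using u by simp
    also have "\<dots> \<le> (1 - u) powr (2 * H)" using u False Hurst_index by (intro powr_mono') auto
    finally show ?thesis .
  qed simp
  then have "1 - (1 - u) powr (2 * H) \<le> 2 * u" by (simp add: power2_eq_square algebra_simps) (use u in \<open>smt (verit) mult_nonneg_nonneg\<close>)
  then have "1 + u powr (2 * H) - (1 - u) powr (2 * H) \<le> 2 * (u powr (2 * H) + u)"
    using powr_ge_zero[of u "2 * H"] unfolding distrib_left by linarith
  then have "expectation (\<lambda>\<omega>. X t \<omega> * X (u * t) \<omega>) \<le> t powr (2 * H) * (u powr (2 * H) + u)"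
    unfolding E times_divide_eq_right[symmetric] by (intro mult_left_mono) auto
  also have "\<dots> = (u powr H + u powr (1 - H)) * (t powr H * (u * t) powr H)"
    using t u by (simp add: powr_mult algebra_simps flip: powr_add) 
  finally show "expectation (\<lambda>\<omega>. X t \<omega> * X (u * t) \<omega>) \<le> (u powr H + u powr (1 - H)) * (t powr H * (u * t) powr H)" .
qed

text \<open>If the normalised values \<open>Y k\<close> are all nonpositive, then so is every \<open>1 - cos (Y k) + Y k\<close>, although
  their average concentrates at \<open>1 - exp (- 1 / 2)\<close> because the \<open>Y k\<close> are almost uncorrelated.\<close>

lemma prob_nonpositive_le:
  assumes r: "0 < r" "r < 1" and small: "r powr H + r powr (1 - H) \<le> 1" and n: "1 \<le> n"
  shows "prob {\<omega> \<in> space M. \<forall>k<n. X (r ^ k) \<omega> \<le> 0} \<le> 4 * (1 / real n + (r powr H + r powr (1 - H))) / (1 - exp (- 1 / 2))\<^sup>2"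
proof -
  define \<eta> where "\<eta> = r powr H + r powr (1 - H)"
  define c where "c k = 1 / (r ^ k) powr H" for k :: nat
  define Y where "Y k \<omega> = c k * X (r ^ k) \<omega>" for k \<omega>
  define G where "G k \<omega> = cos (Y k \<omega>) - exp (- 1 / 2)" for k \<omega>
  define \<kappa> where "\<kappa> = 1 - exp (- 1 / 2 :: real)"
  have \<kappa>: "0 < \<kappa>" by (simp add: \<kappa>_def)
  have c: "0 < c k" for k using r by (simp add: c_def)
  have Y_mem: "Y k \<in> lin_span" for k
    unfolding Y_def[abs_def] using r by (intro gs.scale_mem X_mem) auto
  note [measurable] = gs.measurable_mem[OF Y_mem]
  have \<eta>: "0 \<le> \<eta>" "\<eta> \<le> 1" using small by (auto simp: \<eta>_def)
  have YY1: "expectation (\<lambda>\<omega>. (Y k \<omega>)\<^sup>2) = 1" for k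
  proof -
    have "expectation (\<lambda>\<omega>. (Y k \<omega>)\<^sup>2) = (c k)\<^sup>2 * (r ^ k) powr (2 * H)"
      using r by (simp add: Y_def power_mult_distrib second_moment)
    also have "(r ^ k) powr (2 * H) = ((r ^ k) powr H)\<^sup>2" using r by (simp add: powr_power mult.commute)
    finally show ?thesis using r by (simp add: c_def power_divide)
  qed
  have YY: "0 \<le> expectation (\<lambda>\<omega>. Y j \<omega> * Y k \<omega>)" "expectation (\<lambda>\<omega>. Y j \<omega> * Y k \<omega>) \<le> \<eta>" if "j < k" for j k
  proof -
    define u where "u = r ^ (k - j)"
    have u: "0 < u" "u \<le> r" using r that power_decreasing[of 1 "k - j" r] by (auto simp: u_def)
    have rk: "r ^ k = u * r ^ j" using that by (simp add: u_def power_add[symmetric])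
    have E: "expectation (\<lambda>\<omega>. Y j \<omega> * Y k \<omega>) = c j * c k * expectation (\<lambda>\<omega>. X (r ^ j) \<omega> * X (u * r ^ j) \<omega>)"
      unfolding Y_def rk[symmetric] by (simp add: mult_ac)
    have cov: "0 \<le> expectation (\<lambda>\<omega>. X (r ^ j) \<omega> * X (u * r ^ j) \<omega>)"
      "expectation (\<lambda>\<omega>. X (r ^ j) \<omega> * X (u * r ^ j) \<omega>) \<le> (u powr H + u powr (1 - H)) * ((r ^ j) powr H * (u * r ^ j) powr H)"
      using r u by (intro covariance_scaled_le; simp)+
    show "0 \<le> expectation (\<lambda>\<omega>. Y j \<omega> * Y k \<omega>)" unfolding E using c cov by (simp add: less_imp_le)
    have "expectation (\<lambda>\<omega>. Y j \<omega> * Y k \<omega>) \<le> c j * c k * ((u powr H + u powr (1 - H)) * ((r ^ j) powr H * (r ^ k) powr H))"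
      unfolding E rk using c cov by (intro mult_left_mono) (auto simp: less_imp_le rk)
    also have "\<dots> = u powr H + u powr (1 - H)" using r by (simp add: c_def)
    also have "\<dots> \<le> \<eta>" unfolding \<eta>_def using u Hurst_index by (intro add_mono powr_mono2) auto
    finally show "expectation (\<lambda>\<omega>. Y j \<omega> * Y k \<omega>) \<le> \<eta>" .
  qed
  have E_cos: "expectation (\<lambda>\<omega>. cos (Y k \<omega>)) = exp (- 1 / 2)" for k
    using gs.expectation_cos_mem[OF Y_mem, of k] by (simp add: YY1)
  have int_cos: "integrable M (\<lambda>\<omega>. cos (Y k \<omega>))" for k by (intro integrable_const_bound[where B = 1]) auto
  have int_cos2: "integrable M (\<lambda>\<omega>. cos (Y j \<omega>) * cos (Y k \<omega>))" for j k
    by (intro integrable_const_bound[where B = 1]) (auto simp: abs_mult intro!: mult_le_one)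
  have GG_eq: "(\<lambda>\<omega>. G j \<omega> * G k \<omega>) = (\<lambda>\<omega>. cos (Y j \<omega>) * cos (Y k \<omega>) - exp (-1/2) * cos (Y j \<omega>) - exp (-1/2) * cos (Y k \<omega>) + exp (-1/2) * exp (-1/2))" for j k
    by (simp add: G_def fun_eq_iff algebra_simps)
  have int_GG: "integrable M (\<lambda>\<omega>. G j \<omega> * G k \<omega>)" for j k
    unfolding GG_eq using int_cos int_cos2 by simp
  have GG: "expectation (\<lambda>\<omega>. G j \<omega> * G k \<omega>) = expectation (\<lambda>\<omega>. cos (Y j \<omega>) * cos (Y k \<omega>)) - exp (-1)" for j k
    unfolding GG_eq using int_cos int_cos2 by (simp add: E_cos prob_space flip: exp_add)
  have 1: "expectation (\<lambda>\<omega>. (\<Sum>k<n. Y k \<omega>)\<^sup>2) \<le> real n + (real n)\<^sup>2 * \<eta>"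
    by (rule second_moment_sum_le) (use YY YY1 \<eta> in \<open>auto simp: gs.integrable_mult_mem Y_mem power2_eq_square\<close>)
  \<comment> \<open>The covariance of two cosines is \<open>exp (-1) * (cosh \<rho> - 1)\<close>
    with \<rho> the covariance of the \<open>Y\<close> variables; for \<rho> in [0,1] this is at
    most \<rho>, so the cosines are as weakly correlated as the variables.\<close>
  have 2: "expectation (\<lambda>\<omega>. (\<Sum>k<n. G k \<omega>)\<^sup>2) \<le> real n + (real n)\<^sup>2 * \<eta>"
  proof (rule second_moment_sum_le[OF int_GG _ _ \<eta>(1)])
    fix k
    have "expectation (\<lambda>\<omega>. cos (Y k \<omega>) * cos (Y k \<omega>)) \<le> expectation (\<lambda>\<omega>. 1)"
      by (intro integral_mono int_cos2) (auto simp: mult_le_one abs_square_le_1 power2_eq_square[symmetric])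
    then show "expectation (\<lambda>\<omega>. G k \<omega> * G k \<omega>) \<le> 1" unfolding GG by (simp add: prob_space) (smt (verit) exp_gt_zero)
  next
    fix j k :: nat assume jk: "j < k"
    define \<rho> where "\<rho> = expectation (\<lambda>\<omega>. Y j \<omega> * Y k \<omega>)"
    have \<rho>: "0 \<le> \<rho>" "\<rho> \<le> \<eta>" using YY[OF jk] by (auto simp: \<rho>_def)
    have sq: "expectation (\<lambda>\<omega>. (Y j \<omega> + Y k \<omega>)\<^sup>2) = 2 + 2 * \<rho>" "expectation (\<lambda>\<omega>. (Y j \<omega> - Y k \<omega>)\<^sup>2) = 2 - 2 * \<rho>"
      using gs.expectation_square_add[OF Y_mem[of j] Y_mem[of k], where c = 1] gs.expectation_square_add[OF Y_mem[of j] Y_mem[of k], where c = "-1"]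
      by (simp_all add: YY1 \<rho>_def)
    have "expectation (\<lambda>\<omega>. cos (Y j \<omega>) * cos (Y k \<omega>)) = exp (-1) * ((exp (-\<rho>) + exp \<rho>) / 2)"
      unfolding gs.expectation_cos_cos[OF Y_mem Y_mem] sq by (simp add: exp_add[symmetric] algebra_simps add_divide_distrib diff_divide_distrib)
    also have "exp (-\<rho>) \<le> 1" using \<rho> by simp
    also have "exp \<rho> \<le> 1 + \<rho> + \<rho>\<^sup>2" using \<rho> \<eta> by (intro exp_bound) auto
    also have "\<rho>\<^sup>2 \<le> \<rho>" using \<rho> \<eta> by (simp add: power2_eq_square mult_left_le)
    finally have "expectation (\<lambda>\<omega>. cos (Y j \<omega>) * cos (Y k \<omega>)) \<le> exp (-1) + exp (-1) * \<rho>"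
      by (simp add: algebra_simps add_divide_distrib)
    also have "exp (-1) * \<rho> \<le> 1 * \<rho>" using \<rho> by (intro mult_right_mono) auto
    finally show "expectation (\<lambda>\<omega>. G j \<omega> * G k \<omega>) \<le> \<eta>" unfolding GG using \<rho> by simp
  qed
  \<comment> \<open>On the event every \<open>G k - Y k\<close> is at least \<kappa>, so the
    difference of the two sums is at least \<open>n * \<kappa>\<close>. \<open>Q\<close> bounds the
    square of this difference and has expectation of order \<open>n + n\<^sup>2 * \<eta>\<close>,
    which makes Markov's inequality effective.\<close>
  define Q where "Q \<omega> = 2 * (\<Sum>k<n. Y k \<omega>)\<^sup>2 + 2 * (\<Sum>k<n. G k \<omega>)\<^sup>2" for \<omega>
  have int_Q: "integrable M (\<lambda>\<omega>. (\<Sum>k<n. Y k \<omega>)\<^sup>2)" "integrable M (\<lambda>\<omega>. (\<Sum>k<n. G k \<omega>)\<^sup>2)"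
    unfolding power2_eq_square sum_product
    by (intro Bochner_Integration.integrable_sum gs.integrable_mult_mem Y_mem int_GG)+
  have Q: "integrable M Q" "expectation Q \<le> 4 * (real n + (real n)\<^sup>2 * \<eta>)"
    unfolding Q_def[abs_def] using int_Q 1 2 by auto
  have Q0: "0 \<le> Q \<omega>" for \<omega> by (simp add: Q_def)
  have "prob {\<omega> \<in> space M. \<forall>k<n. X (r ^ k) \<omega> \<le> 0} \<le> prob {\<omega> \<in> space M. (real n * \<kappa>)\<^sup>2 \<le> Q \<omega>}"
  proof (rule finite_measure_mono)
    show "{\<omega> \<in> space M. (real n * \<kappa>)\<^sup>2 \<le> Q \<omega>} \<in> events" using Q(1) by measurable
    show "{\<omega> \<in> space M. \<forall>k<n. X (r ^ k) \<omega> \<le> 0} \<subseteq> {\<omega> \<in> space M. (real n * \<kappa>)\<^sup>2 \<le> Q \<omega>}"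
    proof safe
      fix \<omega> assume *: "\<forall>k<n. X (r ^ k) \<omega> \<le> 0"
      have "(\<Sum>k<n. \<kappa>) \<le> (\<Sum>k<n. G k \<omega> - Y k \<omega>)"
      proof (rule sum_mono)
        fix k assume "k \<in> {..<n}"
        then have "Y k \<omega> \<le> 0" using * c[of k] by (simp add: Y_def mult_nonneg_nonpos less_imp_le)
        then show "\<kappa> \<le> G k \<omega> - Y k \<omega>" using one_minus_cos_le_abs[of "Y k \<omega>"] by (simp add: \<kappa>_def G_def)
      qed
      then have "real n * \<kappa> \<le> (\<Sum>k<n. G k \<omega>) - (\<Sum>k<n. Y k \<omega>)" by (simp add: sum_subtractf)
      then have "(real n * \<kappa>)\<^sup>2 \<le> ((\<Sum>k<n. G k \<omega>) - (\<Sum>k<n. Y k \<omega>))\<^sup>2" using \<kappa> by (intro power_mono) auto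
      also have "\<dots> \<le> Q \<omega>"
        using zero_le_power2[of "(\<Sum>k<n. G k \<omega>) + (\<Sum>k<n. Y k \<omega>)"] unfolding Q_def power2_sum power2_diff by linarith
      finally show "(real n * \<kappa>)\<^sup>2 \<le> Q \<omega>" .
    qed
  qed
  also have "\<dots> \<le> expectation Q / (real n * \<kappa>)\<^sup>2"
    by (rule integral_Markov_inequality_measure[where A = "{}"]) (use Q Q0 n \<kappa> in auto)
  also have "\<dots> \<le> 4 * (real n + (real n)\<^sup>2 * \<eta>) / (real n * \<kappa>)\<^sup>2"
    using Q by (intro divide_right_mono) auto
  also have "\<dots> = 4 * (1 / real n + \<eta>) / \<kappa>\<^sup>2"
    using n \<kappa> by (simp add: field_simps power2_eq_square)
  finally show ?thesis by (simp add: \<eta>_def \<kappa>_def)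
qed

lemma AE_start_zero: "AE \<omega> in M. X 0 \<omega> = 0"
proof -
  have "expectation (\<lambda>\<omega>. (X 0 \<omega>)\<^sup>2) = 0" by (simp add: second_moment)
  then have "AE \<omega> in M. (X 0 \<omega>)\<^sup>2 = 0"
    using gs.integrable_square_mem[OF X_mem, of 0] by (subst (asm) integral_nonneg_eq_0_iff_AE) auto
  then show ?thesis by simp
qed

text \<open>The exceptional event is contained in the nonpositivity event of every geometric
  sequence of times. Taking \<open>i\<close> points with ratio \<open>1 / (i + 1)\<close> makes both
  error terms, \<open>1 / i\<close> and the correlation \<open>\<eta> i\<close>, vanish
  together.\<close>

lemma AE_positive_value: "AE \<omega> in M. \<exists>t\<in>{0..1}. 0 < X t \<omega>"
proof -
  define B where "B = {\<omega> \<in> space M. \<forall>(i::nat) k. X ((1 / real (Suc i)) ^ k) \<omega> \<le> 0}"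
  have [measurable]: "X ((1 / real (Suc i)) ^ k) \<in> borel_measurable M" for i k
    by (intro gs.measurable_mem X_mem) auto
  have B: "B \<in> events" unfolding B_def by measurable
  define \<eta> where "\<eta> i = (1 / real (Suc i)) powr H + (1 / real (Suc i)) powr (1 - H)" for i
  have \<eta>: "\<eta> \<longlonglongrightarrow> 0"
  proof -
    have lim: "(\<lambda>i. 1 / real (Suc i)) \<longlonglongrightarrow> 0"
      using LIMSEQ_inverse_real_of_nat by (simp add: inverse_eq_divide)
    have "(\<lambda>i. (1 / real (Suc i)) powr H + (1 / real (Suc i)) powr (1 - H)) \<longlonglongrightarrow> 0 + 0"
      using Hurst_index by (intro tendsto_add tendsto_zero_powrI[OF lim tendsto_const]) auto
    then show ?thesis by (simp add: \<eta>_def[abs_def])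
  qed
  then have "\<forall>\<^sub>F i in sequentially. \<eta> i < 1" by (rule order_tendstoD) simp
  then have "\<forall>\<^sub>F i in sequentially. prob B \<le> 4 * (1 / real i + \<eta> i) / (1 - exp (- 1 / 2))\<^sup>2"
    using eventually_ge_at_top[of 1]
  proof eventually_elim
    case (elim i)
    have "prob B \<le> prob {\<omega> \<in> space M. \<forall>k<i. X ((1 / real (Suc i)) ^ k) \<omega> \<le> 0}"
    proof (rule finite_measure_mono)
      show "{\<omega> \<in> space M. \<forall>k<i. X ((1 / real (Suc i)) ^ k) \<omega> \<le> 0} \<in> events" by measurable
    qed (use B_def in blast)
    also have "\<dots> \<le> 4 * (1 / real i + \<eta> i) / (1 - exp (- 1 / 2))\<^sup>2"
      unfolding \<eta>_def by (rule prob_nonpositive_le) (use elim in \<open>auto simp: \<eta>_def\<close>)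
    finally show ?case .
  qed
  moreover have "(\<lambda>i. 4 * (1 / real i + \<eta> i) / (1 - exp (- 1 / 2))\<^sup>2) \<longlonglongrightarrow> 4 * (0 + 0) / (1 - exp (- 1 / 2))\<^sup>2"
    by (intro tendsto_intros \<eta> lim_1_over_n) auto
  ultimately have "prob B \<le> 4 * (0 + 0) / (1 - exp (- 1 / 2))\<^sup>2"
    by (intro tendsto_lowerbound) auto
  then have "prob B = 0" using measure_nonneg[of M B] by simp
  then have "B \<in> null_sets M" using B by (intro null_setsI) (simp_all add: emeasure_eq_measure)
  then have "AE \<omega> in M. \<omega> \<notin> B" by (rule AE_not_in)
  then show ?thesis
  proof (rule AE_mp, intro AE_I2 impI)
    fix \<omega> assume \<omega>: "\<omega> \<in> space M" "\<omega> \<notin> B"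
    then obtain i k where "0 < X ((1 / real (Suc i)) ^ k) \<omega>" by (auto simp: B_def not_le)
    moreover have "(1 / real (Suc i)) ^ k \<in> {0..1}" by (auto intro!: power_le_one)
    ultimately show "\<exists>t\<in>{0..1}. 0 < X t \<omega>" by blast
  qed
qed

lemma prob_increment_ge_le:
  assumes "0 \<le> s" "0 \<le> t" "s \<noteq> t"
  shows "prob {\<omega> \<in> space M. a \<le> \<bar>X t \<omega> - X s \<omega>\<bar>} \<le> 2 * exp (1/2 - a / \<bar>t - s\<bar> powr H)"
proof -
  have tail: "prob {\<omega> \<in> space M. a \<le> X v \<omega> - X u \<omega>} \<le> exp (1/2 - a / \<bar>t - s\<bar> powr H)"
    if "0 \<le> u" "0 \<le> v" "\<bar>v - u\<bar> = \<bar>t - s\<bar>" for u v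
    using gs.tail_mem[OF increment_mem[OF that(1,2)], of "\<bar>t - s\<bar> powr H" a] assms that
    by (simp add: increment_second_moment powr_power mult.commute)
  note [measurable] = gs.measurable_mem[OF X_mem[OF assms(1)]] gs.measurable_mem[OF X_mem[OF assms(2)]]
  have "prob {\<omega> \<in> space M. a \<le> \<bar>X t \<omega> - X s \<omega>\<bar>} \<le>
      prob ({\<omega> \<in> space M. a \<le> X t \<omega> - X s \<omega>} \<union> {\<omega> \<in> space M. a \<le> X s \<omega> - X t \<omega>})"
    by (intro finite_measure_mono) auto
  also have "\<dots> \<le> prob {\<omega> \<in> space M. a \<le> X t \<omega> - X s \<omega>} + prob {\<omega> \<in> space M. a \<le> X s \<omega> - X t \<omega>}"
    by (intro measure_Un_le) auto
  also have "\<dots> \<le> exp (1/2 - a / \<bar>t - s\<bar> powr H) + exp (1/2 - a / \<bar>t - s\<bar> powr H)"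
    using assms by (intro add_mono tail) auto
  finally show ?thesis by simp
qed

text \<open>An increment over \<open>1 / 2 ^ m\<close> exceeds
  \<open>(1 / 2 ^ m) powr \<gamma>\<close> only if it is \<open>(2 ^ m) powr (H - \<gamma>)\<close>
  standard deviations large. This beats the number of dyadic intervals in the union bound, and
  Borel-Cantelli supplies a random starting level for the chaining.\<close>

lemma AE_hoelder:
  fixes T :: nat
  assumes \<gamma>: "0 < \<gamma>" "\<gamma> < H"
  shows "AE \<omega> in M. \<exists>C>0. \<forall>s\<in>{0..real T}. \<forall>t\<in>{0..real T}. \<bar>X s \<omega> - X t \<omega>\<bar> \<le> C * \<bar>s - t\<bar> powr \<gamma>"
proof -
  define D where "D m k \<omega> = \<bar>X (real (Suc k) / 2 ^ m) \<omega> - X (real k / 2 ^ m) \<omega>\<bar>" for m k :: nat and \<omega>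
  define A where "A m = (\<Union>k<T * 2 ^ m. {\<omega> \<in> space M. (1 / 2 ^ m) powr \<gamma> \<le> D m k \<omega>})" for m
  have [measurable]: "X (real k / 2 ^ m) \<in> borel_measurable M" for k m :: nat
    by (intro gs.measurable_mem X_mem) auto
  have D_meas: "{\<omega> \<in> space M. (1 / 2 ^ m) powr \<gamma> \<le> D m k \<omega>} \<in> events" for m k
  proof -
    have "D m k \<in> borel_measurable M" unfolding D_def[abs_def] by measurable
    then show ?thesis by measurable
  qed
  have A_meas: "A m \<in> events" for m unfolding A_def by (intro sets.finite_UN D_meas) auto
  have A_le: "prob (A m) \<le> real T * 2 * exp (1/2) * (2 ^ m * exp (- ((2 ^ m) powr (H - \<gamma>))))" for m
  proof -
    have "prob (A m) \<le> (\<Sum>k<T * 2 ^ m. prob {\<omega> \<in> space M. (1 / 2 ^ m) powr \<gamma> \<le> D m k \<omega>})"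
      unfolding A_def by (rule finite_measure_subadditive_finite) (auto simp: D_meas)
    also have "\<dots> \<le> real (card {..<T * 2 ^ m}) * (2 * exp (1/2 - (2 ^ m) powr (H - \<gamma>)))"
    proof (rule sum_bounded_above)
      fix k
      have "\<bar>real (Suc k) / 2 ^ m - real k / 2 ^ m\<bar> = 1 / 2 ^ m" by (simp add: diff_divide_distrib[symmetric])
      moreover have "(1 / 2 ^ m) powr \<gamma> / (1 / 2 ^ m) powr H = (2 ^ m) powr (H - \<gamma>)"
        by (simp add: powr_divide powr_diff)
      ultimately show "prob {\<omega> \<in> space M. (1 / 2 ^ m) powr \<gamma> \<le> D m k \<omega>} \<le> 2 * exp (1/2 - (2 ^ m) powr (H - \<gamma>))"
        unfolding D_def
        using prob_increment_ge_le[of "real k / 2 ^ m" "real (Suc k) / 2 ^ m" "(1 / 2 ^ m) powr \<gamma>"] by simp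
    qed
    also have "exp (1/2 - (2 ^ m) powr (H - \<gamma>)) = exp (1/2) * exp (- ((2 ^ m) powr (H - \<gamma>)))"
      by (simp only: exp_add[symmetric] diff_conv_add_uminus)
    finally show ?thesis by (simp add: mult_ac)
  qed
  have "summable (\<lambda>m. real T * 2 * exp (1/2) * (2 ^ m * exp (- ((2 ^ m) powr (H - \<gamma>)))))"
  proof (intro summable_mult)
    define k where "k = H - \<gamma>"
    have "k > 0" using \<gamma> by (simp add: k_def)
    then have "(\<lambda>m::nat. 2 ^ m * exp (- ((2 ^ m) powr k))) \<in> O(\<lambda>m. (1/2) ^ m :: real)"
      by real_asymp
    then show "summable (\<lambda>m::nat. 2 ^ m * exp (- ((2 ^ m) powr (H - \<gamma>))))"
      unfolding k_def by (rule summable_comparison_test_bigo[rotated]) (simp add: summable_geometric)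
  qed
  then have "summable (\<lambda>m. prob (A m))"
    by (rule summable_comparison_test[rotated]) (use A_le in auto)
  then have "AE \<omega> in M. \<forall>\<^sub>F m in sequentially. \<omega> \<in> space M - A m"
    by (intro borel_cantelli_AE1 A_meas) (auto simp: emeasure_eq_measure)
  then show ?thesis
  proof (rule AE_mp, intro AE_I2 impI)
    fix \<omega> assume \<omega>: "\<omega> \<in> space M" and "\<forall>\<^sub>F m in sequentially. \<omega> \<in> space M - A m"
    then obtain m0 where m0: "\<And>m. m0 \<le> m \<Longrightarrow> \<omega> \<notin> A m" by (auto simp: eventually_sequentially)
    show "\<exists>C>0. \<forall>s\<in>{0..real T}. \<forall>t\<in>{0..real T}. \<bar>X s \<omega> - X t \<omega>\<bar> \<le> C * \<bar>s - t\<bar> powr \<gamma>"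
    proof (rule hoelder_of_dyadic_increments)
      show "continuous_on {0..real T} (\<lambda>t. X t \<omega>)"
        by (rule continuous_on_subset[OF continuous_paths[OF \<omega>]]) auto
      fix m k assume "m0 \<le> m" "k < T * 2 ^ m"
      then show "\<bar>X (real (Suc k) / 2 ^ m) \<omega> - X (real k / 2 ^ m) \<omega>\<bar> \<le> (1 / 2 ^ m) powr \<gamma>"
        using m0[of m] \<omega> unfolding A_def D_def by (auto simp: not_le intro: less_imp_le)
    qed (rule \<gamma>)
  qed
qed

end

section \<open>The dimension of the record set\<close>

context fractional_brownian_motion
begin

text \<open>Markov's inequality and Borel-Cantelli, along the dyadic meshes where the expectations
  are summable.\<close>

lemma AE_few_near_records:
  fixes T :: nat
  assumes T: "1 \<le> T" and \<epsilon>: "0 < \<epsilon>" "\<epsilon> \<le> H" and \<alpha>: "H + 2 * \<epsilon> / H < \<alpha>"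
  shows "AE \<omega> in M. \<forall>\<^sub>F m::nat in sequentially.
    real (card {n\<in>{1..T * 2 ^ m}. \<forall>k<n. - ((1 / 2 ^ m) powr (H - \<epsilon>)) \<le> X (real n * (1 / 2 ^ m)) \<omega> - X (real k * (1 / 2 ^ m)) \<omega>})
      * (1 / 2 ^ m) powr \<alpha> < 1"
proof -
  define P where "P m n \<omega> \<longleftrightarrow> (\<forall>k<n. - ((1 / 2 ^ m) powr (H - \<epsilon>)) \<le> X (real n * (1 / 2 ^ m)) \<omega> - X (real k * (1 / 2 ^ m)) \<omega>)"
    for m n :: nat and \<omega>
  define R where "R m \<omega> = real (card {n\<in>{1..T * 2 ^ m}. P m n \<omega>}) * (1 / 2 ^ m) powr \<alpha>" for m \<omega>
  have [measurable]: "X (real k * (1 / 2 ^ m)) \<in> borel_measurable M" for k m :: nat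
    by (intro gs.measurable_mem X_mem) auto
  have P_meas: "{\<omega> \<in> space M. P m n \<omega>} \<in> events" for m n
    unfolding P_def by measurable
  have R_nonneg: "0 \<le> R m \<omega>" for m \<omega> by (simp add: R_def)
  have R_eq: "R m \<omega> = (\<Sum>n=1..T * 2 ^ m. indicat_real {\<omega> \<in> space M. P m n \<omega>} \<omega>) * (1 / 2 ^ m) powr \<alpha>" if "\<omega> \<in> space M" for m \<omega>
  proof -
    have "(\<Sum>n=1..T * 2 ^ m. indicat_real {\<omega> \<in> space M. P m n \<omega>} \<omega>) = (\<Sum>n=1..T * 2 ^ m. if P m n \<omega> then 1 else 0)"
      using that by (intro sum.cong) (auto simp: indicator_def)
    also have "\<dots> = real (card {n\<in>{1..T * 2 ^ m}. P m n \<omega>})"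
      by (simp add: sum.If_cases Int_def)
    finally show ?thesis by (simp add: R_def)
  qed
  have int_sum: "integrable M (\<lambda>\<omega>. (\<Sum>n=1..T * 2 ^ m. indicat_real {\<omega> \<in> space M. P m n \<omega>} \<omega>) * (1 / 2 ^ m) powr \<alpha>)" for m
    using P_meas by (intro integrable_mult_left Bochner_Integration.integrable_sum) (auto simp: emeasure_eq_measure)
  have int_R: "integrable M (R m)" for m
    by (rule iffD1[OF Bochner_Integration.integrable_cong[OF refl] int_sum[of m]]) (simp add: R_eq)
  have E_R: "expectation (R m) = (\<Sum>n=1..T * 2 ^ m. prob {\<omega> \<in> space M. P m n \<omega>}) * (1 / 2 ^ m) powr \<alpha>" for m
  proof -
    have "expectation (R m) = expectation (\<lambda>\<omega>. (\<Sum>n=1..T * 2 ^ m. indicat_real {\<omega> \<in> space M. P m n \<omega>} \<omega>) * (1 / 2 ^ m) powr \<alpha>)"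
      by (rule Bochner_Integration.integral_cong) (simp_all add: R_eq)
    also have "\<dots> = (\<Sum>n=1..T * 2 ^ m. expectation (indicat_real {\<omega> \<in> space M. P m n \<omega>})) * (1 / 2 ^ m) powr \<alpha>"
      using P_meas by (subst integral_mult_left_zero, subst Bochner_Integration.integral_sum) (auto simp: emeasure_eq_measure)
    finally show ?thesis using P_meas by simp
  qed
  define A where "A m = {\<omega> \<in> space M. 1 \<le> R m \<omega>}" for m
  have A_meas: "A m \<in> events" for m
  proof -
    have [measurable]: "R m \<in> borel_measurable M" using int_R by (rule borel_measurable_integrable)
    show ?thesis unfolding A_def by measurable
  qed
  have A_le: "prob (A m) \<le> expectation (R m)" for m
  proof -
    have "prob (A m) \<le> expectation (R m) / 1"
      unfolding A_def by (rule integral_Markov_inequality_measure[where A = "{}"]) (use int_R R_nonneg in auto)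
    then show ?thesis by simp
  qed
  have "summable (\<lambda>m. expectation (R m))"
    unfolding E_R P_def by (rule summable_expected_near_records[OF T \<epsilon> \<alpha>])
  then have "summable (\<lambda>m. prob (A m))"
    by (rule summable_comparison_test[rotated]) (use A_le in auto)
  then have "AE \<omega> in M. \<forall>\<^sub>F m in sequentially. \<omega> \<in> space M - A m"
    by (intro borel_cantelli_AE1 A_meas) (auto simp: emeasure_eq_measure)
  then have "AE \<omega> in M. \<forall>\<^sub>F m in sequentially. R m \<omega> < 1"
    by eventually_elim (auto simp: A_def elim!: eventually_mono)
  then show ?thesis unfolding R_def P_def .
qed

lemma AE_hausdorff_measure_eq_0:
  assumes \<alpha>: "H < \<alpha>"
  shows "AE \<omega> in M. hausdorff_measure \<alpha> (record_set (\<lambda>t. X t \<omega>)) = 0"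
proof -
  \<comment> \<open>The count is controlled at the intermediate exponent, where it is merely below
    1; the surplus \<open>h powr (\<alpha> - \<alpha>')\<close> then makes the \<alpha>-value
    arbitrarily small.\<close>
  define \<alpha>' where "\<alpha>' = (\<alpha> + H) / 2"
  define \<epsilon> where "\<epsilon> = min H (H * (\<alpha>' - H) / 4)"
  \<comment> \<open>Strictly between \<open>H - \<epsilon>\<close> and \<open>H\<close>: the spare
    factor \<open>h powr (\<epsilon> / 2)\<close> absorbs the random Hoelder constant once the mesh
    is fine enough, so the modulus holds with the deterministic tolerance.\<close>
  define \<gamma> where "\<gamma> = H - \<epsilon> / 2"
  have \<alpha>': "H < \<alpha>'" "\<alpha>' < \<alpha>" using \<alpha> by (auto simp: \<alpha>'_def)
  have \<epsilon>: "0 < \<epsilon>" "\<epsilon> \<le> H" using \<alpha>' Hurst_index by (auto simp: \<epsilon>_def)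
  have \<epsilon>\<alpha>: "H + 2 * \<epsilon> / H < \<alpha>'"
  proof -
    have "2 * \<epsilon> / H \<le> 2 * (H * (\<alpha>' - H) / 4) / H"
      using Hurst_index by (intro divide_right_mono mult_left_mono) (auto simp: \<epsilon>_def)
    also have "\<dots> = (\<alpha>' - H) / 2" using Hurst_index by simp
    also have "\<dots> < \<alpha>' - H" using \<alpha>'(1) by simp
    finally show ?thesis by (simp only: less_diff_eq add.commute)
  qed
  have \<gamma>: "0 < \<gamma>" "\<gamma> < H" using \<epsilon> Hurst_index by (auto simp: \<gamma>_def)
  let ?N = "\<lambda>T m \<omega>. {n\<in>{1..T * 2 ^ m}. \<forall>k<n. - ((1 / 2 ^ m) powr (H - \<epsilon>)) \<le> X (real n * (1 / 2 ^ m)) \<omega> - X (real k * (1 / 2 ^ m)) \<omega>}"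
  have "AE \<omega> in M. \<forall>j::nat. \<forall>\<^sub>F m::nat in sequentially. real (card (?N (Suc j) m \<omega>)) * (1 / 2 ^ m) powr \<alpha>' < 1"
    unfolding AE_all_countable by (intro allI AE_few_near_records \<epsilon> \<epsilon>\<alpha>) auto
  moreover have "AE \<omega> in M. \<forall>j::nat. \<exists>C>0. \<forall>s\<in>{0..real (Suc j)}. \<forall>t\<in>{0..real (Suc j)}. \<bar>X s \<omega> - X t \<omega>\<bar> \<le> C * \<bar>s - t\<bar> powr \<gamma>"
    unfolding AE_all_countable by (intro allI AE_hoelder \<gamma>)
  ultimately show ?thesis
    using AE_space
  proof eventually_elim
    case (elim \<omega>)
    let ?x = "\<lambda>t. X t \<omega>"
    have cont: "continuous_on {0..} ?x" by (rule continuous_paths[OF elim(3)])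
    have "hausdorff_measure \<alpha> (\<Union>j. record_set ?x \<inter> {0..real (Suc j)}) = 0"
    proof (rule hausdorff_measure_UN_eq_0)
      fix j :: nat and \<delta> \<theta> :: real assume \<delta>: "0 < \<delta>" and \<theta>: "0 < \<theta>"
      obtain C where C: "0 < C" "\<And>s t. s \<in> {0..real (Suc j)} \<Longrightarrow> t \<in> {0..real (Suc j)} \<Longrightarrow> \<bar>?x s - ?x t\<bar> \<le> C * \<bar>s - t\<bar> powr \<gamma>"
        using elim(2) by blast
      define e k where "e = \<epsilon> / 2" and "k = \<alpha> - \<alpha>'"
      have ek: "0 < e" "0 < k" using \<epsilon> \<alpha>' by (auto simp: e_def k_def)
      have "((\<lambda>m::nat. 1 / 2 ^ m :: real) \<longlonglongrightarrow> 0)" by real_asymp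
      then have 1: "\<forall>\<^sub>F m::nat in sequentially. 1 / 2 ^ m < \<delta>" using \<delta> by (rule order_tendstoD)
      have "((\<lambda>m::nat. (1 / 2 ^ m :: real) powr k) \<longlonglongrightarrow> 0)" using ek by real_asymp
      then have 2: "\<forall>\<^sub>F m::nat in sequentially. (1 / 2 ^ m) powr k < \<theta>" using \<theta> by (rule order_tendstoD)
      have "((\<lambda>m::nat. (1 / 2 ^ m :: real) powr e) \<longlonglongrightarrow> 0)" using ek by real_asymp
      then have 3: "\<forall>\<^sub>F m::nat in sequentially. (1 / 2 ^ m) powr e < 1 / C" by (rule order_tendstoD) (use C in simp)
      have "\<forall>\<^sub>F m::nat in sequentially. real (card (?N (Suc j) m \<omega>)) * (1 / 2 ^ m) powr \<alpha>' < 1" using elim(1) by blast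
      with 1 2 3 have "\<forall>\<^sub>F m::nat in sequentially. 1 / 2 ^ m < \<delta> \<and> (1 / 2 ^ m) powr k < \<theta> \<and> (1 / 2 ^ m) powr e < 1 / C
          \<and> real (card (?N (Suc j) m \<omega>)) * (1 / 2 ^ m) powr \<alpha>' < 1"
        by eventually_elim simp
      then obtain m :: nat where m: "1 / 2 ^ m < \<delta>" "(1 / 2 ^ m) powr k < \<theta>" "(1 / 2 ^ m) powr e < 1 / C"
        "real (card (?N (Suc j) m \<omega>)) * (1 / 2 ^ m) powr \<alpha>' < 1"
        using eventually_happens trivial_limit_sequentially by blast
      define h :: real where "h = 1 / 2 ^ m"
      have h: "0 < h" by (simp add: h_def)
      have mod: "\<bar>?x t - ?x s\<bar> \<le> h powr (H - \<epsilon>)" if "0 \<le> s" "s \<le> t" "t \<le> real (Suc j)" "t - s \<le> h" for s t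
      proof -
        have "\<bar>?x t - ?x s\<bar> \<le> C * \<bar>t - s\<bar> powr \<gamma>" using that by (intro C) auto
        also have "\<dots> \<le> C * h powr \<gamma>" using that C \<gamma> by (intro mult_left_mono powr_mono2) auto
        also have "\<gamma> = e + (H - \<epsilon>)" by (simp add: \<gamma>_def e_def)
        also have "C * h powr (e + (H - \<epsilon>)) = (C * h powr e) * h powr (H - \<epsilon>)" by (simp add: powr_add)
        also have "\<dots> \<le> 1 * h powr (H - \<epsilon>)"
          using m(3) C by (intro mult_right_mono) (auto simp: h_def field_simps)
        finally show ?thesis by simp
      qed
      obtain A where A: "A \<in> delta_coverings (record_set ?x \<inter> {0..real (Suc j)}) h"
        "alpha_value \<alpha> A \<le> ennreal (real (card (?N (Suc j) m \<omega>)) * h powr \<alpha>)"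
        using record_set_covering[OF cont _ _ h_def mod, of "Suc j" \<alpha>] \<alpha> Hurst_index by (auto simp: h_def)
      have "real (card (?N (Suc j) m \<omega>)) * h powr \<alpha> = (real (card (?N (Suc j) m \<omega>)) * h powr \<alpha>') * h powr k"
        by (simp add: k_def powr_add[symmetric] mult.assoc)
      also have "\<dots> \<le> 1 * h powr k"
        using m(4) by (intro mult_right_mono) (auto simp: h_def)
      also have "\<dots> \<le> \<theta>" using m(2) by (simp add: h_def)
      finally have "alpha_value \<alpha> A \<le> ennreal \<theta>"
        by (intro order_trans[OF A(2)] ennreal_leI)
      moreover have "A \<in> delta_coverings (record_set ?x \<inter> {0..real (Suc j)}) \<delta>"
        using A(1) m(1) by (auto simp: delta_coverings_def h_def intro: order_trans less_imp_le)
      ultimately show "\<exists>A\<in>delta_coverings (record_set ?x \<inter> {0..real (Suc j)}) \<delta>. alpha_value \<alpha> A \<le> ennreal \<theta>"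
        by blast
    qed
    moreover have "(\<Union>j. record_set ?x \<inter> {0..real (Suc j)}) = record_set ?x"
    proof (intro equalityI subsetI)
      fix t assume t: "t \<in> record_set ?x"
      obtain j :: nat where "t \<le> real j" using real_arch_simple by blast
      then have "t \<in> {0..real (Suc j)}" using t by (auto simp: record_set_def)
      then show "t \<in> (\<Union>j. record_set ?x \<inter> {0..real (Suc j)})" using t by blast
    qed auto
    ultimately show ?case by simp
  qed
qed

text \<open>The exceptional null set depends only on \<gamma>, so a single one serves the
  uncountably many exponents below \<gamma>.\<close>

lemma AE_hausdorff_measure_eq_infinity:
  assumes \<gamma>: "0 < \<gamma>" "\<gamma> < H"
  shows "AE \<omega> in M. \<forall>\<alpha>. 0 \<le> \<alpha> \<and> \<alpha> < \<gamma> \<longrightarrow> hausdorff_measure \<alpha> (record_set (\<lambda>t. X t \<omega>)) = \<infinity>"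
  using AE_hoelder[OF \<gamma>, of 1] AE_start_zero AE_positive_value AE_space
proof eventually_elim
  case (elim \<omega>)
  let ?x = "\<lambda>t. X t \<omega>"
  have cont: "continuous_on {0..} ?x" by (rule continuous_paths[OF elim(4)])
  obtain t where t: "t \<in> {0..1}" "0 < ?x t" using elim(3) by blast
  obtain C where C: "0 < C" "\<And>s t. s \<in> {0..1} \<Longrightarrow> t \<in> {0..1} \<Longrightarrow> \<bar>?x s - ?x t\<bar> \<le> C * \<bar>s - t\<bar> powr \<gamma>"
    using elim(1) by auto
  have "{0..?x t} \<subseteq> ?x ` (record_set ?x \<inter> {0..t})"
    using record_set_attains[OF cont elim(2), of t] t by (fastforce simp: image_iff)
  then show ?case
    using t C by (intro allI impI hausdorff_measure_eq_infinity[where \<gamma> = \<gamma> and S = "record_set ?x \<inter> {0..t}" and b = "?x t" and C = C and x = ?x])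
      (auto simp: dist_real_def)
qed

lemma AE_hausdorff_dim: "AE \<omega> in M. hausdorff_dim (record_set (\<lambda>t. X t \<omega>)) = ereal H"
proof -
  \<comment> \<open>The shift by 2 keeps even the first exponent positive, namely
    \<open>H / 2\<close>; the sequence tends to \<open>H\<close> from below.\<close>
  define \<gamma> where "\<gamma> i = H - H / real (i + 2)" for i :: nat
  have \<gamma>: "0 < \<gamma> i" "\<gamma> i < H" for i
    using Hurst_index by (auto simp: \<gamma>_def field_simps add_pos_nonneg)
  have \<gamma>_lim: "\<gamma> \<longlonglongrightarrow> H" unfolding \<gamma>_def[abs_def] by real_asymp
  have "AE \<omega> in M. \<forall>i::nat. hausdorff_measure (H + 1 / real (Suc i)) (record_set (\<lambda>t. X t \<omega>)) = 0"
    unfolding AE_all_countable by (intro allI AE_hausdorff_measure_eq_0) simp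
  moreover have "AE \<omega> in M. \<forall>i::nat. \<forall>\<alpha>. 0 \<le> \<alpha> \<and> \<alpha> < \<gamma> i \<longrightarrow> hausdorff_measure \<alpha> (record_set (\<lambda>t. X t \<omega>)) = \<infinity>"
    by (subst AE_all_countable) (intro allI AE_hausdorff_measure_eq_infinity \<gamma>)
  ultimately show ?thesis
  proof eventually_elim
    case (elim \<omega>)
    let ?E = "record_set (\<lambda>t. X t \<omega>)"
    show ?case
    proof (rule antisym)
      \<comment> \<open>Countably many exponents above \<open>H\<close> suffice, as each one with
        measure 0 is a member of the set whose infimum is taken.\<close>
      have "hausdorff_dim ?E \<le> ereal (H + 1 / real (Suc i))" for i
        unfolding hausdorff_dim_def using elim(1) Hurst_index by (intro Inf_lower) (auto intro!: exI[of _ "H + 1 / real (Suc i)"])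
      moreover have "(\<lambda>i. ereal (H + 1 / real (Suc i))) \<longlonglongrightarrow> ereal (H + 0)"
        using LIMSEQ_inverse_real_of_nat by (intro tendsto_intros) (simp add: inverse_eq_divide)
      ultimately show "hausdorff_dim ?E \<le> ereal H"
        by (intro tendsto_lowerbound[where F = sequentially and f = "\<lambda>i. ereal (H + 1 / real (Suc i))"]) auto
      show "ereal H \<le> hausdorff_dim ?E"
        unfolding hausdorff_dim_def
      proof (rule Inf_greatest, safe)
        fix \<alpha> :: real assume \<alpha>: "0 \<le> \<alpha>" "hausdorff_measure \<alpha> ?E < \<infinity>"
        show "ereal H \<le> ereal \<alpha>"
        proof (rule ccontr)
          assume "\<not> ereal H \<le> ereal \<alpha>"
          then have "\<forall>\<^sub>F i in sequentially. \<alpha> < \<gamma> i" by (intro order_tendstoD[OF \<gamma>_lim]) simp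
          then obtain i where "\<alpha> < \<gamma> i" using eventually_happens trivial_limit_sequentially by blast
          then show False using elim(2) \<alpha> by force
        qed
      qed
    qed
  qed
qed

end

theorem theorem1:
  fixes M :: "'a measure" and H :: real and X :: "real \<Rightarrow> 'a \<Rightarrow> real"
  assumes "0 < H" and "H < 1"
    and "fractional_brownian_motion M H X"
  shows "AE \<omega> in M. hausdorff_dim (record_set (\<lambda>t. X t \<omega>)) = ereal H"
  using assms(3) by (rule fractional_brownian_motion.AE_hausdorff_dim)

end
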